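(* Let $\mathcal{G}=(\mathcal{V},\mathcal{E})$ be an undirected graph on $n$ vertices with public edge lengths such that every pair of vertices $u,v$ has a unique shortest path $P(u,v)$, and let $w:\mathcal{E}\to\mathbb{R}^{\ge 0}$ be a private attribute function. For all privacy parameters $\varepsilon,\delta\in(0,1)$ there exists an efficient (polynomial-time) $(\varepsilon,\delta)$-differentially private algorithm which, given $\mathcal{G}$ and $w$, outputs estimates $\widehat f(u,v)$ for all pairs $u,v\in\mathcal{V}$ such that $$\Pr\left(\max_{u,v\in\mathcal{V}}\left|\widehat f(u,v)-f(u,v)\right| = O\!\left(\frac{n^{1/4}\log^{5/4} n\,\log^{1/2}(1/\delta)}{\varepsilon}\right)\right)\ge 1-\frac{1}{n},$$ where $f(u,v)=\sum_{e\in P(u,v)} w(e)$ is the counting query along the shortest path.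
   Context: The shortest paths (determined by the public edge lengths) are public; the attributes $w(e)$ are separate from the edge lengths and do not affect the shortest paths. Two attribute functions $w,w':\mathcal{E}\to\mathbb{R}^{\ge0}$ are neighboring if $\sum_{e\in\mathcal{E}}|w(e)-w'(e)|\le 1$. A randomized algorithm $\mathcal{A}$ taking $(\mathcal{G},w)$ as input is $(\varepsilon,\delta)$-differentially private if for all neighboring $w,w'$ and all sets $C$ of possible outputs, $\Pr[\mathcal{A}(\mathcal{G},w)\in C]\le e^{\varepsilon}\Pr[\mathcal{A}(\mathcal{G},w')\in C]+\delta$.
   Formalization: The constant hidden in O(.) is uniform for δ in (0,δ₀] for each fixed δ₀<1 and may depend on δ₀; one absolute constant for all δ in (0,1) is impossible, since log(1/δ) tends to 0 as δ tends to 1 (take ε=1/2, δ=1-4/n on a path). *)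

theory Defs
  imports "HOL-Probability.Probability" "HOL-Computational_Algebra.Polynomial"
begin

section \<open>Graphs, shortest paths and counting queries\<close>

text \<open>Vertices are \<open>0, \<dots>, n - 1\<close> and an undirected edge is a two-element set of vertices.
  The lengths outside \<open>edges G\<close> are irrelevant.\<close>

record graph =
  nverts :: nat
  edges :: "nat set set"
  len :: "nat set \<Rightarrow> real"

definition verts :: "graph \<Rightarrow> nat set" where
  "verts G = {..<nverts G}"

definition wf_graph :: "graph \<Rightarrow> bool" where
  "wf_graph G \<longleftrightarrow> 0 < nverts G \<and> edges G \<subseteq> {e. e \<subseteq> verts G \<and> card e = 2} \<and>
     (\<forall>e\<in>edges G. 0 \<le> len G e)"

fun path_edges :: "nat list \<Rightarrow> nat set list" where
  "path_edges (x # y # p) = {x, y} # path_edges (y # p)"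
| "path_edges _ = []"

definition is_path :: "graph \<Rightarrow> nat \<Rightarrow> nat \<Rightarrow> nat list \<Rightarrow> bool" where
  "is_path G u v p \<longleftrightarrow> p \<noteq> [] \<and> hd p = u \<and> last p = v \<and> distinct p \<and>
     set p \<subseteq> verts G \<and> set (path_edges p) \<subseteq> edges G"

definition path_len :: "graph \<Rightarrow> nat list \<Rightarrow> real" where
  "path_len G p = (\<Sum>e\<leftarrow>path_edges p. len G e)"

definition is_shortest_path :: "graph \<Rightarrow> nat \<Rightarrow> nat \<Rightarrow> nat list \<Rightarrow> bool" where
  "is_shortest_path G u v p \<longleftrightarrow> is_path G u v p \<and>
     (\<forall>q. is_path G u v q \<longrightarrow> path_len G p \<le> path_len G q)"

definition unique_shortest_paths :: "graph \<Rightarrow> bool" where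
  "unique_shortest_paths G \<longleftrightarrow> (\<forall>u\<in>verts G. \<forall>v\<in>verts G. \<exists>!p. is_shortest_path G u v p)"

definition shortest_path :: "graph \<Rightarrow> nat \<Rightarrow> nat \<Rightarrow> nat list" where
  "shortest_path G u v = (THE p. is_shortest_path G u v p)"

definition counting_query :: "graph \<Rightarrow> (nat set \<Rightarrow> real) \<Rightarrow> nat \<Rightarrow> nat \<Rightarrow> real" where
  "counting_query G w u v = (\<Sum>e\<in>set (path_edges (shortest_path G u v)). w e)"


section \<open>Differential privacy\<close>

definition is_attribute :: "graph \<Rightarrow> (nat set \<Rightarrow> real) \<Rightarrow> bool" where
  "is_attribute G w \<longleftrightarrow> (\<forall>e\<in>edges G. 0 \<le> w e)"

definition neighboring :: "graph \<Rightarrow> (nat set \<Rightarrow> real) \<Rightarrow> (nat set \<Rightarrow> real) \<Rightarrow> bool" where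
  "neighboring G w w' \<longleftrightarrow> is_attribute G w \<and> is_attribute G w' \<and>
     (\<Sum>e\<in>edges G. \<bar>w e - w' e\<bar>) \<le> 1"

text \<open>\<open>M w\<close> is the output distribution on attribute function \<open>w\<close>, the graph being fixed.\<close>

definition differentially_private ::
    "real \<Rightarrow> real \<Rightarrow> graph \<Rightarrow> ((nat set \<Rightarrow> real) \<Rightarrow> 'o measure) \<Rightarrow> bool" where
  "differentially_private \<epsilon> \<delta> G M \<longleftrightarrow>
     (\<forall>w w'. neighboring G w w' \<longrightarrow>
        (\<forall>C\<in>sets (M w). measure (M w) C \<le> exp \<epsilon> * measure (M w') C + \<delta>))"


section \<open>Randomized real-RAM programs\<close>

text \<open>
  Algorithms are programs of a randomized real RAM with unit cost per executed command. The
  memory consists of named arrays, addressed by lists of natural numbers, with natural or real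
  entries. Natural numbers can only be added, subtracted (truncated at 0) and compared; there is
  no multiplication and no rounding from reals to naturals, so that polynomially many steps only
  create naturals of polynomial bit length. Real operations are exact; those undefined
  mathematically take the values fixed by HOL (for instance \<open>x / 0 = 0\<close>).
  The only literals are natural numbers, so no real-valued advice can be hidden in a program.
  Randomness is a sequence \<open>\<omega>\<close> of independent standard normal variates; \<open>Sample\<close>
  stores the next unused one.
\<close>

record state =
  nmem :: "string \<Rightarrow> nat list \<Rightarrow> nat"
  rmem :: "string \<Rightarrow> nat list \<Rightarrow> real"
  drawn :: nat

datatype nexp =
    NConst nat
  | NGet string "nexp list"
  | NAdd nexp nexp
  | NSub nexp nexp

datatype rexp =
    OfNat nexp
  | RGet string "nexp list"
  | RAdd rexp rexp
  | RSub rexp rexp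
  | RMul rexp rexp
  | RDiv rexp rexp
  | RSqrt rexp
  | RLn rexp

datatype bexp =
    NLess nexp nexp
  | RLess rexp rexp
  | BNot bexp
  | BAnd bexp bexp

datatype com =
    Skip
  | NSet string "nexp list" nexp
  | RSet string "nexp list" rexp
  | Sample string "nexp list"
  | Seq com com
  | Cond bexp com com
  | While bexp com

primrec nval :: "state \<Rightarrow> nexp \<Rightarrow> nat" where
  "nval s (NConst k) = k"
| "nval s (NGet a is) = nmem s a (map (nval s) is)"
| "nval s (NAdd x y) = nval s x + nval s y"
| "nval s (NSub x y) = nval s x - nval s y"

primrec rval :: "state \<Rightarrow> rexp \<Rightarrow> real" where
  "rval s (OfNat x) = real (nval s x)"
| "rval s (RGet a is) = rmem s a (map (nval s) is)"
| "rval s (RAdd x y) = rval s x + rval s y"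
| "rval s (RSub x y) = rval s x - rval s y"
| "rval s (RMul x y) = rval s x * rval s y"
| "rval s (RDiv x y) = rval s x / rval s y"
| "rval s (RSqrt x) = sqrt (rval s x)"
| "rval s (RLn x) = ln (rval s x)"

primrec bval :: "state \<Rightarrow> bexp \<Rightarrow> bool" where
  "bval s (NLess x y) \<longleftrightarrow> nval s x < nval s y"
| "bval s (RLess x y) \<longleftrightarrow> rval s x < rval s y"
| "bval s (BNot b) \<longleftrightarrow> \<not> bval s b"
| "bval s (BAnd b c) \<longleftrightarrow> bval s b \<and> bval s c"

definition nset :: "string \<Rightarrow> nat list \<Rightarrow> nat \<Rightarrow> state \<Rightarrow> state" where
  "nset a i x s = s\<lparr>nmem := (nmem s)(a := (nmem s a)(i := x))\<rparr>"

definition rset :: "string \<Rightarrow> nat list \<Rightarrow> real \<Rightarrow> state \<Rightarrow> state" where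
  "rset a i x s = s\<lparr>rmem := (rmem s)(a := (rmem s a)(i := x))\<rparr>"

text \<open>\<open>exec \<omega> c s t s'\<close>: with randomness \<open>\<omega>\<close>, command \<open>c\<close> started in \<open>s\<close> terminates in \<open>s'\<close>
  after \<open>t\<close> steps.\<close>

inductive exec :: "(nat \<Rightarrow> real) \<Rightarrow> com \<Rightarrow> state \<Rightarrow> nat \<Rightarrow> state \<Rightarrow> bool" for \<omega> where
  Skip: "exec \<omega> Skip s 1 s"
| NSet: "exec \<omega> (NSet a is x) s 1 (nset a (map (nval s) is) (nval s x) s)"
| RSet: "exec \<omega> (RSet a is x) s 1 (rset a (map (nval s) is) (rval s x) s)"
| Sample: "exec \<omega> (Sample a is) s 1
    (rset a (map (nval s) is) (\<omega> (drawn s)) (s\<lparr>drawn := Suc (drawn s)\<rparr>))"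
| Seq: "exec \<omega> c1 s1 t1 s2 \<Longrightarrow> exec \<omega> c2 s2 t2 s3 \<Longrightarrow> exec \<omega> (Seq c1 c2) s1 (t1 + t2) s3"
| CondTrue: "bval s b \<Longrightarrow> exec \<omega> c1 s t s' \<Longrightarrow> exec \<omega> (Cond b c1 c2) s (Suc t) s'"
| CondFalse: "\<not> bval s b \<Longrightarrow> exec \<omega> c2 s t s' \<Longrightarrow> exec \<omega> (Cond b c1 c2) s (Suc t) s'"
| WhileFalse: "\<not> bval s b \<Longrightarrow> exec \<omega> (While b c) s 1 s"
| WhileTrue: "bval s1 b \<Longrightarrow> exec \<omega> c s1 t1 s2 \<Longrightarrow> exec \<omega> (While b c) s2 t2 s3 \<Longrightarrow>
    exec \<omega> (While b c) s1 (Suc (t1 + t2)) s3"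

lemma exec_deterministic:
  "exec \<omega> c s t s' \<Longrightarrow> exec \<omega> c s t' s'' \<Longrightarrow> t' = t \<and> s'' = s'"
proof (induction arbitrary: t' s'' rule: exec.induct)
  case (Seq c1 s1 t1 s2 c2 t2 s3)
  from Seq.prems show ?case by cases (use Seq.IH in blast)
next
  case (CondTrue s b c1 t s' c2)
  from CondTrue.prems show ?case by cases (use CondTrue in blast)+
next
  case (CondFalse s b c2 t s' c1)
  from CondFalse.prems show ?case by cases (use CondFalse in blast)+
next
  case (WhileFalse s b c)
  from WhileFalse.prems show ?case by cases (use WhileFalse in auto)
next
  case (WhileTrue s1 b c t1 s2 t2 s3)
  from WhileTrue.prems show ?case by cases (use WhileTrue in blast)+
qed (auto elim: exec.cases)


section \<open>Programs as randomized algorithms for all-pairs counting queries\<close>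

text \<open>All cells other than those of the input are initially 0. The edge set is given by its
  adjacency matrix; lengths and attributes are visible on edges only.\<close>

definition initial_state :: "real \<Rightarrow> real \<Rightarrow> graph \<Rightarrow> (nat set \<Rightarrow> real) \<Rightarrow> state" where
  "initial_state \<epsilon> \<delta> G w = \<lparr>
     nmem = (\<lambda>a i.
       if a = ''n'' \<and> i = [] then nverts G
       else if a = ''adj'' \<and> (\<exists>u v. i = [u, v] \<and> {u, v} \<in> edges G) then 1
       else 0),
     rmem = (\<lambda>a i.
       if a = ''eps'' \<and> i = [] then \<epsilon>
       else if a = ''delta'' \<and> i = [] then \<delta>
       else if a = ''len'' \<and> (\<exists>u v. i = [u, v] \<and> {u, v} \<in> edges G) then len G (set i)
       else if a = ''attr'' \<and> (\<exists>u v. i = [u, v] \<and> {u, v} \<in> edges G) then w (set i)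
       else 0),
     drawn = 0\<rparr>"

definition final_state :: "(nat \<Rightarrow> real) \<Rightarrow> com \<Rightarrow> state \<Rightarrow> state" where
  "final_state \<omega> c s = (THE s'. \<exists>t. exec \<omega> c s t s')"

definition estimates ::
    "com \<Rightarrow> real \<Rightarrow> real \<Rightarrow> graph \<Rightarrow> (nat set \<Rightarrow> real) \<Rightarrow> (nat \<Rightarrow> real) \<Rightarrow> nat \<times> nat \<Rightarrow> real" where
  "estimates c \<epsilon> \<delta> G w \<omega> =
     (\<lambda>(u, v)\<in>verts G \<times> verts G. rmem (final_state \<omega> c (initial_state \<epsilon> \<delta> G w)) ''out'' [u, v])"

definition randomness :: "(nat \<Rightarrow> real) measure" where
  "randomness = (\<Pi>\<^sub>M i\<in>UNIV. density lborel (\<lambda>x. ennreal (std_normal_density x)))"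

definition output_space :: "graph \<Rightarrow> (nat \<times> nat \<Rightarrow> real) measure" where
  "output_space G = (\<Pi>\<^sub>M uv\<in>verts G \<times> verts G. borel)"

definition mechanism ::
    "com \<Rightarrow> real \<Rightarrow> real \<Rightarrow> graph \<Rightarrow> (nat set \<Rightarrow> real) \<Rightarrow> (nat \<times> nat \<Rightarrow> real) measure" where
  "mechanism c \<epsilon> \<delta> G w = distr randomness (output_space G) (estimates c \<epsilon> \<delta> G w)"

text \<open>Halting within a time polynomial in the number of vertices, for every input and every
  outcome of the random choices. The measurability clause makes the estimates random variables,
  so that \<open>mechanism\<close> is a probability distribution.\<close>

definition polynomial_time :: "com \<Rightarrow> real \<Rightarrow> real \<Rightarrow> bool" where
  "polynomial_time c \<epsilon> \<delta> \<longleftrightarrow>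
     (\<exists>q :: nat poly. \<forall>G w. wf_graph G \<and> unique_shortest_paths G \<and> is_attribute G w \<longrightarrow>
        estimates c \<epsilon> \<delta> G w \<in> measurable randomness (output_space G) \<and>
        (\<forall>\<omega>. \<exists>t s'. exec \<omega> c (initial_state \<epsilon> \<delta> G w) t s' \<and> t \<le> poly q (nverts G)))"

end

theory Submission
  imports Defs
begin

text \<open>
  The algorithm adds Gaussian noise to the true answers. Every path with at least
  \<open>L = sqrt (n (ln n)\<^sup>3)\<close> vertices meets a greedy hitting set \<open>S\<close> of size \<open>O((n / L) ln n)\<close>. A pair
  whose path is not hit gets the sum of the noise of its fewer than \<open>L\<close> edges. If the path meets
  \<open>h \<in> S\<close>, the answer is \<open>f(h, u) + f(h, v)\<close> with noise from the shortest path tree of \<open>h\<close>: in an order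
  that inserts every vertex right after its parent, the values \<open>f(h, \<cdot>)\<close> have total variation at most
  twice the total weight, and factoring the prefix sum matrix into two Toeplitz matrices releases
  them with \<open>O(ln n)\<close> both for the squared sensitivity and for the variance at unit scale. Composing
  the \<open>|S|\<close> trees, both kinds of noise have variance
  \<open>O(sqrt n (ln n) powr (3/2) ln (1/\<delta>) / \<epsilon>\<^sup>2)\<close>; a union bound costs another factor \<open>sqrt (ln n)\<close>.
\<close>

section \<open>Gaussian noise\<close>

text \<open>The estimates are the exact answers plus a linear map, with public coefficients, of one
  standard Gaussian vector. So no composition theorem is needed for privacy: it suffices to
  translate that vector by some \<open>b\<close> which the linear map sends to the change of the
  answers, and to bound the squared norm of \<open>b\<close> by
  \<open>\<epsilon>\<^sup>2 / (4 * (ln (1 / \<delta>) + 1))\<close>. The edges and all the trees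
  together each take half of this budget, which fixes the constants 8 and 32 in the scales. The
  length \<open>L\<close> balances two variances. Up to the common factor
  \<open>ln (1 / \<delta>) / \<epsilon>\<^sup>2\<close>, edge noise costs \<open>L\<close>, while
  the trees cost \<open>|S| (ln n)^2\<close> with \<open>|S|\<close> about
  \<open>(n / L) ln n\<close>; equality means \<open>L^2 = n (ln n)^3\<close>. The coefficients are
  themselves computed in the memory that holds the attributes. A syntactic noninterference check on
  the first phase shows that they are the same for all attributes and all random outcomes, so
  privacy can be argued for fixed coefficients.\<close>

abbreviation stdn :: "real measure" where
  "stdn \<equiv> density lborel (\<lambda>x. ennreal (std_normal_density x))"

lemma prob_space_stdn: "prob_space stdn"
  by (rule prob_space_normal_density) simp

text \<open>One-dimensional Cameron-Martin formula: completing the square writes the translated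
  density as the standard one times \<open>exp (b * x - b\<^sup>2 / 2)\<close>.\<close>

lemma stdn_shift:
  assumes [measurable]: "A \<in> sets borel"
  shows "emeasure stdn {x. x + b \<in> A} = (\<integral>\<^sup>+x. ennreal (exp (b * x - b\<^sup>2 / 2)) * indicator A x \<partial>stdn)"
proof -
  have eq: "std_normal_density x * exp (b * x - b\<^sup>2 / 2) = std_normal_density (x - b)" for x
    by (simp add: std_normal_density_def exp_add[symmetric] exp_diff[symmetric] power2_eq_square field_simps)
       (simp add: exp_add[symmetric] field_simps)?
  have "emeasure stdn {x. x + b \<in> A} = (\<integral>\<^sup>+x. ennreal (std_normal_density x) * indicator A (x + b) \<partial>lborel)"
    by (subst emeasure_density) (auto intro!: nn_integral_cong simp: indicator_def)
  also have "\<dots> = (\<integral>\<^sup>+x. ennreal (std_normal_density (x - b)) * indicator A x \<partial>lborel)"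
    by (subst nn_integral_real_affine[where c = 1 and t = "-b"]) (auto)
  also have "\<dots> = (\<integral>\<^sup>+x. ennreal (std_normal_density x) * (ennreal (exp (b * x - b\<^sup>2 / 2)) * indicator A x) \<partial>lborel)"
    by (simp add: eq[symmetric] ennreal_mult' mult.assoc)
  also have "\<dots> = (\<integral>\<^sup>+x. ennreal (exp (b * x - b\<^sup>2 / 2)) * indicator A x \<partial>stdn)"
    by (subst nn_integral_density) auto
  finally show ?thesis .
qed

section \<open>Translations of an infinite product of Gaussians\<close>

lemma product_prob_space_stdn: "product_prob_space (\<lambda>_::nat. stdn)"
  by (intro product_prob_spaceI prob_space_stdn)

lemma prob_space_randomness: "prob_space randomness"
  unfolding randomness_def by (intro prob_space_PiM prob_space_stdn)

lemma sets_randomness [measurable_cong]: "sets randomness = sets (PiM UNIV (\<lambda>_. borel))"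
  unfolding randomness_def by (intro sets_PiM_cong) auto

lemma space_randomness [simp]: "space randomness = UNIV"
  by (auto simp: randomness_def space_PiM)

lemma measurable_randomness_component [measurable]: "(\<lambda>\<omega>. \<omega> k) \<in> borel_measurable randomness"
  by measurable

text \<open>Independence: the integrand lives on the finite marginal \<open>J\<close>, where Fubini
  splits it.\<close>

lemma nn_integral_randomness_prod:
  assumes "finite J" and [measurable]: "\<And>j. j \<in> J \<Longrightarrow> f j \<in> borel_measurable borel"
  shows "(\<integral>\<^sup>+\<omega>. (\<Prod>j\<in>J. f j (\<omega> j)) \<partial>randomness) = (\<Prod>j\<in>J. \<integral>\<^sup>+x. f j x \<partial>stdn)"
proof -
  interpret product_prob_space "\<lambda>_::nat. stdn" UNIV by (rule product_prob_space_stdn)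
  have "(\<Prod>j\<in>J. \<integral>\<^sup>+x. f j x \<partial>stdn) = (\<integral>\<^sup>+x. (\<Prod>j\<in>J. f j (x j)) \<partial>PiM J (\<lambda>_. stdn))"
    using assms by (subst product_nn_integral_prod) auto
  also have "\<dots> = (\<integral>\<^sup>+x. (\<Prod>j\<in>J. f j (x j)) \<partial>distr randomness (PiM J (\<lambda>_. stdn)) (\<lambda>x. restrict x J))"
    using distr_PiM_restrict_finite[of J] assms(1) by (simp add: randomness_def)
  also have "\<dots> = (\<integral>\<^sup>+\<omega>. (\<Prod>j\<in>J. f j (restrict \<omega> J j)) \<partial>randomness)"
  proof -
    have 1: "(\<lambda>x. restrict x J) \<in> measurable randomness (PiM J (\<lambda>_. stdn))"
      unfolding randomness_def by (rule measurable_restrict_subset) simp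
    have 2: "(\<lambda>x. \<Prod>j\<in>J. f j (x j)) \<in> borel_measurable (PiM J (\<lambda>_. stdn))"
    proof (rule borel_measurable_prod_ennreal)
      fix j assume "j \<in> J"
      then show "(\<lambda>x. f j (x j)) \<in> borel_measurable (PiM J (\<lambda>_. stdn))"
        by (intro measurable_compose[OF measurable_component_singleton]) auto
    qed
    show ?thesis using 2 by (subst nn_integral_distr[OF 1]) auto
  qed
  also have "\<dots> = (\<integral>\<^sup>+\<omega>. (\<Prod>j\<in>J. f j (\<omega> j)) \<partial>randomness)"
    by (intro nn_integral_cong prod.cong) auto
  finally show ?thesis by simp
qed

definition lin_form :: "nat \<Rightarrow> (nat \<Rightarrow> real) \<Rightarrow> (nat \<Rightarrow> real) \<Rightarrow> real" where
  "lin_form m a \<omega> = (\<Sum>k<m. a k * \<omega> k)"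

definition sq_norm :: "nat \<Rightarrow> (nat \<Rightarrow> real) \<Rightarrow> real" where
  "sq_norm m a = (\<Sum>k<m. (a k)\<^sup>2)"

lemma lin_form_measurable [measurable]: "lin_form m a \<in> borel_measurable randomness"
  unfolding lin_form_def by measurable

lemma shift_measurable [measurable]: "(\<lambda>\<omega> k. \<omega> k + b k) \<in> measurable randomness randomness"
  unfolding measurable_cong_sets[OF sets_randomness sets_randomness]
  by (rule measurable_PiM_single') (auto)

text \<open>Cameron-Martin for the infinite product. Only finitely many coordinates move, so the
  density is a finite product of one-dimensional ones; cylinders determine both measures.\<close>

lemma randomness_shift:
  assumes b: "\<And>k. k \<ge> m \<Longrightarrow> b k = 0"
  shows "distr randomness randomness (\<lambda>\<omega> k. \<omega> k + b k)
       = density randomness (\<lambda>\<omega>. ennreal (exp (lin_form m b \<omega> - sq_norm m b / 2)))"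
proof -
  have "distr randomness randomness (\<lambda>\<omega> k. \<omega> k + b k)
       = density randomness (\<lambda>\<omega>. ennreal (exp (lin_form m b \<omega> - sq_norm m b / 2)))" (is "?P = ?Q")
  proof (rule measure_eqI_PiM_infinite[where I = "UNIV :: nat set" and M = "\<lambda>_. borel"])
    show "finite_measure ?P"
      by (intro prob_space.finite_measure prob_space.prob_space_distr[OF prob_space_randomness]) simp
  next
    fix A :: "nat \<Rightarrow> real set" and J :: "nat set"
    assume J: "finite J" and A: "\<And>i. i \<in> J \<Longrightarrow> A i \<in> sets borel"
    \<comment> \<open>The cylinder over \<open>J\<close> is rewritten over the larger
      \<open>K\<close>, with trivial constraints outside \<open>J\<close>, so that every moved
      coordinate contributes its factor.\<close>
    define B where "B j = (if j \<in> J then A j else UNIV)" for j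
    define K where "K = J \<union> {..<m}"
    have [simp]: "finite K" using J by (simp add: K_def)
    have B [measurable]: "B j \<in> sets borel" for j using A by (auto simp: B_def)
    have emb: "prod_emb UNIV (\<lambda>_. borel) J (Pi\<^sub>E J A) = {\<omega>. \<forall>j\<in>K. \<omega> j \<in> B j}"
      by (auto simp: prod_emb_def B_def K_def PiE_def Pi_def extensional_def restrict_def)
    have m: "{\<omega>. \<forall>j\<in>K. \<omega> j \<in> B j} \<in> sets randomness"
    proof -
      have "{\<omega>\<in>space randomness. \<forall>j\<in>K. \<omega> j \<in> B j} \<in> sets randomness" by measurable
      then show ?thesis by simp
    qed
    have ind: "indicator {\<omega>. \<forall>j\<in>K. \<omega> j \<in> C j} \<omega> = (\<Prod>j\<in>K. indicator (C j) (\<omega> j) :: ennreal)" for C \<omega>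
      by (auto simp: indicator_def)
    have "emeasure ?P {\<omega>. \<forall>j\<in>K. \<omega> j \<in> B j} = emeasure randomness {\<omega>. \<forall>j\<in>K. \<omega> j \<in> {x. x + b j \<in> B j}}"
      using m by (subst emeasure_distr) (auto intro!: arg_cong[where f = "emeasure randomness"])
    also have "\<dots> = (\<integral>\<^sup>+\<omega>. (\<Prod>j\<in>K. indicator {x. x + b j \<in> B j} (\<omega> j)) \<partial>randomness)"
    proof -
      have "{\<omega>\<in>space randomness. \<forall>j\<in>K. \<omega> j + b j \<in> B j} \<in> sets randomness" by measurable
      then show ?thesis by (simp add: ind[symmetric])
    qed
    also have "\<dots> = (\<Prod>j\<in>K. emeasure stdn {x. x + b j \<in> B j})"
    proof -
      have *: "{x. x + b j \<in> B j} \<in> sets borel" for j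
      proof -
        have "{x\<in>space borel. x + b j \<in> B j} \<in> sets borel" by measurable
        then show ?thesis by simp
      qed
      show ?thesis using * by (subst nn_integral_randomness_prod) auto
    qed
    also have "\<dots> = (\<Prod>j\<in>K. \<integral>\<^sup>+x. ennreal (exp (b j * x - (b j)\<^sup>2 / 2)) * indicator (B j) x \<partial>stdn)"
      by (intro prod.cong refl stdn_shift) simp
    also have "\<dots> = (\<integral>\<^sup>+\<omega>. (\<Prod>j\<in>K. ennreal (exp (b j * \<omega> j - (b j)\<^sup>2 / 2)) * indicator (B j) (\<omega> j)) \<partial>randomness)"
      by (subst nn_integral_randomness_prod) auto
    also have "\<dots> = (\<integral>\<^sup>+\<omega>. ennreal (exp (lin_form m b \<omega> - sq_norm m b / 2)) * indicator {\<omega>. \<forall>j\<in>K. \<omega> j \<in> B j} \<omega> \<partial>randomness)"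
    proof (intro nn_integral_cong)
      fix \<omega> :: "nat \<Rightarrow> real"
      have "(\<Prod>j\<in>K. ennreal (exp (b j * \<omega> j - (b j)\<^sup>2 / 2))) = ennreal (exp (\<Sum>j\<in>K. b j * \<omega> j - (b j)\<^sup>2 / 2))"
        by (simp add: prod_ennreal exp_sum)
      also have "(\<Sum>j\<in>K. b j * \<omega> j - (b j)\<^sup>2 / 2) = (\<Sum>j<m. b j * \<omega> j - (b j)\<^sup>2 / 2)"
        by (rule sum.mono_neutral_right) (use J in \<open>auto simp: K_def b\<close>)
      also have "\<dots> = lin_form m b \<omega> - sq_norm m b / 2"
        by (simp add: lin_form_def sq_norm_def sum_subtractf sum_divide_distrib)
      finally show "(\<Prod>j\<in>K. ennreal (exp (b j * \<omega> j - (b j)\<^sup>2 / 2)) * indicator (B j) (\<omega> j)) =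
          ennreal (exp (lin_form m b \<omega> - sq_norm m b / 2)) * indicator {\<omega>. \<forall>j\<in>K. \<omega> j \<in> B j} \<omega>"
        by (simp add: prod.distrib ind)
    qed
    also have "\<dots> = emeasure ?Q {\<omega>. \<forall>j\<in>K. \<omega> j \<in> B j}"
      using m by (subst emeasure_density) (auto simp del: finite_Collect_le_nat)
    finally show "emeasure ?P (prod_emb UNIV (\<lambda>_. borel) J (Pi\<^sub>E J A)) = emeasure ?Q (prod_emb UNIV (\<lambda>_. borel) J (Pi\<^sub>E J A))"
      unfolding emb .
  qed (simp_all add: sets_randomness)
  then show ?thesis .
qed

text \<open>The Gaussian moment generating function without computing an integral: the density of a
  translation has total mass 1.\<close>

lemma nn_integral_exp_lin:
  "(\<integral>\<^sup>+\<omega>. ennreal (exp (lin_form m a \<omega>)) \<partial>randomness) = ennreal (exp (sq_norm m a / 2))"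
proof -
  \<comment> \<open>Cutting \<open>a\<close> off at \<open>m\<close> meets the support hypothesis of
    \<open>randomness_shift\<close> and changes neither the linear form nor its norm.\<close>
  define b where "b k = (if k < m then a k else 0)" for k
  have [simp]: "lin_form m b = lin_form m a" "sq_norm m b = sq_norm m a" by (auto simp: lin_form_def sq_norm_def b_def fun_eq_iff)
  have "(\<integral>\<^sup>+\<omega>. ennreal (exp (lin_form m a \<omega>)) \<partial>randomness)
      = (\<integral>\<^sup>+\<omega>. ennreal (exp (sq_norm m a / 2)) * ennreal (exp (lin_form m b \<omega> - sq_norm m b / 2)) \<partial>randomness)"
    by (simp add: ennreal_mult'[symmetric] exp_add[symmetric])
  also have "\<dots> = ennreal (exp (sq_norm m a / 2)) * emeasure (density randomness (\<lambda>\<omega>. ennreal (exp (lin_form m b \<omega> - sq_norm m b / 2)))) UNIV"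
    using sets.top[of randomness] by (subst nn_integral_cmult, simp, subst emeasure_density) (auto simp del: sets.top)
  also have "emeasure (density randomness (\<lambda>\<omega>. ennreal (exp (lin_form m b \<omega> - sq_norm m b / 2)))) UNIV = 1"
    using prob_space.emeasure_space_1[OF prob_space.prob_space_distr[OF prob_space_randomness shift_measurable[of b]]]
    by (subst randomness_shift[symmetric]) (auto simp: b_def)
  finally show ?thesis by simp
qed

section \<open>Gaussian tails and the Gaussian mechanism\<close>

lemma lin_form_scale: "lin_form m (\<lambda>k. c * a k) \<omega> = c * lin_form m a \<omega>"
  by (simp add: lin_form_def sum_distrib_left mult.assoc)

lemma sq_norm_scale: "sq_norm m (\<lambda>k. c * a k) = c\<^sup>2 * sq_norm m a"
  by (simp add: sq_norm_def sum_distrib_left power_mult_distrib)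

lemma sq_norm_nonneg [simp]: "0 \<le> sq_norm m a"
  by (simp add: sq_norm_def sum_nonneg)

text \<open>Chernoff bound. \<open>V\<close> is only an upper bound of the variance, so vanishing
  coefficients are covered too.\<close>

lemma gaussian_upper_tail:
  assumes V: "sq_norm m a \<le> V" "0 < V" and t: "0 \<le> t"
  shows "measure randomness {\<omega>. t \<le> lin_form m a \<omega>} \<le> exp (- t\<^sup>2 / (2 * V))"
proof -
  interpret prob_space randomness by (rule prob_space_randomness)
  \<comment> \<open>The minimizer of the exponent
    \<open>- l * t + l\<^sup>2 * V / 2\<close>.\<close>
  define l where "l = t / V"
  have l: "0 \<le> l" using assms by (simp add: l_def)
  have ms: "{\<omega>. t \<le> lin_form m a \<omega>} \<in> sets randomness"
  proof -
    have "{\<omega>\<in>space randomness. t \<le> lin_form m a \<omega>} \<in> sets randomness" by measurable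
    then show ?thesis by simp
  qed
  have "ennreal (measure randomness {\<omega>. t \<le> lin_form m a \<omega>}) = (\<integral>\<^sup>+\<omega>. indicator {\<omega>. t \<le> lin_form m a \<omega>} \<omega> \<partial>randomness)"
    using ms by (simp add: emeasure_eq_measure)
  also have "\<dots> \<le> (\<integral>\<^sup>+\<omega>. ennreal (exp (- l * t)) * ennreal (exp (lin_form m (\<lambda>k. l * a k) \<omega>)) \<partial>randomness)"
  proof (intro nn_integral_mono)
    fix \<omega>
    have "1 \<le> exp (- l * t) * exp (lin_form m (\<lambda>k. l * a k) \<omega>)" if "t \<le> lin_form m a \<omega>"
      using mult_left_mono[OF that l] by (simp add: exp_add[symmetric] lin_form_scale)
    then show "indicator {\<omega>. t \<le> lin_form m a \<omega>} \<omega> \<le> ennreal (exp (- l * t)) * ennreal (exp (lin_form m (\<lambda>k. l * a k) \<omega>))"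
      by (auto simp: indicator_def ennreal_mult'[symmetric])
  qed
  also have "\<dots> = ennreal (exp (- l * t + l\<^sup>2 * sq_norm m a / 2))"
    by (subst nn_integral_cmult) (auto simp: nn_integral_exp_lin sq_norm_scale ennreal_mult'[symmetric] exp_add[symmetric])
  also have "\<dots> \<le> ennreal (exp (- l * t + l\<^sup>2 * V / 2))"
    using V by (intro ennreal_leI) (auto intro!: mult_left_mono)
  also have "- l * t + l\<^sup>2 * V / 2 = - t\<^sup>2 / (2 * V)"
    using V by (simp add: l_def power2_eq_square field_simps)
  finally show ?thesis by simp
qed

lemma gaussian_tail:
  assumes V: "sq_norm m a \<le> V" "0 < V" and t: "0 \<le> t"
  shows "measure randomness {\<omega>. t < \<bar>lin_form m a \<omega>\<bar>} \<le> 2 * exp (- t\<^sup>2 / (2 * V))"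
proof -
  interpret prob_space randomness by (rule prob_space_randomness)
  have ms: "{\<omega>. t \<le> lin_form m a \<omega>} \<in> sets randomness" for a
  proof -
    have "{\<omega>\<in>space randomness. t \<le> lin_form m a \<omega>} \<in> sets randomness" by measurable
    then show ?thesis by simp
  qed
  have neg: "lin_form m (\<lambda>k. - a k) \<omega> = - lin_form m a \<omega>" for \<omega> by (simp add: lin_form_def sum_negf)
  have "measure randomness {\<omega>. t < \<bar>lin_form m a \<omega>\<bar>}
      \<le> measure randomness ({\<omega>. t \<le> lin_form m a \<omega>} \<union> {\<omega>. t \<le> lin_form m (\<lambda>k. - a k) \<omega>})"
    using ms[of a] ms[of "\<lambda>k. - a k"] by (intro finite_measure_mono sets.Un) (auto simp: neg)
  also have "\<dots> \<le> measure randomness {\<omega>. t \<le> lin_form m a \<omega>} + measure randomness {\<omega>. t \<le> lin_form m (\<lambda>k. - a k) \<omega>}"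
    using ms by (intro measure_Un_le) auto
  also have "\<dots> \<le> exp (- t\<^sup>2 / (2 * V)) + exp (- t\<^sup>2 / (2 * V))"
    using assms by (intro add_mono gaussian_upper_tail) (auto simp: sq_norm_def)
  finally show ?thesis by simp
qed

text \<open>The density ratio of the shifted noise exceeds \<open>exp \<epsilon>\<close> only where \<open>lin_form m b\<close> is large; under
  the shifted measure this is a Gaussian tail event, which contributes at most \<open>\<delta>\<close>.\<close>

lemma gaussian_mechanism:
  assumes b: "\<And>k. k \<ge> m \<Longrightarrow> b k = 0"
    and eps: "0 < \<epsilon>" "\<epsilon> < 1" and del: "0 < \<delta>" "\<delta> < 1"
    and sens: "sq_norm m b \<le> \<epsilon>\<^sup>2 / (4 * (ln (1 / \<delta>) + 1))"
    and A: "A \<in> sets randomness"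
  shows "measure randomness {\<omega>. (\<lambda>k. \<omega> k + b k) \<in> A} \<le> exp \<epsilon> * measure randomness A + \<delta>"
proof -
  interpret prob_space randomness by (rule prob_space_randomness)
  define L where "L = ln (1 / \<delta>)"
  have L: "0 < L" using del by (simp add: L_def)
  define B where "B = {\<omega>. \<epsilon> < lin_form m b \<omega> - sq_norm m b / 2}"
  have B: "B \<in> sets randomness"
  proof -
    have "{\<omega>\<in>space randomness. \<epsilon> < lin_form m b \<omega> - sq_norm m b / 2} \<in> sets randomness" by measurable
    then show ?thesis by (simp add: B_def)
  qed
  let ?sh = "\<lambda>\<omega> k. \<omega> k + b k"
  let ?D = "distr randomness randomness ?sh"
  have shift_lin: "lin_form m b (?sh \<omega>) = lin_form m b \<omega> + sq_norm m b" for \<omega>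
    by (simp add: lin_form_def sq_norm_def sum.distrib distrib_left power2_eq_square)
  have [measurable]: "A \<in> sets randomness" "B \<in> sets randomness" by fact+
  have "emeasure ?D (A - B) = (\<integral>\<^sup>+\<omega>. ennreal (exp (lin_form m b \<omega> - sq_norm m b / 2)) * indicator (A - B) \<omega> \<partial>randomness)"
    by (subst randomness_shift[of m b, OF b], simp, subst emeasure_density) auto
  also have "\<dots> \<le> (\<integral>\<^sup>+\<omega>. ennreal (exp \<epsilon>) * indicator A \<omega> \<partial>randomness)"
    by (intro nn_integral_mono) (auto simp: indicator_def B_def intro!: ennreal_leI)
  also have "\<dots> = ennreal (exp \<epsilon> * measure randomness A)"
    by (subst nn_integral_cmult_indicator) (auto simp: emeasure_eq_measure ennreal_mult)
  finally have 1: "measure ?D (A - B) \<le> exp \<epsilon> * measure randomness A"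
    by (simp add: finite_measure.emeasure_eq_measure
        prob_space.finite_measure[OF prob_space_distr[OF shift_measurable]])
  \<comment> \<open>The summand 1 next to \<open>L\<close> keeps the squared norm below
    \<open>\<epsilon> / 4\<close> even when \<open>\<delta>\<close> is close to 1 and
    \<open>L\<close> close to 0.\<close>
  have s: "sq_norm m b \<le> \<epsilon>\<^sup>2 / (4 * (L + 1))" "\<epsilon>\<^sup>2 / (4 * (L + 1)) \<le> \<epsilon> / 4"
  proof -
    show "sq_norm m b \<le> \<epsilon>\<^sup>2 / (4 * (L + 1))" using sens by (simp add: L_def)
    have "\<epsilon>\<^sup>2 / (4 * (L + 1)) \<le> \<epsilon>\<^sup>2 / 4" using L by (intro divide_left_mono) auto
    also have "\<dots> \<le> \<epsilon> / 4" using eps by (simp add: power2_eq_square mult_left_le)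
    finally show "\<epsilon>\<^sup>2 / (4 * (L + 1)) \<le> \<epsilon> / 4" .
  qed
  have "measure ?D B = measure randomness {\<omega>. ?sh \<omega> \<in> B}"
    by (subst measure_distr) (auto simp: vimage_def)
  \<comment> \<open>After the translation the event reads
    \<open>\<epsilon> < lin_form m b \<omega> + sq_norm m b / 2\<close>, and the last term is at
    most \<open>\<epsilon> / 8\<close>.\<close>
  also have "\<dots> \<le> measure randomness {\<omega>. 7 / 8 * \<epsilon> \<le> lin_form m b \<omega>}"
  proof (rule finite_measure_mono)
    show "{\<omega>. ?sh \<omega> \<in> B} \<subseteq> {\<omega>. 7 / 8 * \<epsilon> \<le> lin_form m b \<omega>}"
      using order.trans[OF s] by (auto simp: B_def shift_lin)
    have "{\<omega>\<in>space randomness. 7 / 8 * \<epsilon> \<le> lin_form m b \<omega>} \<in> sets randomness" by measurable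
    then show "{\<omega>. 7 / 8 * \<epsilon> \<le> lin_form m b \<omega>} \<in> sets randomness" by simp
  qed
  also have "\<dots> \<le> exp (- (7 / 8 * \<epsilon>)\<^sup>2 / (2 * (\<epsilon>\<^sup>2 / (4 * (L + 1)))))"
    using s L eps by (intro gaussian_upper_tail) auto
  \<comment> \<open>The factor 49/32 is twice the square of 7/8. It exceeds 1, so the tail drops
    below \<open>exp (- L)\<close>.\<close>
  also have "- (7 / 8 * \<epsilon>)\<^sup>2 / (2 * (\<epsilon>\<^sup>2 / (4 * (L + 1)))) = - (49 / 32) * (L + 1)"
    using eps L by (simp add: power2_eq_square field_simps)
  also have "exp (- (49 / 32) * (L + 1)) \<le> exp (- L)" using L by simp
  also have "\<dots> = \<delta>" using del by (simp add: L_def ln_div)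
  finally have 2: "measure ?D B \<le> \<delta>" .
  have "measure randomness {\<omega>. ?sh \<omega> \<in> A} = measure ?D A"
    by (subst measure_distr) (auto simp: vimage_def)
  also have "\<dots> \<le> measure ?D ((A - B) \<union> B)"
    by (intro finite_measure.finite_measure_mono
        prob_space.finite_measure[OF prob_space_distr[OF shift_measurable]]) auto
  also have "\<dots> \<le> measure ?D (A - B) + measure ?D B"
    by (intro measure_Un_le) auto
  finally show ?thesis using 1 2 by simp
qed

section \<open>A square root of the prefix sum matrix\<close>

text \<open>The coefficients of \<open>(1 - x) powr (-1/2)\<close>: the lower triangular Toeplitz matrix they define is a
  square root of the prefix sum matrix, with rows and columns of squared norm \<open>O(log n)\<close>.\<close>

fun sqrt_coef :: "nat \<Rightarrow> real" where
  "sqrt_coef 0 = 1"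
| "sqrt_coef (Suc k) = sqrt_coef k * (2 * real k + 1) / (2 * real k + 2)"

text \<open>Identifies the recursion with binomial series coefficients, so that Vandermonde's
  identity applies.\<close>

lemma sqrt_coef_gchoose: "sqrt_coef k = (-1) ^ k * ((-1/2) gchoose k)"
proof (induction k)
  case (Suc k)
  have "((-1/2 :: real) gchoose Suc k) = ((-1/2) gchoose k) * (-1/2 - real k) / real (Suc k)"
    using gbinomial_absorption'[of "Suc k" "-1/2 :: real"] gbinomial_mult_1[of "-1/2 :: real" k]
    by (simp add: field_simps)
  then show ?case using Suc by (simp del: gbinomial_Suc) (simp add: field_simps)
qed simp

text \<open>The square of the generating function is \<open>1 / (1 - x)\<close>, all of whose
  coefficients are 1.\<close>

lemma sqrt_coef_convolution: "(\<Sum>k\<le>n. sqrt_coef k * sqrt_coef (n - k)) = 1"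
proof -
  have "(\<Sum>k\<le>n. sqrt_coef k * sqrt_coef (n - k)) = (\<Sum>k\<le>n. (-1) ^ n * (((-1/2) gchoose k) * ((-1/2) gchoose (n - k))))"
    by (intro sum.cong refl) (simp add: sqrt_coef_gchoose power_add[symmetric])
  also have "\<dots> = (-1) ^ n * (((-1/2) + (-1/2)) gchoose n)"
    unfolding sum_distrib_left[symmetric] gbinomial_Vandermonde[symmetric] atMost_atLeast0 ..
  also have "(((-1/2) + (-1/2)) gchoose n) = ((-1 :: real) gchoose n)" by simp
  also have "\<dots> = (-1) ^ n"
    using gbinomial_minus[of "1 :: real" n] by (simp add: binomial_gbinomial[symmetric])
  finally show ?thesis by (simp add: power_mult_distrib[symmetric])
qed

text \<open>Harmonic decay of the squares is what makes row and column norms logarithmic.\<close>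

lemma sqrt_coef_sq_le: "(sqrt_coef k)\<^sup>2 \<le> 1 / (real k + 1)"
proof (induction k)
  case (Suc k)
  have "(sqrt_coef (Suc k))\<^sup>2 = (sqrt_coef k)\<^sup>2 * ((2 * real k + 1) / (2 * real k + 2))\<^sup>2"
    by (simp add: power_mult_distrib power_divide)
  also have "\<dots> \<le> 1 / (real k + 1) * ((2 * real k + 1) / (2 * real k + 2))\<^sup>2"
    by (intro mult_right_mono Suc) auto
  also have "\<dots> \<le> 1 / (real (Suc k) + 1)"
  proof -
    have "(2 * real k + 1)\<^sup>2 * (real k + 2) \<le> (real k + 1) * (2 * real k + 2)\<^sup>2"
      by (simp add: power2_eq_square algebra_simps)
    then show ?thesis by (simp add: power_divide divide_simps add_ac)
  qed
  finally show ?case .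
qed simp

text \<open>Harmonic sum against the logarithm, through \<open>ln x \<le> x - 1\<close> at
  \<open>x = n / (n + 1)\<close>.\<close>

lemma sqrt_coef_sum_sq_le: "0 < n \<Longrightarrow> (\<Sum>k<n. (sqrt_coef k)\<^sup>2) \<le> 1 + ln (real n)"
proof (induction n rule: nat_induct_non_zero)
  case (Suc n)
  have "1 / (real n + 1) \<le> ln (real (Suc n)) - ln (real n)"
  proof -
    have "ln (real n / real (Suc n)) \<le> real n / real (Suc n) - 1"
      using Suc.hyps by (intro ln_le_minus_one) auto
    then show ?thesis using Suc.hyps by (simp add: ln_div field_simps)
  qed
  then show ?case using Suc.IH sqrt_coef_sq_le[of n] by simp
qed simp

section \<open>Total variation along a list and the factored prefix sums\<close>

fun variation :: "('a \<Rightarrow> real) \<Rightarrow> 'a list \<Rightarrow> real" where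
  "variation g (x # y # xs) = \<bar>g y - g x\<bar> + variation g (y # xs)"
| "variation g _ = 0"

lemma variation_conv_sum: "variation g xs = (\<Sum>i<length xs - 1. \<bar>g (xs ! Suc i) - g (xs ! i)\<bar>)"
proof (induction g xs rule: variation.induct)
  case (1 g x y xs)
  then show ?case by (simp add: sum.lessThan_Suc_shift del: sum.lessThan_Suc)
qed auto

text \<open>The new value is a detour from \<open>x\<close> on the way to its successor; the
  triangle inequality charges the way there and back.\<close>

lemma variation_insert: "variation g (as @ x # y # bs) \<le> variation g (as @ x # bs) + 2 * \<bar>g y - g x\<bar>"
proof (induction as)
  case Nil
  show ?case by (cases bs) auto
next
  case (Cons a as)
  then show ?case by (cases as) auto
qed

text \<open>After exchanging the sums, the coefficient of \<open>z l\<close> is a convolution of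
  \<open>sqrt_coef\<close> with itself, hence 1.\<close>

lemma prefix_sum_factorization:
  fixes z :: "nat \<Rightarrow> real"
  defines "y \<equiv> \<lambda>i. \<Sum>j\<le>i. sqrt_coef (i - j) * z j"
  shows "(\<Sum>j\<le>i. sqrt_coef (i - j) * y j) = (\<Sum>j\<le>i. z j)"
proof -
  have "(\<Sum>j\<le>i. sqrt_coef (i - j) * y j) = (\<Sum>j\<le>i. \<Sum>l\<le>j. sqrt_coef (i - j) * (sqrt_coef (j - l) * z l))"
    by (simp add: y_def sum_distrib_left)
  also have "\<dots> = (\<Sum>j\<in>{..i}. \<Sum>l\<in>{l\<in>{..i}. l \<le> j}. sqrt_coef (i - j) * (sqrt_coef (j - l) * z l))"
    by (intro sum.cong refl) auto
  also have "\<dots> = (\<Sum>l\<in>{..i}. \<Sum>j\<in>{j\<in>{..i}. l \<le> j}. sqrt_coef (i - j) * (sqrt_coef (j - l) * z l))"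
    by (rule sum.swap_restrict) auto
  also have "\<dots> = (\<Sum>l\<le>i. z l)"
  proof (intro sum.cong refl)
    fix l assume l: "l \<in> {..i}"
    have "(\<Sum>j\<in>{j\<in>{..i}. l \<le> j}. sqrt_coef (i - j) * (sqrt_coef (j - l) * z l)) = (\<Sum>k\<le>i - l. sqrt_coef k * sqrt_coef (i - l - k)) * z l"
      unfolding sum_distrib_right using l
      by (intro sum.reindex_bij_witness[where i = "\<lambda>k. i - k" and j = "\<lambda>j. i - j"]) (auto simp: mult_ac)
    then show "(\<Sum>j\<in>{j\<in>{..i}. l \<le> j}. sqrt_coef (i - j) * (sqrt_coef (j - l) * z l)) = z l"
      using sqrt_coef_convolution[of "i - l"] by simp
  qed
  finally show ?thesis .
qed

text \<open>The sensitivity half of the factorization: a matrix maps the l1 ball of radius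
  \<open>B\<close> into an l2 ball whose squared radius is \<open>B\<^sup>2\<close> times the
  largest squared column norm.\<close>

lemma sqrt_coef_conv_sq_norm_le:
  fixes z :: "nat \<Rightarrow> real"
  assumes n: "0 < n" and z: "(\<Sum>j<n. \<bar>z j\<bar>) \<le> B"
  shows "(\<Sum>i<n. (\<Sum>j\<le>i. sqrt_coef (i - j) * z j)\<^sup>2) \<le> B\<^sup>2 * (1 + ln (real n))"
proof -
  define r where "r i j = (if j \<le> i then sqrt_coef (i - j) else 0)" for i j
  define S where "S = (\<Sum>j<n. \<bar>z j\<bar>)"
  have S: "0 \<le> S" "S \<le> B" using z by (auto simp: S_def sum_nonneg)
  have C: "0 \<le> 1 + ln (real n)" using n by simp
  have one: "(\<Sum>j\<le>i. sqrt_coef (i - j) * z j)\<^sup>2 \<le> S * (\<Sum>j<n. \<bar>z j\<bar> * (r i j)\<^sup>2)" if i: "i < n" for i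
  proof -
    have eq: "(\<Sum>j\<le>i. sqrt_coef (i - j) * z j) = (\<Sum>j<n. r i j * z j)"
      using i by (intro sum.mono_neutral_cong_left) (auto simp: r_def)
    \<comment> \<open>Prepares Cauchy-Schwarz with the weight \<open>\<bar>z j\<bar>\<close> split
      evenly over both factors.\<close>
    have "\<bar>\<Sum>j<n. r i j * z j\<bar> \<le> (\<Sum>j<n. sqrt \<bar>z j\<bar> * (sqrt \<bar>z j\<bar> * \<bar>r i j\<bar>))"
    proof (rule order.trans[OF sum_abs], rule sum_mono)
      fix j
      show "\<bar>r i j * z j\<bar> \<le> sqrt \<bar>z j\<bar> * (sqrt \<bar>z j\<bar> * \<bar>r i j\<bar>)"
        by (simp add: abs_mult mult.assoc[symmetric])
    qed
    then have "(\<Sum>j<n. r i j * z j)\<^sup>2 \<le> (\<Sum>j<n. sqrt \<bar>z j\<bar> * (sqrt \<bar>z j\<bar> * \<bar>r i j\<bar>))\<^sup>2"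
      by (metis abs_ge_zero power2_abs power_mono)
    also have "\<dots> \<le> (\<Sum>j<n. (sqrt \<bar>z j\<bar>)\<^sup>2) * (\<Sum>j<n. (sqrt \<bar>z j\<bar> * \<bar>r i j\<bar>)\<^sup>2)"
      by (rule Cauchy_Schwarz_ineq_sum)
    finally show ?thesis unfolding eq by (simp add: power_mult_distrib S_def)
  qed
  have col: "(\<Sum>i<n. (r i j)\<^sup>2) \<le> 1 + ln (real n)" if j: "j < n" for j
  proof -
    have "(\<Sum>i<n. (r i j)\<^sup>2) = (\<Sum>k<n - j. (sqrt_coef k)\<^sup>2)"
    proof -
      have "(\<Sum>i<n. (r i j)\<^sup>2) = (\<Sum>i\<in>{j..<n}. (sqrt_coef (i - j))\<^sup>2)"
        by (rule sum.mono_neutral_cong_right) (auto simp: r_def)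
      also have "\<dots> = (\<Sum>k<n - j. (sqrt_coef k)\<^sup>2)"
        by (rule sum.reindex_bij_witness[where i = "\<lambda>k. k + j" and j = "\<lambda>i. i - j"]) auto
      finally show ?thesis .
    qed
    also have "\<dots> \<le> (\<Sum>k<n. (sqrt_coef k)\<^sup>2)" by (intro sum_mono2) auto
    also have "\<dots> \<le> 1 + ln (real n)" by (rule sqrt_coef_sum_sq_le[OF n])
    finally show ?thesis .
  qed
  have "(\<Sum>i<n. (\<Sum>j\<le>i. sqrt_coef (i - j) * z j)\<^sup>2) \<le> (\<Sum>i<n. S * (\<Sum>j<n. \<bar>z j\<bar> * (r i j)\<^sup>2))"
    by (intro sum_mono one) auto
  also have "\<dots> = S * (\<Sum>j<n. \<bar>z j\<bar> * (\<Sum>i<n. (r i j)\<^sup>2))"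
    by (simp add: sum_distrib_left, subst sum.swap, simp)
  also have "\<dots> \<le> S * (\<Sum>j<n. \<bar>z j\<bar> * (1 + ln (real n)))"
    by (intro mult_left_mono sum_mono col S) auto
  also have "\<dots> = S\<^sup>2 * (1 + ln (real n))"
    by (simp add: sum_distrib_right[symmetric] S_def[symmetric] power2_eq_square)
  also have "\<dots> \<le> B\<^sup>2 * (1 + ln (real n))" using S C by (intro mult_right_mono power_mono) auto
  finally show ?thesis .
qed

text \<open>The variance half of the factorization: rows in place of columns.\<close>

lemma sqrt_coef_row_le:
  assumes "i < n"
  shows "(\<Sum>j<n. (if j \<le> i then sqrt_coef (i - j) else 0)\<^sup>2) \<le> 1 + ln (real n)"
proof -
  have "(\<Sum>j<n. (if j \<le> i then sqrt_coef (i - j) else 0)\<^sup>2) = (\<Sum>j\<le>i. (sqrt_coef (i - j))\<^sup>2)"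
    using assms by (intro sum.mono_neutral_cong_right) auto
  also have "\<dots> = (\<Sum>k<Suc i. (sqrt_coef k)\<^sup>2)"
    by (rule sum.reindex_bij_witness[where i = "\<lambda>k. i - k" and j = "\<lambda>j. i - j"]) auto
  also have "\<dots> \<le> (\<Sum>k<n. (sqrt_coef k)\<^sup>2)" using assms by (intro sum_mono2) auto
  also have "\<dots> \<le> 1 + ln (real n)" using assms by (intro sqrt_coef_sum_sq_le) auto
  finally show ?thesis .
qed

section \<open>Shortest path trees\<close>

lemma path_edges_append: "path_edges (p @ x # q) = path_edges (p @ [x]) @ path_edges (x # q)"
proof (induction p)
  case (Cons a p)
  then show ?case by (cases p) auto
qed simp

lemma path_edges_rev: "path_edges (rev p) = rev (path_edges p)"
proof (induction p rule: path_edges.induct)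
  case (1 x y p)
  then show ?case by (simp add: path_edges_append[of "rev p" y "[x]"] insert_commute)
qed auto

lemma path_edges_subset: "e \<in> set (path_edges p) \<Longrightarrow> e \<subseteq> set p"
  by (induction p rule: path_edges.induct) auto

lemma distinct_path_edges: "distinct p \<Longrightarrow> distinct (path_edges p)"
  by (induction p rule: path_edges.induct) (auto dest: path_edges_subset)

lemma length_path_edges: "length (path_edges p) = length p - 1"
  by (induction p rule: path_edges.induct) auto

lemma path_len_append: "path_len G (p @ x # q) = path_len G (p @ [x]) + path_len G (x # q)"
  by (simp add: path_len_def path_edges_append[of p x q])

lemma path_len_rev: "path_len G (rev p) = path_len G p"
  by (simp add: path_len_def path_edges_rev rev_map[symmetric])

lemma is_path_rev: "is_path G u v p \<Longrightarrow> is_path G v u (rev p)"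
  by (auto simp: is_path_def path_edges_rev hd_rev last_rev)

lemma list_crossing:
  assumes "q \<noteq> []" "hd q \<in> X" "last q \<notin> X"
  shows "\<exists>q1 a b q2. q = q1 @ a # b # q2 \<and> a \<in> X \<and> b \<notin> X"
  using assms
proof (induction q)
  case (Cons a q)
  then have "q \<noteq> []" by (cases q) auto
  then obtain b r where q: "q = b # r" by (cases q) auto
  show ?case
  proof (cases "b \<in> X")
    case True
    then obtain q1 c d q2 where "q = q1 @ c # d # q2" "c \<in> X" "d \<notin> X"
      using Cons q by auto
    then show ?thesis by (intro exI[of _ "a # q1"]) auto
  next
    case False
    then show ?thesis using Cons.prems q by (intro exI[of _ "[]"]) auto
  qed
qed simp

text \<open>Inserting every new vertex right after its parent costs only the new edge, twice, in the total
  variation of any path sum along the order.\<close>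

inductive tree_order :: "graph \<Rightarrow> nat \<Rightarrow> nat list \<Rightarrow> bool" for G s where
  init: "tree_order G s [s]"
| ins: "tree_order G s (as @ x # bs) \<Longrightarrow> y \<notin> set (as @ x # bs) \<Longrightarrow> y \<in> verts G \<Longrightarrow>
    {x, y} \<in> edges G \<Longrightarrow> shortest_path G s y = shortest_path G s x @ [y] \<Longrightarrow>
    tree_order G s (as @ x # y # bs)"

lemma tree_order_distinct: "tree_order G s xs \<Longrightarrow> distinct xs"
  by (induction rule: tree_order.induct) auto

lemma tree_order_verts: "tree_order G s xs \<Longrightarrow> s \<in> verts G \<Longrightarrow> set xs \<subseteq> verts G"
  by (induction rule: tree_order.induct) auto

lemma tree_order_hd: "tree_order G s xs \<Longrightarrow> xs \<noteq> [] \<and> hd xs = s"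
proof (induction rule: tree_order.induct)
  case (ins as x bs y)
  then show ?case by (cases as) auto
qed simp

section \<open>Uniqueness, prefixes and growth of shortest path trees\<close>

locale usp_graph =
  fixes G :: graph
  assumes wf: "wf_graph G" and usp: "unique_shortest_paths G"
begin

abbreviation "n \<equiv> nverts G"

abbreviation P :: "nat \<Rightarrow> nat \<Rightarrow> nat list" where
  "P \<equiv> shortest_path G"

abbreviation pedges :: "nat \<Rightarrow> nat \<Rightarrow> nat set set" where
  "pedges u v \<equiv> set (path_edges (P u v))"

lemma n_pos: "0 < n" using wf by (simp add: wf_graph_def)

lemma ln_n_nonneg: "0 \<le> ln (real n)"
  using n_pos by simp

lemma len_nonneg: "e \<in> edges G \<Longrightarrow> 0 \<le> len G e"
  using wf by (simp add: wf_graph_def)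

lemma edge_verts: "e \<in> edges G \<Longrightarrow> e \<subseteq> verts G" "e \<in> edges G \<Longrightarrow> card e = 2"
  using wf by (auto simp: wf_graph_def)

lemma finite_edges: "finite (edges G)"
proof (rule finite_subset)
  show "edges G \<subseteq> Pow (verts G)" using edge_verts(1) by blast
qed (simp add: verts_def)

lemma shortest_P: "u \<in> verts G \<Longrightarrow> v \<in> verts G \<Longrightarrow> is_shortest_path G u v (P u v)"
  unfolding shortest_path_def by (rule theI') (use usp in \<open>simp add: unique_shortest_paths_def\<close>)

lemma P_eqI:
  assumes "is_shortest_path G u v p"
  shows "P u v = p"
proof -
  have "u \<in> verts G" "v \<in> verts G"
    using assms hd_in_set[of p] last_in_set[of p] by (auto simp: is_shortest_path_def is_path_def)
  then have "\<exists>!p. is_shortest_path G u v p"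
    using usp unfolding unique_shortest_paths_def by blast
  then show ?thesis unfolding shortest_path_def using assms by (rule the1_equality)
qed

lemma path_P: "u \<in> verts G \<Longrightarrow> v \<in> verts G \<Longrightarrow> is_path G u v (P u v)"
  using shortest_P by (simp add: is_shortest_path_def)

lemma P_facts:
  assumes "u \<in> verts G" "v \<in> verts G"
  shows "P u v \<noteq> []" "hd (P u v) = u" "last (P u v) = v" "distinct (P u v)"
    "set (P u v) \<subseteq> verts G" "pedges u v \<subseteq> edges G" "u \<in> set (P u v)" "v \<in> set (P u v)"
proof -
  show *: "P u v \<noteq> []" "hd (P u v) = u" "last (P u v) = v" "distinct (P u v)"
    "set (P u v) \<subseteq> verts G" "pedges u v \<subseteq> edges G"
    using path_P[OF assms] by (auto simp: is_path_def)
  show "u \<in> set (P u v)" "v \<in> set (P u v)" using hd_in_set[of "P u v"] last_in_set[of "P u v"] * by simp_all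
qed

lemma path_len_nonneg: "set (path_edges p) \<subseteq> edges G \<Longrightarrow> 0 \<le> path_len G p"
  unfolding path_len_def by (intro sum_list_nonneg) (auto intro: len_nonneg)

lemma P_self: "s \<in> verts G \<Longrightarrow> P s s = [s]"
proof (rule P_eqI, unfold is_shortest_path_def, intro conjI allI impI)
  assume s: "s \<in> verts G"
  then show "is_path G s s [s]" by (simp add: is_path_def)
  fix q assume "is_path G s s q"
  then show "path_len G [s] \<le> path_len G q"
    using path_len_nonneg[of q] by (simp add: is_path_def path_len_def[of G "[s]"])
qed

lemma P_rev:
  assumes "u \<in> verts G" "v \<in> verts G"
  shows "P v u = rev (P u v)"
proof (intro P_eqI, unfold is_shortest_path_def, intro conjI allI impI)
  show "is_path G v u (rev (P u v))" by (intro is_path_rev path_P assms)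
  fix q assume "is_path G v u q"
  then have "path_len G (P u v) \<le> path_len G (rev q)"
    using shortest_P[OF assms] is_path_rev by (auto simp: is_shortest_path_def)
  then show "path_len G (rev (P u v)) \<le> path_len G q" by (simp add: path_len_rev)
qed

lemma pedges_commute: "u \<in> verts G \<Longrightarrow> v \<in> verts G \<Longrightarrow> pedges v u = pedges u v"
  using P_rev[of u v] path_edges_rev[of "P u v"] by simp

lemma length_P_le:
  assumes "u \<in> verts G" "v \<in> verts G"
  shows "length (P u v) \<le> n"
proof -
  have "length (P u v) = card (set (P u v))" using P_facts(4)[OF assms] by (simp add: distinct_card)
  also have "\<dots> \<le> card (verts G)" using P_facts(5)[OF assms] by (intro card_mono) (auto simp: verts_def)
  finally show ?thesis by (simp add: verts_def)
qed

lemma path_prefix: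
  assumes "is_path G u v (q1 @ h # q2)"
  shows "is_path G u h (q1 @ [h])"
proof -
  have "set (path_edges (q1 @ [h])) \<subseteq> set (path_edges (q1 @ h # q2))"
    by (subst path_edges_append[of q1 h q2]) simp
  moreover have "hd (q1 @ [h]) = hd (q1 @ h # q2)" by (cases q1) auto
  ultimately show ?thesis using assms by (auto simp: is_path_def)
qed

text \<open>A path through the cheapest edge leaving the closed set \<open>X\<close> stays simple,
  so uniqueness identifies it even in the presence of edges of length zero.\<close>

lemma dijkstra_step:
  assumes X: "X \<subseteq> verts G" "s \<in> X" "\<And>z. z \<in> X \<Longrightarrow> set (P s z) \<subseteq> X"
    and xy: "x \<in> X" "y \<in> verts G" "y \<notin> X" "{x, y} \<in> edges G"
    and min: "\<And>a b. a \<in> X \<Longrightarrow> b \<in> verts G \<Longrightarrow> b \<notin> X \<Longrightarrow> {a, b} \<in> edges G \<Longrightarrow>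
      path_len G (P s x) + len G {x, y} \<le> path_len G (P s a) + len G {a, b}"
  shows "P s y = P s x @ [y]" "path_len G (P s y) = path_len G (P s x) + len G {x, y}"
    "path_edges (P s y) = path_edges (P s x) @ [{x, y}]"
proof -
  have s: "s \<in> verts G" and x: "x \<in> verts G" using X xy by auto
  obtain p where p: "P s x = p @ [x]"
    using P_facts(1,3)[OF s x] by (metis append_butlast_last_id)
  have e: "path_edges (P s x @ [y]) = path_edges (P s x) @ [{x, y}]"
    by (simp add: p path_edges_append[of p x "[y]"])
  have l: "path_len G (P s x @ [y]) = path_len G (P s x) + len G {x, y}"
    by (simp add: path_len_def e)
  have "is_shortest_path G s y (P s x @ [y])"
    unfolding is_shortest_path_def
  proof (intro conjI allI impI)
    show "is_path G s y (P s x @ [y])"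
      using P_facts[OF s x] X(3)[OF xy(1)] xy e by (auto simp: is_path_def)
    fix q assume q: "is_path G s y q"
    \<comment> \<open>Any competitor leaves \<open>X\<close> through some edge
      \<open>{a, b}\<close>. Its part up to \<open>a\<close> is no shorter than
      \<open>P s a\<close>, the part after \<open>b\<close> has nonnegative length, and
      \<open>min\<close> compares the two crossing edges.\<close>
    then obtain q1 a b q2 where q_eq: "q = q1 @ a # b # q2" and ab: "a \<in> X" "b \<notin> X"
      using list_crossing[of q X] X(2) xy(3) by (auto simp: is_path_def)
    have es: "set (path_edges q) = set (path_edges (q1 @ [a])) \<union> {{a, b}} \<union> set (path_edges (b # q2))"
      using path_edges_append[of q1 a "b # q2"] by (auto simp: q_eq)
    have bv: "b \<in> verts G" and av: "a \<in> verts G" and sub: "set (path_edges q) \<subseteq> edges G"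
      using q by (auto simp: is_path_def q_eq)
    have "path_len G (P s a) \<le> path_len G (q1 @ [a])"
      using shortest_P[OF s av] path_prefix[of s y q1 a "b # q2"] q by (auto simp: q_eq is_shortest_path_def)
    moreover have "path_len G q = path_len G (q1 @ [a]) + len G {a, b} + path_len G (b # q2)"
      using path_len_append[of G q1 a "b # q2"] by (simp add: q_eq path_len_def)
    moreover have "0 \<le> path_len G (b # q2)" using es sub by (intro path_len_nonneg) auto
    moreover have "{a, b} \<in> edges G" using es sub by auto
    ultimately show "path_len G (P s x @ [y]) \<le> path_len G q"
      using min[OF ab(1) bv ab(2)] l by simp
  qed
  then show 1: "P s y = P s x @ [y]" by (rule P_eqI)
  show "path_len G (P s y) = path_len G (P s x) + len G {x, y}"
    "path_edges (P s y) = path_edges (P s x) @ [{x, y}]"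
    unfolding 1 by (fact l e)+
qed

text \<open>Shortest paths exist between all pairs, so the graph is connected and a tree stops
  growing only when it spans.\<close>

lemma crossing_edge:
  assumes "X \<subseteq> verts G" "s \<in> X" "X \<noteq> verts G"
  shows "\<exists>a b. a \<in> X \<and> b \<in> verts G \<and> b \<notin> X \<and> {a, b} \<in> edges G"
proof -
  obtain y where y: "y \<in> verts G" "y \<notin> X" using assms by auto
  have s: "s \<in> verts G" using assms by auto
  obtain q1 a b q2 where q: "P s y = q1 @ a # b # q2" "a \<in> X" "b \<notin> X"
    using list_crossing[of "P s y" X] P_facts(1-3)[OF s y(1)] assms y by auto
  have "{a, b} \<in> pedges s y" using path_edges_append[of q1 a "b # q2"] by (auto simp: q)
  then show ?thesis using q P_facts(5,6)[OF s y(1)] by (intro exI[of _ a] exI[of _ b]) auto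
qed

text \<open>Supplies the closedness that \<open>dijkstra_step\<close> asks of \<open>X\<close>, for
  the set of listed vertices.\<close>

lemma tree_order_closed:
  "tree_order G s xs \<Longrightarrow> s \<in> verts G \<Longrightarrow> z \<in> set xs \<Longrightarrow> set (P s z) \<subseteq> set xs"
proof (induction arbitrary: z rule: tree_order.induct)
  case (ins as x bs y)
  show ?case
  proof (cases "z = y")
    case True
    then show ?thesis using ins.IH[of x] ins.prems ins.hyps by auto
  next
    case False
    then show ?thesis using ins.IH[of z] ins.prems by auto
  qed
qed (simp add: P_self)

text \<open>Prefixes of shortest paths are shortest. Exchanging a prefix may produce a walk that is
  not simple, and edges may have length zero; reading the claim off the tree, where each path
  extends its parent's by one vertex, avoids the exchange.\<close>

lemma tree_order_prefix:
  "tree_order G s xs \<Longrightarrow> s \<in> verts G \<Longrightarrow> z \<in> set xs \<Longrightarrow> P s z = q1 @ h # q2 \<Longrightarrow> P s h = q1 @ [h]"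
proof (induction arbitrary: z q1 q2 rule: tree_order.induct)
  case init
  then show ?case by (auto simp: P_self Cons_eq_append_conv)
next
  case (ins as x bs y)
  show ?case
  proof (cases "z = y")
    case True
    then have eq: "P s x @ [y] = q1 @ h # q2" using ins by simp
    show ?thesis
    proof (cases q2 rule: rev_cases)
      case Nil
      then show ?thesis using eq ins.hyps by simp
    next
      case (snoc r w)
      then have "P s x = q1 @ h # r" using eq by simp
      then show ?thesis using ins.IH[of x q1 r] ins.prems by auto
    qed
  next
    case False
    then show ?thesis using ins.IH[of z q1 q2] ins.prems by auto
  qed
qed

text \<open>Restricting the sum to edges inside \<open>xs\<close> makes the induction work: the
  inserted edge contains the new vertex, so it enters the sum exactly when its cost of
  \<open>2 * \<bar>d {x, y}\<bar>\<close> arises.\<close>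

lemma tree_order_variation:
  fixes d :: "nat set \<Rightarrow> real"
  assumes "tree_order G s xs" "s \<in> verts G"
  shows "variation (\<lambda>y. \<Sum>e\<in>pedges s y. d e) xs \<le> 2 * (\<Sum>e\<in>{e\<in>edges G. e \<subseteq> set xs}. \<bar>d e\<bar>)"
  using assms
proof (induction rule: tree_order.induct)
  case init
  then show ?case by (simp add: sum_nonneg)
next
  case (ins as x bs y)
  let ?g = "\<lambda>y. \<Sum>e\<in>pedges s y. d e"
  let ?T = "\<lambda>A. {e\<in>edges G. e \<subseteq> A}"
  have x: "x \<in> verts G" using tree_order_verts[OF ins.hyps(1)] ins.prems by auto
  obtain p where p: "P s x = p @ [x]"
    using P_facts(1,3)[OF ins.prems x] by (metis append_butlast_last_id)
  have pe: "path_edges (P s y) = path_edges (P s x) @ [{x, y}]"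
    using path_edges_append[of p x "[y]"] ins.hyps(5) by (simp add: p)
  have new: "{x, y} \<notin> pedges s x"
    using tree_order_closed[OF ins.hyps(1) ins.prems, of x] ins.hyps(2) path_edges_subset[of "{x, y}" "P s x"] by auto
  have "?g y = d {x, y} + ?g x" using new by (simp add: pe)
  then have "variation ?g (as @ x # y # bs) \<le> variation ?g (as @ x # bs) + 2 * \<bar>d {x, y}\<bar>"
    using variation_insert[of ?g as x y bs] by simp
  also have "\<dots> \<le> 2 * (\<Sum>e\<in>?T (set (as @ x # bs)). \<bar>d e\<bar>) + 2 * \<bar>d {x, y}\<bar>"
    using ins.IH ins.prems by simp
  also have "\<dots> = 2 * (\<Sum>e\<in>insert {x, y} (?T (set (as @ x # bs))). \<bar>d e\<bar>)"
    using ins.hyps(2) finite_edges by (subst sum.insert) auto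
  also have "\<dots> \<le> 2 * (\<Sum>e\<in>?T (set (as @ x # y # bs)). \<bar>d e\<bar>)"
    using ins.hyps(4) finite_edges by (intro mult_left_mono sum_mono2) auto
  finally show ?case .
qed

text \<open>Cutting at \<open>h\<close> leaves two shortest paths, the prefix from \<open>u\<close>
  and, after reversal, the prefix from \<open>v\<close>. Hence the single tree of \<open>h\<close>
  answers every pair whose path visits \<open>h\<close>.\<close>

lemma sum_pedges_through:
  fixes d :: "nat set \<Rightarrow> real"
  assumes ord: "\<And>s. s \<in> verts G \<Longrightarrow> \<exists>xs. tree_order G s xs \<and> set xs = verts G"
    and uv: "u \<in> verts G" "v \<in> verts G" and h: "h \<in> set (P u v)"
  shows "(\<Sum>e\<in>pedges u v. d e) = (\<Sum>e\<in>pedges h u. d e) + (\<Sum>e\<in>pedges h v. d e)"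
proof -
  obtain q1 q2 where q: "P u v = q1 @ h # q2" using h by (meson split_list)
  have hv: "h \<in> verts G" using P_facts(5)[OF uv] h by auto
  have 1: "P u h = q1 @ [h]"
    using ord[OF uv(1)] tree_order_prefix[of u _ v q1 h q2] uv q by auto
  have "P v u = rev q2 @ h # rev q1" using P_rev[OF uv] q by simp
  then have "P v h = rev q2 @ [h]"
    using ord[OF uv(2)] tree_order_prefix[of v _ u "rev q2" h "rev q1"] uv by auto
  then have 2: "P h v = h # q2" using P_rev[OF uv(2) hv] by simp
  have pe: "path_edges (P u v) = path_edges (P u h) @ path_edges (P h v)"
    using path_edges_append[of q1 h q2] by (simp add: q 1 2)
  have "distinct (path_edges (P u v))" using P_facts(4)[OF uv] by (rule distinct_path_edges)
  then show ?thesis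
    unfolding pe using pedges_commute[OF uv(1) hv] by (simp add: sum.union_disjoint)
qed

end

text \<open>Every edge owns exactly one cell, given by its minimum and maximum, so sums over a noise
  array become sums over edges.\<close>

lemma sum_ordered_pairs:
  fixes f :: "nat set \<Rightarrow> real"
  assumes E: "\<And>e. e \<in> E \<Longrightarrow> e \<subseteq> {..<n} \<and> card e = 2"
  shows "(\<Sum>x<n. \<Sum>y<n. if x < y \<and> {x, y} \<in> E then f {x, y} else 0) = (\<Sum>e\<in>E. f e)"
proof -
  have "(\<Sum>x<n. \<Sum>y<n. if x < y \<and> {x, y} \<in> E then f {x, y} else 0)
      = (\<Sum>z\<in>{..<n} \<times> {..<n}. if fst z < snd z \<and> {fst z, snd z} \<in> E then f {fst z, snd z} else 0)"
    by (simp add: sum.cartesian_product case_prod_beta)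
  also have "\<dots> = (\<Sum>z\<in>{z\<in>{..<n} \<times> {..<n}. fst z < snd z \<and> {fst z, snd z} \<in> E}. f {fst z, snd z})"
    by (rule sum.mono_neutral_cong_right) auto
  also have "\<dots> = (\<Sum>e\<in>E. f e)"
  proof (rule sum.reindex_bij_witness[where i = "\<lambda>e. (Min e, Max e)" and j = "\<lambda>z. {fst z, snd z}"])
    fix e assume e: "e \<in> E"
    then obtain a b where ab: "e = {a, b}" "a \<noteq> b" using E[OF e] by (auto simp: card_2_iff)
    have mm: "{min a b, max a b} = {a, b}" by (auto simp: min_def max_def)
    show "{fst (Min e, Max e), snd (Min e, Max e)} = e" using ab mm by simp
    show "(Min e, Max e) \<in> {z\<in>{..<n} \<times> {..<n}. fst z < snd z \<and> {fst z, snd z} \<in> E}"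
      using E[OF e] e mm ab by (auto simp: min_def max_def)
  qed auto
  finally show ?thesis .
qed

section \<open>The noise and its sensitivity\<close>

definition toeplitz :: "nat \<Rightarrow> nat \<Rightarrow> real" where
  "toeplitz i j = (if j \<le> i then sqrt_coef (i - j) else 0)"

lemma toeplitz_sum: "i < n \<Longrightarrow> (\<Sum>j<n. toeplitz i j * f j) = (\<Sum>j\<le>i. sqrt_coef (i - j) * f j)"
  by (intro sum.mono_neutral_cong_right) (auto simp: toeplitz_def)

lemma sum_lessThan_add: "(\<Sum>x<m + n::nat. f x) = (\<Sum>x<m. f x) + (\<Sum>x<n. f (m + x))"
  for f :: "nat \<Rightarrow> 'a :: comm_monoid_add"
  by (induction n) (auto simp: add.assoc)

text \<open>The noise of the pair \<open>(u, v)\<close> has coefficient \<open>noise_coef u v x y\<close> on an array of \<open>2 n \<times> n\<close>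
  independent Gaussians: the rows \<open>x < n\<close> hold the noise of the edges, row \<open>n + s\<close> holds the noise
  of the shortest path tree of \<open>s\<close>. The value \<open>hit u v\<close> is 0 if edge noise is used, and \<open>Suc h\<close> if
  the path is estimated through its vertex \<open>h\<close>.\<close>

locale noise_structure = usp_graph +
  fixes pos :: "nat \<Rightarrow> nat \<Rightarrow> nat" and hit :: "nat \<Rightarrow> nat \<Rightarrow> nat" and m :: nat and \<sigma> \<tau> :: real
  assumes order: "s < n \<Longrightarrow> \<exists>xs. tree_order G s xs \<and> set xs = verts G \<and> (\<forall>i<length xs. pos s (xs ! i) = i)"
    and hit_on_path: "u < n \<Longrightarrow> v < n \<Longrightarrow> hit u v = Suc h \<Longrightarrow> h \<in> set (P u v)"
    and card_hit: "card {h. \<exists>u<n. \<exists>v<n. hit u v = Suc h} \<le> m"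
    and scale_pos: "0 < m \<Longrightarrow> 0 < \<sigma>" "0 < \<tau>"
begin

definition noise_coef :: "nat \<Rightarrow> nat \<Rightarrow> nat \<Rightarrow> nat \<Rightarrow> real" where
  "noise_coef u v x y =
    (if x < n then (if hit u v = 0 \<and> x < y \<and> {x, y} \<in> pedges u v then \<tau> else 0)
     else (if hit u v = Suc (x - n) then \<sigma> * (toeplitz (pos (x - n) u) y + toeplitz (pos (x - n) v) y) else 0))"

lemma order_length: "tree_order G s xs \<Longrightarrow> set xs = verts G \<Longrightarrow> length xs = n"
  using tree_order_distinct[of G s xs] distinct_card[of xs] by (simp add: verts_def)

lemma pos_less:
  assumes "s < n" "u < n"
  shows "pos s u < n"
proof -
  obtain xs where xs: "tree_order G s xs" "set xs = verts G" "\<And>i. i < length xs \<Longrightarrow> pos s (xs ! i) = i"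
    using order[OF assms(1)] by blast
  obtain i where "i < length xs" "xs ! i = u"
    using xs(2) assms(2) by (metis in_set_conv_nth lessThan_iff verts_def)
  then show ?thesis using xs order_length by fastforce
qed

lemma hit_less: "u < n \<Longrightarrow> v < n \<Longrightarrow> hit u v = Suc h \<Longrightarrow> h < n"
  using hit_on_path[of u v h] P_facts(5)[of u v] by (auto simp: verts_def)

lemma finite_hit: "finite {h. \<exists>u<n. \<exists>v<n. hit u v = Suc h}"
  by (rule finite_subset[of _ "{..<n}"]) (auto dest: hit_less)

lemma noise_coef_sum:
  fixes F :: "real \<Rightarrow> nat \<Rightarrow> nat \<Rightarrow> real"
  assumes "u < n" "v < n"
  shows "(\<Sum>x<n + n. \<Sum>y<n. F (noise_coef u v x y) x y) =
    (\<Sum>x<n. \<Sum>y<n. F (if hit u v = 0 \<and> x < y \<and> {x, y} \<in> pedges u v then \<tau> else 0) x y) +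
    (\<Sum>s<n. \<Sum>y<n. F (if hit u v = Suc s then \<sigma> * (toeplitz (pos s u) y + toeplitz (pos s v) y) else 0) (n + s) y)"
  unfolding sum_lessThan_add by (intro arg_cong2[where f = "(+)"] sum.cong refl) (auto simp: noise_coef_def)

lemma sum_pedges_ordered:
  fixes f :: "nat set \<Rightarrow> real"
  assumes "u < n" "v < n"
  shows "(\<Sum>x<n. \<Sum>y<n. if x < y \<and> {x, y} \<in> pedges u v then f {x, y} else 0) = (\<Sum>e\<in>pedges u v. f e)"
  using P_facts(6)[of u v] edge_verts assms by (intro sum_ordered_pairs) (auto simp: verts_def subset_eq)

text \<open>The rows of \<open>u\<close> and \<open>v\<close> act on the same Gaussians, so their
  variances do not simply add; \<open>(a + b)^2 \<le> 2 a^2 + 2 b^2\<close> over two rows gives the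
  factor 4.\<close>

lemma sq_norm_noise_coef_le:
  assumes uv: "u < n" "v < n"
  shows "(\<Sum>x<n + n. \<Sum>y<n. (noise_coef u v x y)\<^sup>2) \<le>
    (if hit u v = 0 then \<tau>\<^sup>2 * real (length (P u v)) else 4 * \<sigma>\<^sup>2 * (1 + ln (real n)))"
proof (cases "hit u v")
  case 0
  have "(\<Sum>x<n + n. \<Sum>y<n. (noise_coef u v x y)\<^sup>2)
      = (\<Sum>x<n. \<Sum>y<n. if x < y \<and> {x, y} \<in> pedges u v then \<tau>\<^sup>2 else 0)"
    unfolding noise_coef_sum[OF uv, of "\<lambda>a _ _. a\<^sup>2"] by (simp add: 0 if_distrib[where f = "\<lambda>x. x\<^sup>2"] cong: if_cong)
  also have "\<dots> = real (card (pedges u v)) * \<tau>\<^sup>2"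
    using sum_pedges_ordered[OF uv, of "\<lambda>_. \<tau>\<^sup>2"] by simp
  also have "\<dots> \<le> real (length (P u v)) * \<tau>\<^sup>2"
    using card_length[of "path_edges (P u v)"] length_path_edges[of "P u v"]
    by (intro mult_right_mono) auto
  finally show ?thesis using 0 by (simp add: mult.commute)
next
  case (Suc h)
  have h: "h < n" using hit_less[OF uv Suc] .
  let ?a = "toeplitz (pos h u)" and ?b = "toeplitz (pos h v)"
  have row: "(\<Sum>y<n. (toeplitz (pos h z) y)\<^sup>2) \<le> 1 + ln (real n)" if "z < n" for z
    using sqrt_coef_row_le[OF pos_less[OF h that]] by (simp add: toeplitz_def)
  have "(\<Sum>x<n + n. \<Sum>y<n. (noise_coef u v x y)\<^sup>2)
      = (\<Sum>s<n. if s = h then \<Sum>y<n. (\<sigma> * (?a y + ?b y))\<^sup>2 else 0)"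
  proof -
    have eq: "(\<Sum>y<n. (if hit u v = Suc s then \<sigma> * (toeplitz (pos s u) y + toeplitz (pos s v) y) else 0)\<^sup>2)
        = (if s = h then \<Sum>y<n. (\<sigma> * (?a y + ?b y))\<^sup>2 else 0)" for s
      using Suc by simp
    show ?thesis unfolding noise_coef_sum[OF uv, of "\<lambda>a _ _. a\<^sup>2"] eq using Suc by simp
  qed
  also have "\<dots> = \<sigma>\<^sup>2 * (\<Sum>y<n. (?a y + ?b y)\<^sup>2)"
    using h by (simp add: power_mult_distrib sum_distrib_left)
  also have "\<dots> \<le> \<sigma>\<^sup>2 * (\<Sum>y<n. 2 * (?a y)\<^sup>2 + 2 * (?b y)\<^sup>2)"
  proof (intro mult_left_mono sum_mono)
    fix y
    show "(?a y + ?b y)\<^sup>2 \<le> 2 * (?a y)\<^sup>2 + 2 * (?b y)\<^sup>2"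
      using zero_le_power2[of "?a y - ?b y"] by (simp add: power2_eq_square algebra_simps)
  qed simp
  also have "\<dots> = \<sigma>\<^sup>2 * (2 * (\<Sum>y<n. (?a y)\<^sup>2) + 2 * (\<Sum>y<n. (?b y)\<^sup>2))"
    by (simp add: sum.distrib sum_distrib_left)
  also have "\<dots> \<le> \<sigma>\<^sup>2 * (2 * (1 + ln (real n)) + 2 * (1 + ln (real n)))"
    using row uv by (intro mult_left_mono add_mono) auto
  finally show ?thesis using Suc by (simp add: algebra_simps)
qed

text \<open>The core of privacy: a change \<open>d\<close> of the attributes is imitated, for all
  pairs at once, by one translation \<open>b\<close> of the Gaussians, whose norm is the
  sensitivity. The two summands of the bound are the edge rows and the at most \<open>m\<close>
  trees in use.\<close>

lemma noise_shift:
  fixes d :: "nat set \<Rightarrow> real"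
  assumes d: "(\<Sum>e\<in>edges G. \<bar>d e\<bar>) \<le> 1"
  obtains b where
    "(\<Sum>x<n + n. \<Sum>y<n. (b x y)\<^sup>2) \<le> 1 / \<tau>\<^sup>2 + real m * (4 * (1 + ln (real n)) / \<sigma>\<^sup>2)"
    "\<And>u v. u < n \<Longrightarrow> v < n \<Longrightarrow> (\<Sum>x<n + n. \<Sum>y<n. noise_coef u v x y * b x y) = (\<Sum>e\<in>pedges u v. d e)"
proof -
  define S where "S = {h. \<exists>u<n. \<exists>v<n. hit u v = Suc h}"
  have S: "S \<subseteq> {..<n}" "card S \<le> m" "finite S"
  proof -
    show "S \<subseteq> {..<n}" unfolding S_def using hit_less by blast
    show "card S \<le> m" "finite S" using card_hit finite_hit by (simp_all add: S_def)
  qed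
  define g where "g s y = (\<Sum>e\<in>pedges s y. d e)" for s y
  let ?Q = "\<lambda>s xs. tree_order G s xs \<and> set xs = verts G \<and> (\<forall>i<length xs. pos s (xs ! i) = i)"
  define xs where "xs s = (SOME xs. ?Q s xs)" for s
  have Q: "?Q s (xs s)" if "s < n" for s
    unfolding xs_def using order[OF that] by (rule someI_ex)
  have xs: "tree_order G s (xs s)" "set (xs s) = verts G" "\<And>i. i < n \<Longrightarrow> pos s (xs s ! i) = i" if "s < n" for s
    using Q[OF that] order_length[of s "xs s"] by auto
  have len: "length (xs s) = n" if "s < n" for s using order_length[OF xs(1)[OF that] xs(2)[OF that]] .
  \<comment> \<open>Increments of the answers along the order. The default 0 at the root is right
    because the root's own answer is 0.\<close>
  define z where "z s j = (case j of 0 \<Rightarrow> 0 | Suc i \<Rightarrow> g s (xs s ! j) - g s (xs s ! i))" for s j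
  \<comment> \<open>One application of the square root gives \<open>c\<close>; the second, inside
    \<open>noise_coef\<close>, returns the prefix sums. Dividing by \<open>\<tau>\<close> and
    \<open>\<sigma>\<close> in \<open>b\<close> cancels the scales.\<close>
  define c where "c s i = (\<Sum>j\<le>i. sqrt_coef (i - j) * z s j)" for s i
  define b where "b x y = (if x < n then (if x < y \<and> {x, y} \<in> edges G then d {x, y} / \<tau> else 0)
     else if x - n \<in> S then c (x - n) y / \<sigma> else 0)" for x y
  have g0: "g s (xs s ! 0) = 0" if "s < n" for s
  proof -
    have "xs s ! 0 = s" using tree_order_hd[OF xs(1)[OF that]] by (metis hd_conv_nth)
    then show ?thesis using that P_self[of s] by (simp add: g_def verts_def)
  qed
  have zsum: "(\<Sum>j\<le>i. z s j) = g s (xs s ! i)" if "s < n" for s i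
    by (induction i) (auto simp: z_def g0[OF that])
  have csum: "(\<Sum>y<n. toeplitz (pos s u) y * c s y) = g s u" if s: "s < n" and u: "u < n" for s u
  proof -
    obtain i where i: "i < n" "xs s ! i = u"
      using xs(2)[OF s] u len[OF s] by (metis in_set_conv_nth lessThan_iff verts_def)
    have "(\<Sum>y<n. toeplitz i y * c s y) = (\<Sum>j\<le>i. sqrt_coef (i - j) * c s j)"
      using i(1) by (rule toeplitz_sum)
    also have "\<dots> = g s (xs s ! i)" unfolding c_def prefix_sum_factorization zsum[OF s] ..
    finally show ?thesis using xs(3)[OF s i(1)] i by simp
  qed
  have zabs: "(\<Sum>j<n. \<bar>z s j\<bar>) \<le> 2" if s: "s < n" for s
  proof -
    obtain k where k: "n = Suc k" using n_pos by (cases n) auto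
    have "(\<Sum>j<n. \<bar>z s j\<bar>) = variation (g s) (xs s)"
      unfolding variation_conv_sum len[OF s] k by (simp add: sum.lessThan_Suc_shift z_def del: sum.lessThan_Suc)
    also have "\<dots> \<le> 2 * (\<Sum>e\<in>{e\<in>edges G. e \<subseteq> set (xs s)}. \<bar>d e\<bar>)"
      unfolding g_def using s xs(1) by (intro tree_order_variation) (auto simp: verts_def)
    also have "\<dots> \<le> 2 * (\<Sum>e\<in>edges G. \<bar>d e\<bar>)"
      using finite_edges by (intro mult_left_mono sum_mono2) auto
    finally show ?thesis using d by simp
  qed
  \<comment> \<open>The total variation 2 enters squared, whence the 4.\<close>
  have csq: "(\<Sum>y<n. (c s y)\<^sup>2) \<le> 4 * (1 + ln (real n))" if s: "s < n" for s
    using sqrt_coef_conv_sq_norm_le[OF n_pos zabs[OF s]] by (simp add: c_def)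
  show thesis
  proof (rule that[of b])
    fix u v assume uv: "u < n" "v < n"
    show "(\<Sum>x<n + n. \<Sum>y<n. noise_coef u v x y * b x y) = (\<Sum>e\<in>pedges u v. d e)"
    proof (cases "hit u v")
      case 0
      have pe: "pedges u v \<subseteq> edges G" using P_facts(6)[of u v] uv by (simp add: verts_def)
      have "(\<Sum>x<n + n. \<Sum>y<n. noise_coef u v x y * b x y)
          = (\<Sum>x<n. \<Sum>y<n. if x < y \<and> {x, y} \<in> pedges u v then d {x, y} else 0)"
        unfolding noise_coef_sum[OF uv, of "\<lambda>a x y. a * b x y"] using pe scale_pos(2)
        by (auto simp: 0 b_def intro!: sum.cong)
      also have "\<dots> = (\<Sum>e\<in>pedges u v. d e)" by (rule sum_pedges_ordered[OF uv])
      finally show ?thesis .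
    next
      case (Suc h)
      have h: "h < n" "h \<in> S" using hit_less[OF uv Suc] Suc uv by (auto simp: S_def)
      have "0 < card S" using h S by (auto simp: card_gt_0_iff)
      \<comment> \<open>The scale is proportional to the root of \<open>m\<close>, so its positivity
        needs a hitting vertex, here \<open>h\<close>.\<close>
      then have sg: "0 < \<sigma>" using S(2) scale_pos(1) by simp
      have "(\<Sum>x<n + n. \<Sum>y<n. noise_coef u v x y * b x y)
          = (\<Sum>s<n. if s = h then \<Sum>y<n. (toeplitz (pos h u) y + toeplitz (pos h v) y) * c h y else 0)"
      proof -
        have eq: "(\<Sum>y<n. (if hit u v = Suc s then \<sigma> * (toeplitz (pos s u) y + toeplitz (pos s v) y) else 0) * b (n + s) y)
            = (if s = h then \<Sum>y<n. (toeplitz (pos h u) y + toeplitz (pos h v) y) * c h y else 0)" for s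
          using Suc h sg by (simp add: b_def)
        show ?thesis unfolding noise_coef_sum[OF uv, of "\<lambda>a x y. a * b x y"] eq using Suc by simp
      qed
      also have "\<dots> = g h u + g h v"
        using h by (simp add: distrib_right sum.distrib csum uv)
      also have "\<dots> = (\<Sum>e\<in>pedges u v. d e)"
        unfolding g_def
      proof (rule sum_pedges_through[symmetric])
        show "\<exists>xs. tree_order G s xs \<and> set xs = verts G" if "s \<in> verts G" for s
          using xs(1,2)[of s] that by (intro exI[of _ "xs s"]) (simp add: verts_def)
      qed (use uv hit_on_path[OF uv Suc] in \<open>auto simp: verts_def\<close>)
      finally show ?thesis .
    qed
  next
    have "(\<Sum>x<n + n. \<Sum>y<n. (b x y)\<^sup>2) = (\<Sum>x<n. \<Sum>y<n. (b x y)\<^sup>2) + (\<Sum>s<n. \<Sum>y<n. (b (n + s) y)\<^sup>2)"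
      by (rule sum_lessThan_add)
    also have "(\<Sum>x<n. \<Sum>y<n. (b x y)\<^sup>2) = (\<Sum>x<n. \<Sum>y<n. if x < y \<and> {x, y} \<in> edges G then (d {x, y} / \<tau>)\<^sup>2 else 0)"
      by (intro sum.cong refl) (auto simp: b_def)
    also have "\<dots> = (\<Sum>e\<in>edges G. (d e / \<tau>)\<^sup>2)"
      using edge_verts by (intro sum_ordered_pairs) (auto simp: verts_def subset_eq)
    also have "\<dots> = (\<Sum>e\<in>edges G. \<bar>d e\<bar> * \<bar>d e\<bar>) / \<tau>\<^sup>2"
      by (simp add: power_divide sum_divide_distrib power2_eq_square)
    \<comment> \<open>No single change exceeds the total change 1, so squares are at most absolute
      values.\<close>
    also have "\<dots> \<le> (\<Sum>e\<in>edges G. \<bar>d e\<bar> * 1) / \<tau>\<^sup>2"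
    proof (intro divide_right_mono sum_mono mult_left_mono)
      fix e assume "e \<in> edges G"
      then have "\<bar>d e\<bar> \<le> (\<Sum>e\<in>edges G. \<bar>d e\<bar>)" using finite_edges by (intro member_le_sum) auto
      then show "\<bar>d e\<bar> \<le> 1" using d by simp
    qed auto
    also have "\<dots> \<le> 1 / \<tau>\<^sup>2" using d by (intro divide_right_mono) auto
    also have "(\<Sum>s<n. \<Sum>y<n. (b (n + s) y)\<^sup>2) = (\<Sum>s<n. if s \<in> S then (\<Sum>y<n. (c s y)\<^sup>2) / \<sigma>\<^sup>2 else 0)"
      by (intro sum.cong refl) (auto simp: b_def power_divide sum_divide_distrib)
    also have "\<dots> = (\<Sum>s\<in>S. (\<Sum>y<n. (c s y)\<^sup>2) / \<sigma>\<^sup>2)"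
      using S by (intro sum.mono_neutral_cong_right) auto
    also have "\<dots> \<le> (\<Sum>s\<in>S. 4 * (1 + ln (real n)) / \<sigma>\<^sup>2)"
      using S by (intro sum_mono divide_right_mono csq) auto
    also have "\<dots> = real (card S) * (4 * (1 + ln (real n)) / \<sigma>\<^sup>2)" by simp
    also have "\<dots> \<le> real m * (4 * (1 + ln (real n)) / \<sigma>\<^sup>2)"
      using S ln_n_nonneg by (intro mult_right_mono) auto
    finally show "(\<Sum>x<n + n. \<Sum>y<n. (b x y)\<^sup>2) \<le> 1 / \<tau>\<^sup>2 + real m * (4 * (1 + ln (real n)) / \<sigma>\<^sup>2)"
      by simp
  qed
qed

end

section \<open>Structured programs\<close>

text \<open>\<open>PFor i m p\<close> runs \<open>p\<close> with the counter \<open>i\<close> ranging over all numbers below \<open>m\<close> times the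
  number of vertices.\<close>

datatype prog =
    PNSet string "nexp list" nexp
  | PRSet string "nexp list" rexp
  | PSample string "nexp list"
  | PSeq prog prog (infixr \<open>;;\<close> 60)
  | PIf bexp prog
  | PFor string nat prog

text \<open>The machine cannot multiply naturals, so a fixed multiple of the number of vertices is a
  repeated sum.\<close>

fun bound_exp :: "nat \<Rightarrow> nexp" where
  "bound_exp 0 = NConst 0"
| "bound_exp (Suc m) = NAdd (NGet ''n'' []) (bound_exp m)"

primrec compile :: "prog \<Rightarrow> com" where
  "compile (PNSet a is x) = NSet a is x"
| "compile (PRSet a is x) = RSet a is x"
| "compile (PSample a is) = Sample a is"
| "compile (PSeq p q) = Seq (compile p) (compile q)"
| "compile (PIf b p) = Cond b (compile p) Skip"
| "compile (PFor i m p) = Seq (NSet i [] (NConst 0))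
     (While (NLess (NGet i []) (bound_exp m))
       (Seq (compile p) (NSet i [] (NAdd (NGet i []) (NConst 1)))))"

primrec sem :: "(nat \<Rightarrow> real) \<Rightarrow> prog \<Rightarrow> state \<Rightarrow> state" where
  "sem \<omega> (PNSet a is x) s = nset a (map (nval s) is) (nval s x) s"
| "sem \<omega> (PRSet a is x) s = rset a (map (nval s) is) (rval s x) s"
| "sem \<omega> (PSample a is) s = rset a (map (nval s) is) (\<omega> (drawn s)) (s\<lparr>drawn := Suc (drawn s)\<rparr>)"
| "sem \<omega> (PSeq p q) s = sem \<omega> q (sem \<omega> p s)"
| "sem \<omega> (PIf b p) s = (if bval s b then sem \<omega> p s else s)"
| "sem \<omega> (PFor i m p) s = nset i [] (m * nmem s ''n'' [])
     (fold (\<lambda>k s. sem \<omega> p (nset i [] k s)) [0..<m * nmem s ''n'' []] s)"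

primrec nwrites :: "prog \<Rightarrow> string set" where
  "nwrites (PNSet a is x) = {a}"
| "nwrites (PRSet a is x) = {}"
| "nwrites (PSample a is) = {}"
| "nwrites (PSeq p q) = nwrites p \<union> nwrites q"
| "nwrites (PIf b p) = nwrites p"
| "nwrites (PFor i m p) = insert i (nwrites p)"

primrec rwrites :: "prog \<Rightarrow> string set" where
  "rwrites (PNSet a is x) = {}"
| "rwrites (PRSet a is x) = {a}"
| "rwrites (PSample a is) = {a}"
| "rwrites (PSeq p q) = rwrites p \<union> rwrites q"
| "rwrites (PIf b p) = rwrites p"
| "rwrites (PFor i m p) = rwrites p"

text \<open>Protects the loop bound and the counter from the loop body, so that the fixed-range
  \<open>fold\<close> in \<open>sem\<close> agrees with the compiled \<open>While\<close>.\<close>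

primrec wellformed :: "prog \<Rightarrow> bool" where
  "wellformed (PNSet a is x) \<longleftrightarrow> a \<noteq> ''n''"
| "wellformed (PRSet a is x) \<longleftrightarrow> True"
| "wellformed (PSample a is) \<longleftrightarrow> True"
| "wellformed (PSeq p q) \<longleftrightarrow> wellformed p \<and> wellformed q"
| "wellformed (PIf b p) \<longleftrightarrow> wellformed p"
| "wellformed (PFor i m p) \<longleftrightarrow> wellformed p \<and> i \<noteq> ''n'' \<and> i \<notin> nwrites p"

text \<open>A conditional pays for its test and for a possible \<open>Skip\<close>; an iteration for
  its test and the increment; a loop for the initialization and the last, failing test.\<close>

primrec steps :: "prog \<Rightarrow> nat poly" where
  "steps (PNSet a is x) = 1"
| "steps (PRSet a is x) = 1"
| "steps (PSample a is) = 1"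
| "steps (PSeq p q) = steps p + steps q"
| "steps (PIf b p) = steps p + 2"
| "steps (PFor i m p) = of_nat m * [:0, 1:] * (steps p + 2) + 2"

lemma nmem_nset [simp]: "nmem (nset a i x s) b j = (if b = a \<and> j = i then x else nmem s b j)"
  by (simp add: nset_def)
lemma rmem_nset [simp]: "rmem (nset a i x s) = rmem s"
  by (simp add: nset_def)
lemma drawn_nset [simp]: "drawn (nset a i x s) = drawn s"
  by (simp add: nset_def)
lemma nmem_rset [simp]: "nmem (rset a i x s) = nmem s"
  by (simp add: rset_def)
lemma rmem_rset [simp]: "rmem (rset a i x s) b j = (if b = a \<and> j = i then x else rmem s b j)"
  by (simp add: rset_def)
lemma drawn_rset [simp]: "drawn (rset a i x s) = drawn s"
  by (simp add: rset_def)

lemma sem_nmem_frame: "a \<notin> nwrites p \<Longrightarrow> nmem (sem \<omega> p s) a = nmem s a"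
proof (induction p arbitrary: s)
  case (PFor i m p)
  have "nmem (fold (\<lambda>k s. sem \<omega> p (nset i [] k s)) ks s) a = nmem s a" for ks s
    using PFor by (induction ks arbitrary: s) (auto simp: fun_eq_iff)
  then show ?case using PFor.prems by (auto simp: fun_eq_iff)
qed (auto simp: fun_eq_iff)

lemma sem_rmem_frame: "a \<notin> rwrites p \<Longrightarrow> rmem (sem \<omega> p s) a = rmem s a"
proof (induction p arbitrary: s)
  case (PFor i m p)
  have "rmem (fold (\<lambda>k s. sem \<omega> p (nset i [] k s)) ks s) a = rmem s a" for ks s
    using PFor by (induction ks arbitrary: s) (auto simp: fun_eq_iff)
  then show ?case by (auto simp: fun_eq_iff)
qed (auto simp: fun_eq_iff)

lemma nval_bound_exp [simp]: "nval s (bound_exp m) = m * nmem s ''n'' []"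
  by (induction m) auto

lemma wellformed_n: "wellformed p \<Longrightarrow> ''n'' \<notin> nwrites p"
  by (induction p) auto

text \<open>Halting, functional correctness and the time bound at once. Loops are handled by
  induction on the number of remaining iterations.\<close>

lemma exec_compile:
  "wellformed p \<Longrightarrow> \<exists>t \<le> poly (steps p) (nmem s ''n'' []). exec \<omega> (compile p) s t (sem \<omega> p s)"
proof (induction p arbitrary: s)
  case (PSeq p q)
  obtain t where t: "t \<le> poly (steps p) (nmem s ''n'' [])" "exec \<omega> (compile p) s t (sem \<omega> p s)"
    using PSeq by auto
  obtain t' where t': "t' \<le> poly (steps q) (nmem (sem \<omega> p s) ''n'' [])"
      "exec \<omega> (compile q) (sem \<omega> p s) t' (sem \<omega> q (sem \<omega> p s))"
    using PSeq by (metis wellformed.simps(4))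
  have "nmem (sem \<omega> p s) ''n'' = nmem s ''n''"
    using PSeq.prems by (intro sem_nmem_frame wellformed_n) auto
  then show ?case using t t' by (intro exI[of _ "t + t'"]) (auto intro: exec.Seq)
next
  case (PIf b p)
  obtain t where t: "t \<le> poly (steps p) (nmem s ''n'' [])" "exec \<omega> (compile p) s t (sem \<omega> p s)"
    using PIf by auto
  show ?case
  proof (cases "bval s b")
    case True
    then show ?thesis using t by (intro exI[of _ "Suc t"]) (auto intro: exec.CondTrue)
  next
    case False
    then show ?thesis using exec.CondFalse[OF False exec.Skip[of \<omega> s]]
      by (intro exI[of _ "Suc 1"]) auto
  qed
next
  case (PFor i m p)
  define N where "N = m * nmem s ''n'' []"
  define T where "T = poly (steps p) (nmem s ''n'' [])"
  let ?f = "\<lambda>k s. sem \<omega> p (nset i [] k s)"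
  let ?W = "While (NLess (NGet i []) (bound_exp m)) (Seq (compile p) (NSet i [] (NAdd (NGet i []) (NConst 1))))"
  have i: "i \<noteq> ''n''" "i \<notin> nwrites p" "wellformed p" using PFor.prems by auto
  have loop: "\<exists>t \<le> l * (T + 2) + 1. exec \<omega> ?W (nset i [] k s') t (nset i [] N (fold ?f [k..<N] s'))"
    if "k + l = N" "nmem s' ''n'' = nmem s ''n''" for k l s'
    using that
  proof (induction l arbitrary: k s')
    case 0
    then have "exec \<omega> ?W (nset i [] k s') 1 (nset i [] k s')"
      using i by (intro exec.WhileFalse) (simp add: N_def)
    then show ?case using 0 by (intro exI[of _ 1]) auto
  next
    case (Suc l)
    let ?s = "?f k s'"
    have k: "k < N" using Suc.prems by simp
    have n: "nmem (nset i [] k s') ''n'' = nmem s ''n''" using i Suc.prems by (auto simp: fun_eq_iff)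
    have n': "nmem ?s ''n'' = nmem s ''n''"
      using sem_nmem_frame[OF wellformed_n[OF i(3)]] n by simp
    have c: "nmem ?s i [] = k" using sem_nmem_frame[OF i(2)] by simp
    obtain t where t: "t \<le> T" "exec \<omega> (compile p) (nset i [] k s') t ?s"
      using PFor.IH[OF i(3), of "nset i [] k s'"] n by (auto simp: T_def)
    have "exec \<omega> (NSet i [] (NAdd (NGet i []) (NConst 1))) ?s 1 (nset i [] (Suc k) ?s)"
      using exec.NSet[of \<omega> i "[]" "NAdd (NGet i []) (NConst 1)" ?s] c by simp
    then have body: "exec \<omega> (Seq (compile p) (NSet i [] (NAdd (NGet i []) (NConst 1)))) (nset i [] k s') (t + 1) (nset i [] (Suc k) ?s)"
      by (rule exec.Seq[OF t(2)])
    obtain t' where t': "t' \<le> l * (T + 2) + 1"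
        "exec \<omega> ?W (nset i [] (Suc k) ?s) t' (nset i [] N (fold ?f [Suc k..<N] ?s))"
      using Suc.IH[of "Suc k" ?s] Suc.prems n' by auto
    have "bval (nset i [] k s') (NLess (NGet i []) (bound_exp m))"
      using k n by (simp add: N_def)
    from exec.WhileTrue[OF this body t'(2)]
    have "exec \<omega> ?W (nset i [] k s') (Suc (t + 1 + t')) (nset i [] N (fold ?f [k..<N] s'))"
      using k by (simp add: upt_conv_Cons)
    then show ?case using t t' by (intro exI[of _ "Suc (t + 1 + t')"]) auto
  qed
  obtain t where t: "t \<le> N * (T + 2) + 1" "exec \<omega> ?W (nset i [] 0 s) t (nset i [] N (fold ?f [0..<N] s))"
    using loop[of 0 N s] by auto
  have "exec \<omega> (NSet i [] (NConst 0)) s 1 (nset i [] 0 s)"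
    using exec.NSet[of \<omega> i "[]" "NConst 0" s] by simp
  from exec.Seq[OF this t(2)] show ?case
    using t(1) by (intro exI[of _ "1 + t"]) (auto simp: N_def T_def of_nat_poly algebra_simps)
qed (auto simp del: One_nat_def intro!: exI[of _ 1] intro: exec.intros)

lemma final_state_compile: "wellformed p \<Longrightarrow> final_state \<omega> (compile p) s = sem \<omega> p s"
  unfolding final_state_def
  using exec_compile[of p s \<omega>] by (intro the_equality) (auto dest: exec_deterministic)

text \<open>The noise coefficients are computed by a \<open>public\<close> program, so they cannot depend on the
  attributes or on the random choices.\<close>

primrec rreads :: "rexp \<Rightarrow> string set" where
  "rreads (OfNat x) = {}"
| "rreads (RGet a is) = {a}"
| "rreads (RAdd x y) = rreads x \<union> rreads y"
| "rreads (RSub x y) = rreads x \<union> rreads y"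
| "rreads (RMul x y) = rreads x \<union> rreads y"
| "rreads (RDiv x y) = rreads x \<union> rreads y"
| "rreads (RSqrt x) = rreads x"
| "rreads (RLn x) = rreads x"

primrec breads :: "bexp \<Rightarrow> string set" where
  "breads (NLess x y) = {}"
| "breads (RLess x y) = rreads x \<union> rreads y"
| "breads (BNot b) = breads b"
| "breads (BAnd b c) = breads b \<union> breads c"

text \<open>Natural assignments are unrestricted: natural expressions cannot read real memory, so
  attributes could influence them only through branches, which \<open>breads\<close> checks.\<close>

primrec public :: "prog \<Rightarrow> bool" where
  "public (PNSet a is x) \<longleftrightarrow> True"
| "public (PRSet a is x) \<longleftrightarrow> a \<noteq> ''attr'' \<and> ''attr'' \<notin> rreads x"
| "public (PSample a is) \<longleftrightarrow> False"
| "public (PSeq p q) \<longleftrightarrow> public p \<and> public q"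
| "public (PIf b p) \<longleftrightarrow> ''attr'' \<notin> breads b \<and> public p"
| "public (PFor i m p) \<longleftrightarrow> public p"

definition set_attr :: "(nat list \<Rightarrow> real) \<Rightarrow> state \<Rightarrow> state" where
  "set_attr W s = s\<lparr>rmem := (rmem s)(''attr'' := W)\<rparr>"

lemma nmem_set_attr [simp]: "nmem (set_attr W s) = nmem s"
  by (simp add: set_attr_def)
lemma rmem_set_attr: "rmem (set_attr W s) a = (if a = ''attr'' then W else rmem s a)"
  by (simp add: set_attr_def)
lemma drawn_set_attr [simp]: "drawn (set_attr W s) = drawn s"
  by (simp add: set_attr_def)

lemma nset_set_attr: "nset a i x (set_attr W s) = set_attr W (nset a i x s)"
  by (simp add: nset_def set_attr_def)

lemma rset_set_attr: "a \<noteq> ''attr'' \<Longrightarrow> rset a i x (set_attr W s) = set_attr W (rset a i x s)"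
  by (simp add: rset_def set_attr_def fun_upd_twist)

lemma nval_set_attr [simp]: "nval (set_attr W s) x = nval s x"
proof (induction x)
  case (NGet a js)
  then have "map (nval (set_attr W s)) js = map (nval s) js" by simp
  then show ?case by (metis nval.simps(2) nmem_set_attr)
qed auto

lemma map_nval_set_attr [simp]: "map (nval (set_attr W s)) js = map (nval s) js"
  by simp

lemma rval_set_attr: "''attr'' \<notin> rreads x \<Longrightarrow> rval (set_attr W s) x = rval s x"
  by (induction x) (auto simp: rmem_set_attr simp del: map_eq_conv)

lemma bval_set_attr: "''attr'' \<notin> breads x \<Longrightarrow> bval (set_attr W s) x = bval s x"
  by (induction x) (auto simp: rval_set_attr)

text \<open>Noninterference. Two unrelated random sequences are allowed because a public program
  never samples.\<close>

lemma sem_set_attr: "public p \<Longrightarrow> sem \<omega> p (set_attr W s) = set_attr W (sem \<omega>' p s)"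
proof (induction p arbitrary: s)
  case (PFor i m p)
  have "fold (\<lambda>k s. sem \<omega> p (nset i [] k s)) ks (set_attr W s)
      = set_attr W (fold (\<lambda>k s. sem \<omega>' p (nset i [] k s)) ks s)" for ks s
    using PFor by (induction ks arbitrary: s) (auto simp: nset_set_attr)
  then show ?case by (simp add: nset_set_attr)
qed (auto simp: nset_set_attr rset_set_attr rval_set_attr bval_set_attr simp del: map_eq_conv)

text \<open>Invariant rule with a built-in frame: \<open>step\<close> and \<open>post\<close> may
  assume that arrays the body does not write still have their contents from before the loop.
  \<open>stable\<close> lets the loop set its counter freely.\<close>

lemma sem_PFor:
  assumes "nmem s ''n'' [] = n" "i \<notin> nwrites p" "i \<noteq> ''n''" "''n'' \<notin> nwrites p"
    and init: "I 0 s"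
    and step: "\<And>k s'. k < m * n \<Longrightarrow> I k s' \<Longrightarrow> nmem s' i [] = k \<Longrightarrow>
      (\<And>a. a \<notin> nwrites p \<Longrightarrow> a \<noteq> i \<Longrightarrow> nmem s' a = nmem s a) \<Longrightarrow>
      (\<And>a. a \<notin> rwrites p \<Longrightarrow> rmem s' a = rmem s a) \<Longrightarrow> I (Suc k) (sem \<omega> p s')"
    and stable: "\<And>k l s'. I k s' \<Longrightarrow> I k (nset i [] l s')"
    and post: "\<And>s'. I (m * n) s' \<Longrightarrow>
      (\<And>a. a \<notin> nwrites p \<Longrightarrow> a \<noteq> i \<Longrightarrow> nmem s' a = nmem s a) \<Longrightarrow>
      (\<And>a. a \<notin> rwrites p \<Longrightarrow> rmem s' a = rmem s a) \<Longrightarrow> Q s'"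
  shows "Q (sem \<omega> (PFor i m p) s)"
proof -
  let ?f = "\<lambda>k s. sem \<omega> p (nset i [] k s)"
  have "I k (fold ?f [0..<k] s) \<and> (\<forall>a. a \<notin> nwrites p \<and> a \<noteq> i \<longrightarrow> nmem (fold ?f [0..<k] s) a = nmem s a) \<and>
      (\<forall>a. a \<notin> rwrites p \<longrightarrow> rmem (fold ?f [0..<k] s) a = rmem s a)" if "k \<le> m * n" for k
    using that
  proof (induction k)
    case 0
    then show ?case using init by simp
  next
    case (Suc k)
    let ?s = "nset i [] k (fold ?f [0..<k] s)"
    have "I (Suc k) (sem \<omega> p ?s)"
      using Suc by (intro step stable) (auto simp: fun_eq_iff)
    then show ?case using Suc by (auto simp: sem_nmem_frame sem_rmem_frame fun_eq_iff)
  qed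
  from this[of "m * n"] show ?thesis
    unfolding sem.simps assms(1) by (intro post stable) (auto simp: fun_eq_iff)
qed

text \<open>The invariant is indexed by the set of processed pairs, so specifications ignore the
  order of traversal; freshness of the next pair allows exact counting and summation.\<close>

lemma sem_PFor2:
  assumes n: "nmem s ''n'' [] = n" "''n'' \<notin> nwrites p"
    and ij: "i \<notin> nwrites p" "i \<noteq> ''n''" "j \<notin> nwrites p" "j \<noteq> ''n''" "i \<noteq> j"
    and init: "I {} s"
    and step: "\<And>Z x y s'. x < m * n \<Longrightarrow> y < l * n \<Longrightarrow> (x, y) \<notin> Z \<Longrightarrow> finite Z \<Longrightarrow> I Z s' \<Longrightarrow>
      nmem s' i [] = x \<Longrightarrow> nmem s' j [] = y \<Longrightarrow>
      (\<And>a. a \<notin> nwrites p \<Longrightarrow> a \<noteq> i \<Longrightarrow> a \<noteq> j \<Longrightarrow> nmem s' a = nmem s a) \<Longrightarrow>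
      (\<And>a. a \<notin> rwrites p \<Longrightarrow> rmem s' a = rmem s a) \<Longrightarrow> I (insert (x, y) Z) (sem \<omega> p s')"
    and stable: "\<And>Z k s'. I Z s' \<Longrightarrow> I Z (nset i [] k s')" "\<And>Z k s'. I Z s' \<Longrightarrow> I Z (nset j [] k s')"
    and post: "\<And>s'. I ({..<m * n} \<times> {..<l * n}) s' \<Longrightarrow>
      (\<And>a. a \<notin> nwrites p \<Longrightarrow> a \<noteq> i \<Longrightarrow> a \<noteq> j \<Longrightarrow> nmem s' a = nmem s a) \<Longrightarrow>
      (\<And>a. a \<notin> rwrites p \<Longrightarrow> rmem s' a = rmem s a) \<Longrightarrow> Q s'"
  shows "Q (sem \<omega> (PFor i m (PFor j l p)) s)"
proof (rule sem_PFor[where I = "\<lambda>k s'. I ({..<k} \<times> {..<l * n}) s'" and n = n])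
  fix k s' assume k: "k < m * n" "I ({..<k} \<times> {..<l * n}) s'" "nmem s' i [] = k"
    and fr: "\<And>a. a \<notin> nwrites (PFor j l p) \<Longrightarrow> a \<noteq> i \<Longrightarrow> nmem s' a = nmem s a"
      "\<And>a. a \<notin> rwrites (PFor j l p) \<Longrightarrow> rmem s' a = rmem s a"
  show "I ({..<Suc k} \<times> {..<l * n}) (sem \<omega> (PFor j l p) s')"
  proof (rule sem_PFor[where I = "\<lambda>q s'. I ({..<k} \<times> {..<l * n} \<union> {k} \<times> {..<q}) s'" and n = n])
    fix q s'' assume q: "q < l * n" "I ({..<k} \<times> {..<l * n} \<union> {k} \<times> {..<q}) s''" "nmem s'' j [] = q"
      and fr': "\<And>a. a \<notin> nwrites p \<Longrightarrow> a \<noteq> j \<Longrightarrow> nmem s'' a = nmem s' a"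
        "\<And>a. a \<notin> rwrites p \<Longrightarrow> rmem s'' a = rmem s' a"
    have "I (insert (k, q) ({..<k} \<times> {..<l * n} \<union> {k} \<times> {..<q})) (sem \<omega> p s'')"
      using k q fr fr' ij by (intro step) auto
    moreover have "insert (k, q) ({..<k} \<times> {..<l * n} \<union> {k} \<times> {..<q}) = {..<k} \<times> {..<l * n} \<union> {k} \<times> {..<Suc q}"
      by auto
    ultimately show "I ({..<k} \<times> {..<l * n} \<union> {k} \<times> {..<Suc q}) (sem \<omega> p s'')" by simp
  next
    fix s'' assume "I ({..<k} \<times> {..<l * n} \<union> {k} \<times> {..<l * n}) s''"
    moreover have "{..<k} \<times> {..<l * n} \<union> {k} \<times> {..<l * n} = {..<Suc k} \<times> {..<l * n}" by auto
    ultimately show "I ({..<Suc k} \<times> {..<l * n}) s''" by simp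
  qed (use k fr n ij stable in auto)
qed (use n ij init stable post in auto)

section \<open>Computing the shortest path trees\<close>

abbreviation (input) Var :: "string \<Rightarrow> nexp" where "Var a \<equiv> NGet a []"

text \<open>The last conjunct is a disjunction by De Morgan: nothing has been found yet, or the new
  edge beats the best one.\<close>

definition search_body :: prog where
  "search_body = PIf
     (BAnd (NLess (NConst 0) (NGet ''in'' [Var ''s'', Var ''x'']))
     (BAnd (NLess (NGet ''in'' [Var ''s'', Var ''y'']) (NConst 1))
     (BAnd (NLess (NConst 0) (NGet ''adj'' [Var ''x'', Var ''y'']))
       (BNot (BAnd (NLess (NConst 0) (Var ''f''))
         (BNot (RLess (RAdd (RGet ''D'' [Var ''s'', Var ''x'']) (RGet ''len'' [Var ''x'', Var ''y'']))
                      (RAdd (RGet ''D'' [Var ''s'', Var ''bx'']) (RGet ''len'' [Var ''bx'', Var ''by''])))))))))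
     (PNSet ''bx'' [] (Var ''x'') ;; PNSet ''by'' [] (Var ''y'') ;; PNSet ''f'' [] (NConst 1))"

definition search :: prog where
  "search = PFor ''x'' 1 (PFor ''y'' 1 search_body)"

definition copy_body :: prog where
  "copy_body = PRSet ''P'' [Var ''s'', Var ''by'', Var ''x'', Var ''y''] (RGet ''P'' [Var ''s'', Var ''bx'', Var ''x'', Var ''y''])"

definition copy_row :: prog where
  "copy_row = PFor ''x'' 1 (PFor ''y'' 1 copy_body)"

definition shift_body :: prog where
  "shift_body = PIf (NLess (NGet ''pos'' [Var ''s'', Var ''bx'']) (NGet ''pos'' [Var ''s'', Var ''x'']))
     (PNSet ''pos'' [Var ''s'', Var ''x''] (NAdd (NGet ''pos'' [Var ''s'', Var ''x'']) (NConst 1)))"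

definition shift_pos :: prog where
  "shift_pos = PFor ''x'' 1 shift_body"

definition settle :: prog where
  "settle =
     PRSet ''D'' [Var ''s'', Var ''by''] (RAdd (RGet ''D'' [Var ''s'', Var ''bx'']) (RGet ''len'' [Var ''bx'', Var ''by''])) ;;
     PNSet ''hop'' [Var ''s'', Var ''by''] (NAdd (NGet ''hop'' [Var ''s'', Var ''bx'']) (NConst 1)) ;;
     PNSet ''in'' [Var ''s'', Var ''by''] (NConst 1) ;;
     copy_row ;;
     PRSet ''P'' [Var ''s'', Var ''by'', Var ''bx'', Var ''by''] (OfNat (NConst 1)) ;;
     PRSet ''P'' [Var ''s'', Var ''by'', Var ''by'', Var ''bx''] (OfNat (NConst 1)) ;;
     PRSet ''P'' [Var ''s'', Var ''by'', Var ''by'', Var ''by''] (OfNat (NConst 1)) ;;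
     shift_pos ;;
     PNSet ''pos'' [Var ''s'', Var ''by''] (NAdd (NGet ''pos'' [Var ''s'', Var ''bx'']) (NConst 1))"

definition grow :: prog where
  "grow = PNSet ''f'' [] (NConst 0) ;; search ;; PIf (NLess (NConst 0) (Var ''f'')) settle"

text \<open>\<open>hop\<close> counts vertices rather than edges and therefore starts at 1.\<close>

definition single_source :: prog where
  "single_source =
     PNSet ''in'' [Var ''s'', Var ''s''] (NConst 1) ;;
     PRSet ''P'' [Var ''s'', Var ''s'', Var ''s'', Var ''s''] (OfNat (NConst 1)) ;;
     PNSet ''hop'' [Var ''s'', Var ''s''] (NConst 1) ;;
     PFor ''k'' 1 grow"

definition dijkstra :: prog where
  "dijkstra = PFor ''s'' 1 single_source"

lemmas dijkstra_defs = dijkstra_def single_source_def grow_def settle_def search_def search_body_def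
  copy_row_def copy_body_def shift_pos_def shift_body_def

section \<open>Correctness of the tree computation\<close>

lemma sem_search:
  fixes st :: state and \<omega>
  defines "st' \<equiv> sem \<omega> search st"
  assumes n: "nmem st ''n'' [] = n" and s: "nmem st ''s'' [] = s" and f: "nmem st ''f'' [] = 0"
  defines "valid \<equiv> \<lambda>a b. a < n \<and> b < n \<and> 0 < nmem st ''in'' [s, a] \<and> nmem st ''in'' [s, b] = 0 \<and> 0 < nmem st ''adj'' [a, b]"
  defines "key \<equiv> \<lambda>a b. rmem st ''D'' [s, a] + rmem st ''len'' [a, b]"
  shows "(nmem st' ''f'' [] = 0 \<and> (\<forall>a b. \<not> valid a b)) \<or>
    (0 < nmem st' ''f'' [] \<and> valid (nmem st' ''bx'' []) (nmem st' ''by'' []) \<and>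
      (\<forall>a b. valid a b \<longrightarrow> key (nmem st' ''bx'' []) (nmem st' ''by'' []) \<le> key a b))"
proof -
  define I where "I Z t \<longleftrightarrow> (nmem t ''f'' [] = 0 \<and> (\<forall>(a, b)\<in>Z. \<not> valid a b)) \<or>
    (0 < nmem t ''f'' [] \<and> valid (nmem t ''bx'' []) (nmem t ''by'' []) \<and>
      (\<forall>(a, b)\<in>Z. valid a b \<longrightarrow> key (nmem t ''bx'' []) (nmem t ''by'' []) \<le> key a b))"
    for Z :: "(nat \<times> nat) set" and t :: state
  show ?thesis
    unfolding st'_def search_def
  proof (rule sem_PFor2[where I = I and n = n])
    show "I {} st" using f by (simp add: I_def)
  next
    fix Z x y t
    assume xy: "x < 1 * n" "y < 1 * n" and I: "I Z t" and v: "nmem t ''x'' [] = x" "nmem t ''y'' [] = y"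
      and fr: "\<And>a. a \<notin> nwrites search_body \<Longrightarrow> a \<noteq> ''x'' \<Longrightarrow> a \<noteq> ''y'' \<Longrightarrow> nmem t a = nmem st a"
        "\<And>a. a \<notin> rwrites search_body \<Longrightarrow> rmem t a = rmem st a"
    have [simp]: "nmem t ''in'' = nmem st ''in''" "nmem t ''adj'' = nmem st ''adj''" "nmem t ''s'' [] = s"
      "rmem t ''D'' = rmem st ''D''" "rmem t ''len'' = rmem st ''len''"
      using s by (simp_all add: fr search_body_def)
    let ?c = "valid x y \<and> \<not> (0 < nmem t ''f'' [] \<and> \<not> key x y < key (nmem t ''bx'' []) (nmem t ''by'' []))"
    have e: "sem \<omega> search_body t = (if ?c then nset ''f'' [] 1 (nset ''by'' [] y (nset ''bx'' [] x t)) else t)"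
      using xy by (simp add: search_body_def v valid_def key_def)
    show "I (insert (x, y) Z) (sem \<omega> search_body t)"
    proof (cases ?c)
      case True
      then have "sem \<omega> search_body t = nset ''f'' [] 1 (nset ''by'' [] y (nset ''bx'' [] x t))"
        unfolding e by (rule if_P)
      then show ?thesis using True I by (fastforce simp: I_def)
    next
      case False
      then have "sem \<omega> search_body t = t" unfolding e by (rule if_not_P)
      then show ?thesis using False I by (auto simp: I_def)
    qed
  next
    fix t assume I: "I ({..<1 * n} \<times> {..<1 * n}) t"
    have vb: "valid a b \<Longrightarrow> (a, b) \<in> {..<1 * n} \<times> {..<1 * n}" for a b
      by (simp add: valid_def)
    show "(nmem t ''f'' [] = 0 \<and> (\<forall>a b. \<not> valid a b)) \<or>
      (0 < nmem t ''f'' [] \<and> valid (nmem t ''bx'' []) (nmem t ''by'' []) \<and>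
      (\<forall>a b. valid a b \<longrightarrow> key (nmem t ''bx'' []) (nmem t ''by'' []) \<le> key a b))"
      using I vb unfolding I_def by blast
  qed (simp_all add: n I_def search_body_def)
qed

text \<open>Since \<open>x \<noteq> y\<close>, the source row is not overwritten while it is being
  copied.\<close>

lemma sem_copy_row:
  assumes n: "nmem st ''n'' [] = n" and s: "nmem st ''s'' [] = s"
    and b: "nmem st ''bx'' [] = x" "nmem st ''by'' [] = y" "x \<noteq> y"
  shows "\<forall>r z a b. rmem (sem \<omega> copy_row st) ''P'' [r, z, a, b] =
    (if r = s \<and> z = y \<and> a < n \<and> b < n then rmem st ''P'' [s, x, a, b] else rmem st ''P'' [r, z, a, b])"
proof -
  let ?I = "\<lambda>Z t. \<forall>r z a b. rmem t ''P'' [r, z, a, b] =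
    (if r = s \<and> z = y \<and> (a, b) \<in> Z then rmem st ''P'' [s, x, a, b] else rmem st ''P'' [r, z, a, b])"
  show ?thesis
    unfolding copy_row_def
  proof (rule sem_PFor2[where n = n and I = ?I])
    fix Z p q and t :: state
    assume I: "?I Z t"
      and v: "nmem t ''x'' [] = p" "nmem t ''y'' [] = q"
      and fr: "\<And>a. a \<notin> nwrites copy_body \<Longrightarrow> a \<noteq> ''x'' \<Longrightarrow> a \<noteq> ''y'' \<Longrightarrow> nmem t a = nmem st a"
    have "nmem t ''s'' [] = s" "nmem t ''bx'' [] = x" "nmem t ''by'' [] = y"
      using s b by (simp_all add: fr copy_body_def)
    then show "\<forall>r z a b. rmem (sem \<omega> copy_body t) ''P'' [r, z, a, b] =
      (if r = s \<and> z = y \<and> (a, b) \<in> insert (p, q) Z then rmem st ''P'' [s, x, a, b] else rmem st ''P'' [r, z, a, b])"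
      using I v b(3) by (auto simp: copy_body_def)
  qed (simp_all add: n copy_body_def)
qed

text \<open>The strict comparison never moves the parent itself, so the cutoff position stays
  constant during the loop.\<close>

lemma sem_shift_pos:
  assumes n: "nmem st ''n'' [] = n" and s: "nmem st ''s'' [] = s" and b: "nmem st ''bx'' [] = x"
  shows "\<forall>r u. nmem (sem \<omega> shift_pos st) ''pos'' [r, u] =
    (if r = s \<and> u < n \<and> nmem st ''pos'' [s, x] < nmem st ''pos'' [s, u] then nmem st ''pos'' [s, u] + 1 else nmem st ''pos'' [r, u])"
proof -
  let ?I = "\<lambda>k t. \<forall>r u. nmem t ''pos'' [r, u] =
    (if r = s \<and> u < k \<and> nmem st ''pos'' [s, x] < nmem st ''pos'' [s, u] then nmem st ''pos'' [s, u] + 1 else nmem st ''pos'' [r, u])"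
  show ?thesis
    unfolding shift_pos_def
  proof (rule sem_PFor[where n = n and I = ?I])
    fix k and t :: state
    assume I: "?I k t"
      and v: "nmem t ''x'' [] = k"
      and fr: "\<And>a. a \<notin> nwrites shift_body \<Longrightarrow> a \<noteq> ''x'' \<Longrightarrow> nmem t a = nmem st a"
    have "nmem t ''s'' [] = s" "nmem t ''bx'' [] = x"
      using s b by (simp_all add: fr shift_body_def)
    then show "\<forall>r u. nmem (sem \<omega> shift_body t) ''pos'' [r, u] =
      (if r = s \<and> u < Suc k \<and> nmem st ''pos'' [s, x] < nmem st ''pos'' [s, u] then nmem st ''pos'' [s, u] + 1 else nmem st ''pos'' [r, u])"
      using I v by (auto simp: shift_body_def less_Suc_eq)
  qed (simp_all add: n shift_body_def)
qed

text \<open>The diagonal of the array \<open>P\<close> indicates the vertices of a path, the other entries its edges.\<close>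

definition row :: "state \<Rightarrow> nat \<Rightarrow> nat \<Rightarrow> nat \<times> nat \<times> nat \<times> real \<times> (nat \<Rightarrow> nat \<Rightarrow> real)" where
  "row st s y = (nmem st ''in'' [s, y], nmem st ''pos'' [s, y], nmem st ''hop'' [s, y], rmem st ''D'' [s, y],
     \<lambda>a b. rmem st ''P'' [s, y, a, b])"

lemma row_eq_iff:
  "row st s y = row st' s' y' \<longleftrightarrow> nmem st ''in'' [s, y] = nmem st' ''in'' [s', y'] \<and>
     nmem st ''pos'' [s, y] = nmem st' ''pos'' [s', y'] \<and> nmem st ''hop'' [s, y] = nmem st' ''hop'' [s', y'] \<and>
     rmem st ''D'' [s, y] = rmem st' ''D'' [s', y'] \<and>
     (\<forall>a b. rmem st ''P'' [s, y, a, b] = rmem st' ''P'' [s', y', a, b])"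
  by (auto simp: row_def fun_eq_iff)

definition on_path :: "nat list \<Rightarrow> nat \<Rightarrow> nat \<Rightarrow> bool" where
  "on_path p a b \<longleftrightarrow> a = b \<and> a \<in> set p \<or> {a, b} \<in> set (path_edges p)"

context usp_graph
begin

definition input :: "state \<Rightarrow> bool" where
  "input st \<longleftrightarrow> nmem st ''n'' [] = n \<and> (\<forall>u v. nmem st ''adj'' [u, v] = of_bool ({u, v} \<in> edges G)) \<and>
     (\<forall>u v. {u, v} \<in> edges G \<longrightarrow> rmem st ''len'' [u, v] = len G {u, v})"

definition explored :: "state \<Rightarrow> nat \<Rightarrow> nat list \<Rightarrow> bool" where
  "explored st s xs \<longleftrightarrow> tree_order G s xs \<and>
     (\<forall>y<n. nmem st ''in'' [s, y] = of_bool (y \<in> set xs)) \<and>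
     (\<forall>y\<in>set xs. nmem st ''hop'' [s, y] = length (P s y) \<and> rmem st ''D'' [s, y] = path_len G (P s y) \<and>
        (\<forall>a<n. \<forall>b<n. rmem st ''P'' [s, y, a, b] = of_bool (on_path (P s y) a b))) \<and>
     (\<forall>i<length xs. nmem st ''pos'' [s, xs ! i] = i)"

lemma explored_row:
  assumes "\<forall>y. row st' s y = row st s y"
  shows "explored st' s xs \<longleftrightarrow> explored st s xs"
  using assms by (simp add: explored_def row_eq_iff)

text \<open>The program counterpart of the rule \<open>tree_order.ins\<close>. The second claim
  keeps the trees of other sources intact for the outer loop.\<close>

lemma sem_settle:
  fixes st :: state and x y :: nat
  assumes n: "nmem st ''n'' [] = n" and s: "nmem st ''s'' [] = s" "s < n"
    and b: "nmem st ''bx'' [] = x" "nmem st ''by'' [] = y"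
    and ex: "explored st s (as @ x # bs)" and y: "y \<notin> set (as @ x # bs)" "y < n" "{x, y} \<in> edges G"
    and len: "rmem st ''len'' [x, y] = len G {x, y}"
    and step: "P s y = P s x @ [y]" "path_len G (P s y) = path_len G (P s x) + len G {x, y}"
      "path_edges (P s y) = path_edges (P s x) @ [{x, y}]"
  shows "explored (sem \<omega> settle st) s (as @ x # y # bs)"
    and "\<forall>r z. r \<noteq> s \<longrightarrow> row (sem \<omega> settle st) r z = row st r z"
proof -
  let ?xs = "as @ x # bs" and ?ys = "as @ x # y # bs"
  have xy: "x \<noteq> y" "x < n" using y edge_verts(1)[OF y(3)] by (auto simp: verts_def)
  have ord: "tree_order G s ?xs" using ex by (simp add: explored_def)
  have dist: "distinct ?xs" using tree_order_distinct[OF ord] .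
  have xsn: "set ?xs \<subseteq> {..<n}" using tree_order_verts[OF ord] s by (simp add: verts_def)
  define s1 where "s1 = nset ''in'' [s, y] (Suc 0) (nset ''hop'' [s, y] (Suc (nmem st ''hop'' [s, x]))
    (rset ''D'' [s, y] (rmem st ''D'' [s, x] + rmem st ''len'' [x, y]) st))"
  define s2 where "s2 = sem \<omega> copy_row s1"
  define s3 where "s3 = rset ''P'' [s, y, y, y] 1 (rset ''P'' [s, y, y, x] 1 (rset ''P'' [s, y, x, y] 1 s2))"
  define s4 where "s4 = sem \<omega> shift_pos s3"
  define s5 where "s5 = nset ''pos'' [s, y] (Suc (nmem s4 ''pos'' [s, x])) s4"
  have copy_fr: "nmem s2 a = nmem s1 a" if "a \<noteq> ''x''" "a \<noteq> ''y''" for a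
    unfolding s2_def using that by (intro sem_nmem_frame) (simp add: copy_row_def copy_body_def)
  have copy_fr': "rmem s2 a = rmem s1 a" if "a \<noteq> ''P''" for a
    unfolding s2_def using that by (intro sem_rmem_frame) (simp add: copy_row_def copy_body_def)
  have shift_fr: "nmem s4 a = nmem s3 a" if "a \<noteq> ''x''" "a \<noteq> ''pos''" for a
    unfolding s4_def using that by (intro sem_nmem_frame) (simp add: shift_pos_def shift_body_def)
  have shift_fr': "rmem s4 a = rmem s3 a" for a
    unfolding s4_def by (intro sem_rmem_frame) (simp add: shift_pos_def shift_body_def)
  have [simp]: "nmem s2 ''s'' [] = s" "nmem s2 ''bx'' [] = x" "nmem s2 ''by'' [] = y" "nmem s2 ''n'' [] = n"
    using s b n by (simp_all add: copy_fr s1_def)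
  have [simp]: "nmem s4 ''s'' [] = s" "nmem s4 ''bx'' [] = x" "nmem s4 ''by'' [] = y"
    by (simp_all add: shift_fr s3_def)
  have eq: "sem \<omega> settle st = s5"
    using s b by (simp add: settle_def s1_def[symmetric] s2_def[symmetric] s3_def[symmetric] s4_def[symmetric] s5_def)
  have P2: "rmem s2 ''P'' [r, z, a, c] =
    (if r = s \<and> z = y \<and> a < n \<and> c < n then rmem st ''P'' [s, x, a, c] else rmem st ''P'' [r, z, a, c])" for r z a c
    using sem_copy_row[of s1 n s x y \<omega>] xy n s b by (simp add: s2_def s1_def)
  have pos4: "nmem s4 ''pos'' [r, u] = (if r = s \<and> u < n \<and> nmem st ''pos'' [s, x] < nmem st ''pos'' [s, u]
      then nmem st ''pos'' [s, u] + 1 else nmem st ''pos'' [r, u])" for r u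
    using sem_shift_pos[of s3 n s x \<omega>] unfolding s4_def[symmetric] by (simp add: s3_def copy_fr s1_def n s b)
  have D5: "rmem s5 ''D'' [r, z] = (if r = s \<and> z = y then path_len G (P s y) else rmem st ''D'' [r, z])" for r z
    using ex len step(2) by (simp add: s5_def shift_fr' s3_def copy_fr' s1_def explored_def)
  have hop5: "nmem s5 ''hop'' [r, z] = (if r = s \<and> z = y then length (P s y) else nmem st ''hop'' [r, z])" for r z
    using ex step(1) by (simp add: s5_def shift_fr s3_def copy_fr s1_def explored_def)
  have in5: "nmem s5 ''in'' [r, z] = (if r = s \<and> z = y then 1 else nmem st ''in'' [r, z])" for r z
    by (simp add: s5_def shift_fr s3_def copy_fr s1_def)
  have P5: "rmem s5 ''P'' [r, z, a, c] = (if r = s \<and> z = y \<and> a < n \<and> c < n then of_bool (on_path (P s y) a c)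
      else rmem st ''P'' [r, z, a, c])" for r z a c
  proof -
    \<comment> \<open>The cells overwritten after the copy: the new edge in both orientations and
      the new vertex on the diagonal.\<close>
    let ?new = "a = x \<and> c = y \<or> a = y \<and> c = x \<or> a = y \<and> c = y"
    have s5P: "rmem s5 ''P'' idx = (if idx = [s, y, y, y] then 1 else if idx = [s, y, y, x] then 1
        else if idx = [s, y, x, y] then 1 else rmem s2 ''P'' idx)" for idx
      by (simp add: s5_def shift_fr' s3_def)
    have on: "on_path (P s y) a c \<longleftrightarrow> on_path (P s x) a c \<or> ?new"
      using step(1,3) by (auto simp: on_path_def doubleton_eq_iff)
    have old: "rmem st ''P'' [s, x, a, c] = of_bool (on_path (P s x) a c)" if "a < n" "c < n"
      using ex that by (simp add: explored_def)
    consider "r = s \<and> z = y \<and> ?new" | "r = s \<and> z = y \<and> \<not> ?new \<and> a < n \<and> c < n"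
      | "\<not> (r = s \<and> z = y \<and> a < n \<and> c < n) \<and> \<not> (r = s \<and> z = y \<and> ?new)" by blast
    then show ?thesis
    proof cases
      case 1
      then show ?thesis unfolding s5P on using xy(2) y(2) by auto
    next
      case 2
      then have ne: "[r, z, a, c] \<noteq> [s, y, y, y]" "[r, z, a, c] \<noteq> [s, y, y, x]" "[r, z, a, c] \<noteq> [s, y, x, y]"
        by blast+
      have "rmem s5 ''P'' [r, z, a, c] = rmem st ''P'' [s, x, a, c]"
        unfolding s5P if_not_P[OF ne(1)] if_not_P[OF ne(2)] if_not_P[OF ne(3)] P2 using 2 by (intro if_P) blast
      also have "\<dots> = of_bool (on_path (P s x) a c)" using 2 by (intro old) blast+
      also have "on_path (P s x) a c \<longleftrightarrow> on_path (P s y) a c" unfolding on using 2 by blast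
      finally show ?thesis using 2 by simp
    next
      case 3
      then have ne: "[r, z, a, c] \<noteq> [s, y, y, y]" "[r, z, a, c] \<noteq> [s, y, y, x]" "[r, z, a, c] \<noteq> [s, y, x, y]"
        by blast+
      have "rmem s5 ''P'' [r, z, a, c] = rmem st ''P'' [r, z, a, c]"
        unfolding s5P if_not_P[OF ne(1)] if_not_P[OF ne(2)] if_not_P[OF ne(3)] P2 using 3 by (intro if_not_P) blast
      moreover have "\<not> (r = s \<and> z = y \<and> a < n \<and> c < n)" using 3 by blast
      ultimately show ?thesis by (simp only: if_False)
    qed
  qed
  have px: "nmem st ''pos'' [s, x] = length as"
  proof -
    have "nmem st ''pos'' [s, ?xs ! length as] = length as" using ex unfolding explored_def by (metis add_less_cancel_left length_append length_Cons zero_less_Suc add.right_neutral)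
    then show ?thesis by simp
  qed
  have pos5: "nmem s5 ''pos'' [r, z] = (if r = s \<and> z = y then length as + 1 else
      if r = s \<and> z < n \<and> length as < nmem st ''pos'' [s, z] then nmem st ''pos'' [s, z] + 1 else nmem st ''pos'' [r, z])" for r z
    by (simp add: s5_def pos4 px)
  have "nmem s5 ''pos'' [s, ?ys ! i] = i" if i: "i < length ?ys" for i
  proof -
    have old: "nmem st ''pos'' [s, ?xs ! j] = j" "?xs ! j \<noteq> y" "?xs ! j < n" if "j < length ?xs" for j
    proof -
      show "nmem st ''pos'' [s, ?xs ! j] = j" using ex that unfolding explored_def by blast
      have "?xs ! j \<in> set ?xs" using that by (rule nth_mem)
      then show "?xs ! j \<noteq> y" "?xs ! j < n" using y xsn by auto
    qed
    \<comment> \<open>Up to the parent nothing moves; the next place belongs to the new vertex;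
      every later vertex has been shifted, so its former index is \<open>i - 1\<close>.\<close>
    consider "i \<le> length as" | "i = length as + 1" | "length as + 2 \<le> i" by linarith
    then show ?thesis
    proof cases
      case 1
      then have "?ys ! i = ?xs ! i" "i < length ?xs" by (auto simp: nth_append nth_Cons split: nat.split)
      then show ?thesis using old[of i] 1 by (simp add: pos5)
    next
      case 2
      then show ?thesis by (simp add: pos5 nth_append)
    next
      case 3
      then obtain l where l: "i = length as + Suc (Suc l)" by (metis add_Suc_right add_2_eq_Suc' le_Suc_ex add.assoc add.commute)
      define j where "j = length as + Suc l"
      have j: "i = Suc j" "length as < j" using l by (simp_all add: j_def)
      have "?ys ! i = ?xs ! j" "j < length ?xs" using i l by (simp_all add: j_def nth_append)
      then show ?thesis using old[of j] j by (simp add: pos5)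
    qed
  qed
  moreover have "tree_order G s ?ys" using ord y step by (intro tree_order.ins) (auto simp: verts_def)
  ultimately show "explored (sem \<omega> settle st) s ?ys"
    using ex y unfolding eq explored_def by (auto simp: D5 hop5 in5 P5)
  show "\<forall>r z. r \<noteq> s \<longrightarrow> row (sem \<omega> settle st) r z = row st r z"
    unfolding eq by (simp add: row_eq_iff D5 hop5 in5 P5 pos5)
qed

lemma input_cong:
  "nmem st' ''n'' = nmem st ''n'' \<Longrightarrow> nmem st' ''adj'' = nmem st ''adj'' \<Longrightarrow> rmem st' ''len'' = rmem st ''len'' \<Longrightarrow>
    input st' \<longleftrightarrow> input st"
  by (simp add: input_def)

text \<open>The minimum in the progress claim covers a round that finds no edge: by connectivity the
  order is then already complete.\<close>

lemma sem_grow: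
  assumes inp: "input st" and s: "nmem st ''s'' [] = s" "s < n" and ex: "explored st s xs"
  shows "\<exists>xs'. explored (sem \<omega> grow st) s xs' \<and> min n (Suc (length xs)) \<le> length xs'"
    and "\<forall>r z. r \<noteq> s \<longrightarrow> row (sem \<omega> grow st) r z = row st r z"
proof -
  define s0 where "s0 = nset ''f'' [] 0 st"
  define s1 where "s1 = sem \<omega> search s0"
  define x where "x = nmem s1 ''bx'' []"
  define y where "y = nmem s1 ''by'' []"
  have n: "nmem st ''n'' [] = n" using inp by (simp add: input_def)
  have fr: "nmem s1 a = nmem s0 a" if "a \<notin> {''x'', ''y'', ''bx'', ''by'', ''f''}" for a
    unfolding s1_def using that by (intro sem_nmem_frame) (simp add: search_def search_body_def)
  have fr': "rmem s1 a = rmem st a" for a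
    using sem_rmem_frame[of a search \<omega> s0] by (simp add: s1_def s0_def search_def search_body_def)
  have fr1: "nmem s1 ''in'' = nmem st ''in''" "nmem s1 ''pos'' = nmem st ''pos''" "nmem s1 ''hop'' = nmem st ''hop''"
    "nmem s1 ''s'' [] = s" "nmem s1 ''n'' [] = n" "nmem s1 ''adj'' = nmem st ''adj''"
    using s n by (simp_all add: fr s0_def fun_eq_iff)
  have rows: "row s1 r z = row st r z" for r z by (simp add: row_eq_iff fr1 fr')
  have ex1: "explored s1 s xs" using ex rows explored_row by metis
  have ord: "tree_order G s xs" using ex by (simp add: explored_def)
  have sx: "s \<in> set xs" using tree_order_hd[OF ord] by (metis list.set_sel(1))
  have sv: "s \<in> verts G" using s by (simp add: verts_def)
  have xsv: "set xs \<subseteq> verts G" using tree_order_verts[OF ord sv] .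
  define valid where "valid a b \<longleftrightarrow> a < n \<and> b < n \<and> 0 < nmem s0 ''in'' [s, a] \<and> nmem s0 ''in'' [s, b] = 0 \<and> 0 < nmem s0 ''adj'' [a, b]" for a b
  have valid: "valid a b \<longleftrightarrow> a \<in> set xs \<and> b < n \<and> b \<notin> set xs \<and> {a, b} \<in> edges G" for a b
    using ex inp xsv by (auto simp: valid_def s0_def explored_def input_def verts_def)
  have key: "rmem s0 ''D'' [s, a] + rmem s0 ''len'' [a, b] = path_len G (P s a) + len G {a, b}" if "valid a b" for a b
    using that ex inp unfolding valid by (simp add: s0_def explored_def input_def)
  have srch: "(nmem s1 ''f'' [] = 0 \<and> (\<forall>a b. \<not> valid a b)) \<or>
    (0 < nmem s1 ''f'' [] \<and> valid x y \<and>
      (\<forall>a b. valid a b \<longrightarrow> rmem s0 ''D'' [s, x] + rmem s0 ''len'' [x, y] \<le> rmem s0 ''D'' [s, a] + rmem s0 ''len'' [a, b]))"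
    using sem_search[of s0 n s \<omega>] s n unfolding s1_def[symmetric] x_def[symmetric] y_def[symmetric] valid_def
    by (simp add: s0_def)
  have eq: "sem \<omega> grow st = (if 0 < nmem s1 ''f'' [] then sem \<omega> settle s1 else s1)"
    by (simp add: grow_def s1_def s0_def)
  have "(\<exists>xs'. explored (sem \<omega> grow st) s xs' \<and> min n (Suc (length xs)) \<le> length xs') \<and>
    (\<forall>r z. r \<noteq> s \<longrightarrow> row (sem \<omega> grow st) r z = row st r z)"
  proof (cases "0 < nmem s1 ''f'' []")
    case False
    then have "\<And>a b. \<not> valid a b" using srch by auto
    then have "set xs = verts G" using crossing_edge[OF xsv sx] unfolding valid by (auto simp: verts_def)
    then have "length xs = n" using tree_order_distinct[OF ord] distinct_card[of xs] by (simp add: verts_def)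
    then show ?thesis using False ex1 rows eq by auto
  next
    case True
    then have v: "valid x y" using srch by simp
    have mn: "path_len G (P s x) + len G {x, y} \<le> path_len G (P s a) + len G {a, b}" if "valid a b" for a b
      using True srch that key[OF v] key[OF that] by metis
    have xy: "x \<in> set xs" "y < n" "y \<notin> set xs" "{x, y} \<in> edges G" using v valid by auto
    obtain as bs where xs: "xs = as @ x # bs" using xy(1) by (meson split_list)
    note step = dijkstra_step[OF xsv sx tree_order_closed[OF ord sv] xy(1) _ xy(3,4)]
    have st: "P s y = P s x @ [y]" "path_len G (P s y) = path_len G (P s x) + len G {x, y}"
      "path_edges (P s y) = path_edges (P s x) @ [{x, y}]"
      using mn xy(2) by (auto intro!: step simp: valid verts_def)
    have ln: "rmem s1 ''len'' [x, y] = len G {x, y}" using inp xy by (simp add: fr' input_def)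
    note settled = sem_settle[of s1 s x y as bs \<omega>, OF fr1(5,4) s(2) x_def[symmetric] y_def[symmetric]
        ex1[unfolded xs] xy(3)[unfolded xs] xy(2,4) ln st]
    show ?thesis using settled True rows unfolding eq xs by auto
  qed
  then show "\<exists>xs'. explored (sem \<omega> grow st) s xs' \<and> min n (Suc (length xs)) \<le> length xs'"
    "\<forall>r z. r \<noteq> s \<longrightarrow> row (sem \<omega> grow st) r z = row st r z" by auto
qed

text \<open>The root alone gives length 1, so \<open>k\<close> rounds reach at least
  \<open>min n (Suc k)\<close> vertices and \<open>n\<close> rounds exhaust the graph.\<close>

lemma sem_single_source:
  assumes inp: "input st" and s: "nmem st ''s'' [] = s" "s < n"
    and zero: "\<forall>y. row st s y = (0, 0, 0, 0, \<lambda>_ _. 0)"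
  shows "(\<exists>xs. explored (sem \<omega> single_source st) s xs \<and> set xs = verts G) \<and>
    (\<forall>r z. r \<noteq> s \<longrightarrow> row (sem \<omega> single_source st) r z = row st r z)"
proof -
  define s1 where "s1 = nset ''hop'' [s, s] (Suc 0) (rset ''P'' [s, s, s, s] 1 (nset ''in'' [s, s] (Suc 0) st))"
  have sv: "s \<in> verts G" using s by (simp add: verts_def)
  have eq: "sem \<omega> single_source st = sem \<omega> (PFor ''k'' 1 grow) s1"
    using s by (simp add: single_source_def s1_def del: sem.simps(6))
  have ex1: "explored s1 s [s]"
    using zero P_self[OF sv] tree_order.init[of G s]
    by (auto simp: explored_def s1_def row_def fun_eq_iff on_path_def path_len_def)
  have rows1: "\<forall>r z. r \<noteq> s \<longrightarrow> row s1 r z = row st r z" by (simp add: s1_def row_eq_iff)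
  have n1: "nmem s1 ''n'' [] = n" using inp by (simp add: s1_def input_def)
  show ?thesis
    unfolding eq
  proof (rule sem_PFor[where n = n and I = "\<lambda>k t. (\<exists>xs. explored t s xs \<and> min n (Suc k) \<le> length xs) \<and>
      (\<forall>r z. r \<noteq> s \<longrightarrow> row t r z = row st r z)"])
    show "(\<exists>xs. explored s1 s xs \<and> min n (Suc 0) \<le> length xs) \<and> (\<forall>r z. r \<noteq> s \<longrightarrow> row s1 r z = row st r z)"
      using ex1 rows1 by (intro conjI exI[of _ "[s]"]) auto
  next
    fix k t
    assume I: "(\<exists>xs. explored t s xs \<and> min n (Suc k) \<le> length xs) \<and> (\<forall>r z. r \<noteq> s \<longrightarrow> row t r z = row st r z)"
      and fr: "\<And>a. a \<notin> nwrites grow \<Longrightarrow> a \<noteq> ''k'' \<Longrightarrow> nmem t a = nmem s1 a"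
        "\<And>a. a \<notin> rwrites grow \<Longrightarrow> rmem t a = rmem s1 a"
    then obtain xs where xs: "explored t s xs" "min n (Suc k) \<le> length xs" by auto
    have ts: "nmem t ''s'' [] = s" using s by (simp add: fr s1_def dijkstra_defs)
    have "nmem t ''n'' = nmem s1 ''n''" "nmem t ''adj'' = nmem s1 ''adj''" "rmem t ''len'' = rmem s1 ''len''"
      by (simp_all add: fr dijkstra_defs)
    then have ti: "input t" using inp by (simp add: input_def s1_def)
    show "(\<exists>xs. explored (sem \<omega> grow t) s xs \<and> min n (Suc (Suc k)) \<le> length xs) \<and>
        (\<forall>r z. r \<noteq> s \<longrightarrow> row (sem \<omega> grow t) r z = row st r z)"
      using sem_grow[OF ti ts s(2) xs(1), of \<omega>] I xs(2) by fastforce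
  next
    fix t
    assume I: "(\<exists>xs. explored t s xs \<and> min n (Suc (1 * n)) \<le> length xs) \<and> (\<forall>r z. r \<noteq> s \<longrightarrow> row t r z = row st r z)"
    then obtain xs where xs: "explored t s xs" "n \<le> length xs" by auto
    have ord: "tree_order G s xs" using xs by (simp add: explored_def)
    have "set xs = verts G"
      using tree_order_verts[OF ord sv] tree_order_distinct[OF ord] xs(2) distinct_card[of xs]
      by (intro card_seteq) (auto simp: verts_def)
    then show "(\<exists>xs. explored t s xs \<and> set xs = verts G) \<and> (\<forall>r z. r \<noteq> s \<longrightarrow> row t r z = row st r z)"
      using xs I by auto
  qed (simp_all add: n1 dijkstra_defs explored_def row_def)
qed

text \<open>Besides correctness this proves that tree orders exist for all sources, the hypothesis
  of \<open>sum_pedges_through\<close>. Rows of pending sources must remain zero, their initial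
  content.\<close>

lemma sem_dijkstra:
  assumes inp: "input st" and zero: "\<forall>s y. row st s y = (0, 0, 0, 0, \<lambda>_ _. 0)"
  shows "\<forall>s<n. \<exists>xs. explored (sem \<omega> dijkstra st) s xs \<and> set xs = verts G"
proof -
  let ?I = "\<lambda>k t. (\<forall>s<k. \<exists>xs. explored t s xs \<and> set xs = verts G) \<and>
      (\<forall>s y. k \<le> s \<longrightarrow> row t s y = (0, 0, 0, 0, \<lambda>_ _. 0))"
  show ?thesis
    unfolding dijkstra_def
  proof (rule sem_PFor[where n = n and I = ?I])
    fix k t
    assume I: "?I k t"
      and k: "k < 1 * n" and ts: "nmem t ''s'' [] = k"
      and fr: "\<And>a. a \<notin> nwrites single_source \<Longrightarrow> a \<noteq> ''s'' \<Longrightarrow> nmem t a = nmem st a"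
        "\<And>a. a \<notin> rwrites single_source \<Longrightarrow> rmem t a = rmem st a"
    have "nmem t ''n'' = nmem st ''n''" "nmem t ''adj'' = nmem st ''adj''" "rmem t ''len'' = rmem st ''len''"
      by (simp_all add: fr dijkstra_defs)
    then have ti: "input t" using inp input_cong by blast
    note ss = sem_single_source[OF ti ts, of \<omega>]
    have "\<exists>xs. explored (sem \<omega> single_source t) s xs \<and> set xs = verts G" if "s < Suc k" for s
    proof (cases "s = k")
      case True
      then show ?thesis using ss k I by auto
    next
      case False
      then have "s < k" using that by simp
      moreover have "\<forall>y. row (sem \<omega> single_source t) s y = row t s y" using ss k I False by auto
      ultimately show ?thesis using I explored_row by metis
    qed
    then show "(\<forall>s<Suc k. \<exists>xs. explored (sem \<omega> single_source t) s xs \<and> set xs = verts G) \<and>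
        (\<forall>s y. Suc k \<le> s \<longrightarrow> row (sem \<omega> single_source t) s y = (0, 0, 0, 0, \<lambda>_ _. 0))"
      using ss k I by auto
  next
    show "nmem st ''n'' [] = n" using inp by (simp add: input_def)
  qed (use zero in \<open>simp_all add: dijkstra_defs explored_def row_def\<close>)
qed

end

section \<open>Greedy hitting set\<close>

definition coef_body :: prog where
  "coef_body = PRSet ''r'' [NAdd (Var ''k'') (NConst 1)]
     (RDiv (RMul (RGet ''r'' [Var ''k'']) (OfNat (NAdd (NAdd (Var ''k'') (Var ''k'')) (NConst 1))))
       (OfNat (NAdd (NAdd (Var ''k'') (Var ''k'')) (NConst 2))))"

definition coef_table :: prog where
  "coef_table = PRSet ''r'' [NConst 0] (OfNat (NConst 1)) ;; PFor ''k'' 1 coef_body"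

text \<open>A path is long when it has at least \<open>sqrt (n (ln n)^3)\<close> vertices; the test
  compares squares.\<close>

definition mark_body :: prog where
  "mark_body = PIf (BNot (RLess (RMul (OfNat (NGet ''hop'' [Var ''u'', Var ''v''])) (OfNat (NGet ''hop'' [Var ''u'', Var ''v''])))
      (RMul (OfNat (Var ''n'')) (RMul (RLn (OfNat (Var ''n''))) (RMul (RLn (OfNat (Var ''n''))) (RLn (OfNat (Var ''n''))))))))
    (PRSet ''T'' [Var ''u'', Var ''v''] (OfNat (NConst 1)))"

definition mark_long :: prog where
  "mark_long = PFor ''u'' 1 (PFor ''v'' 1 mark_body)"

definition count_body :: prog where
  "count_body = PRSet ''cnt'' [] (RAdd (RGet ''cnt'' [])
     (RMul (RGet ''T'' [Var ''u'', Var ''v'']) (RGet ''P'' [Var ''u'', Var ''v'', Var ''x'', Var ''x''])))"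

definition count :: prog where
  "count = PFor ''u'' 1 (PFor ''v'' 1 count_body)"

definition candidate :: prog where
  "candidate = PRSet ''cnt'' [] (OfNat (NConst 0)) ;; count ;;
     PIf (RLess (RGet ''best'' []) (RGet ''cnt'' [])) (PRSet ''best'' [] (RGet ''cnt'' []) ;; PNSet ''bx'' [] (Var ''x''))"

text \<open>Storing the successor of the hitting vertex reserves 0, the initial content, for pairs
  that are never hit.\<close>

definition cover_body :: prog where
  "cover_body = PIf (RLess (OfNat (NConst 0)) (RMul (RGet ''T'' [Var ''u'', Var ''v'']) (RGet ''P'' [Var ''u'', Var ''v'', Var ''bx'', Var ''bx''])))
     (PRSet ''T'' [Var ''u'', Var ''v''] (OfNat (NConst 0)) ;; PNSet ''hit'' [Var ''u'', Var ''v''] (NAdd (Var ''bx'') (NConst 1)))"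

definition cover :: prog where
  "cover = PFor ''u'' 1 (PFor ''v'' 1 cover_body)"

definition greedy_step :: prog where
  "greedy_step = PRSet ''best'' [] (OfNat (NConst 0)) ;; PFor ''x'' 1 candidate ;;
     PIf (RLess (OfNat (NConst 0)) (RGet ''best'' [])) (PNSet ''m'' [] (NAdd (Var ''m'') (NConst 1)) ;; cover)"

text \<open>The two loops only count to \<open>n * n\<close>: each productive round covers at least
  one of at most \<open>n * n\<close> pairs.\<close>

definition greedy :: prog where
  "greedy = PFor ''i'' 1 (PFor ''j'' 1 greedy_step)"

definition log_term :: rexp where
  "log_term = RAdd (RLn (RDiv (OfNat (NConst 1)) (RGet ''delta'' []))) (OfNat (NConst 1))"

text \<open>With \<open>D\<close> the value of \<open>log_term\<close>, the constants make
  \<open>1 / \<tau>\<^sup>2\<close> and, when \<open>m\<close> is positive,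
  \<open>m * 4 * (1 + ln n) / \<sigma>\<^sup>2\<close> both equal to
  \<open>\<epsilon>\<^sup>2 / (8 * D)\<close>, half of the privacy budget each.\<close>

definition scales :: prog where
  "scales =
     PRSet ''sig'' [] (RDiv (RSqrt (RMul (OfNat (NConst 32)) (RMul (OfNat (Var ''m''))
        (RMul (RAdd (OfNat (NConst 1)) (RLn (OfNat (Var ''n'')))) log_term)))) (RGet ''eps'' [])) ;;
     PRSet ''tau'' [] (RDiv (RSqrt (RMul (OfNat (NConst 8)) log_term)) (RGet ''eps'' []))"

lemmas greedy_defs = greedy_def greedy_step_def candidate_def cover_def cover_body_def count_def count_body_def

section \<open>Correctness of the coefficient table and of the greedy program\<close>

lemma sem_coef_table:
  assumes n: "nmem st ''n'' [] = n"
  shows "\<forall>k\<le>n. rmem (sem \<omega> coef_table st) ''r'' [k] = sqrt_coef k"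
proof -
  define s1 where "s1 = rset ''r'' [0] 1 st"
  have n1: "nmem s1 ''n'' [] = n" using n by (simp add: s1_def)
  have eq: "sem \<omega> coef_table st = sem \<omega> (PFor ''k'' 1 coef_body) s1"
    by (simp add: coef_table_def s1_def del: sem.simps(6))
  show ?thesis
    unfolding eq
  proof (rule sem_PFor[where n = n and I = "\<lambda>k t. \<forall>j\<le>k. rmem t ''r'' [j] = sqrt_coef j"])
    fix k and t :: state assume "\<forall>j\<le>k. rmem t ''r'' [j] = sqrt_coef j" "nmem t ''k'' [] = k"
    moreover from this have "sem \<omega> coef_body t = rset ''r'' [Suc k] (sqrt_coef (Suc k)) t"
      by (simp add: coef_body_def add_ac)
    ultimately show "\<forall>j\<le>Suc k. rmem (sem \<omega> coef_body t) ''r'' [j] = sqrt_coef j"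
      by (simp add: le_Suc_eq del: sqrt_coef.simps)
  qed (simp_all add: n1 coef_body_def, simp add: s1_def)
qed

context usp_graph
begin

definition paths_known :: "state \<Rightarrow> bool" where
  "paths_known st \<longleftrightarrow> nmem st ''n'' [] = n \<and>
     (\<forall>u<n. \<forall>v<n. nmem st ''hop'' [u, v] = length (P u v) \<and>
       (\<forall>a<n. \<forall>b<n. rmem st ''P'' [u, v, a, b] = of_bool (on_path (P u v) a b)))"

lemma paths_known_cong:
  "nmem st' ''n'' = nmem st ''n'' \<Longrightarrow> nmem st' ''hop'' = nmem st ''hop'' \<Longrightarrow> rmem st' ''P'' = rmem st ''P'' \<Longrightarrow>
    paths_known st' \<longleftrightarrow> paths_known st"
  by (simp add: paths_known_def)

lemma explored_paths_known:
  assumes "nmem st ''n'' [] = n" "\<forall>s<n. \<exists>xs. explored st s xs \<and> set xs = verts G"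
  shows "paths_known st"
  using assms unfolding paths_known_def explored_def verts_def by blast

definition long :: "nat \<Rightarrow> nat \<Rightarrow> bool" where
  "long u v \<longleftrightarrow> real n * ln (real n) ^ 3 \<le> (real (length (P u v)))\<^sup>2"

lemma sem_mark_long:
  assumes pk: "paths_known st" and zero: "\<forall>u v. rmem st ''T'' [u, v] = 0"
  shows "\<forall>u v. rmem (sem \<omega> mark_long st) ''T'' [u, v] = of_bool (u < n \<and> v < n \<and> long u v)"
proof -
  let ?I = "\<lambda>Z t. \<forall>u v. rmem t ''T'' [u, v] = of_bool ((u, v) \<in> Z \<and> long u v)"
  show ?thesis
    unfolding mark_long_def
  proof (rule sem_PFor2[where n = n and I = ?I])
    fix Z x y and t :: state
    assume xy: "x < 1 * n" "y < 1 * n" and I: "?I Z t"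
      and v: "nmem t ''u'' [] = x" "nmem t ''v'' [] = y"
      and fr: "\<And>a. a \<notin> nwrites mark_body \<Longrightarrow> a \<noteq> ''u'' \<Longrightarrow> a \<noteq> ''v'' \<Longrightarrow> nmem t a = nmem st a"
    have h: "nmem t ''hop'' [x, y] = length (P x y)" "nmem t ''n'' [] = n"
      using pk xy by (simp_all add: fr mark_body_def paths_known_def)
    have "sem \<omega> mark_body t = (if long x y then rset ''T'' [x, y] 1 t else t)"
      by (simp add: mark_body_def v h long_def power2_eq_square power3_eq_cube mult.assoc not_less)
    then show "\<forall>u v. rmem (sem \<omega> mark_body t) ''T'' [u, v] = of_bool ((u, v) \<in> insert (x, y) Z \<and> long u v)"
      using I by auto
  next
    show "nmem st ''n'' [] = n" using pk by (simp add: paths_known_def)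
  qed (use zero in \<open>simp_all add: mark_body_def\<close>)
qed

definition todo :: "state \<Rightarrow> (nat \<times> nat) set" where
  "todo st = {(u, v). u < n \<and> v < n \<and> rmem st ''T'' [u, v] = 1}"

definition todo_through :: "state \<Rightarrow> nat \<Rightarrow> (nat \<times> nat) set" where
  "todo_through st x = {(u, v) \<in> todo st. x \<in> set (P u v)}"

lemma finite_todo [simp]: "finite (todo st)" "finite (todo_through st x)"
proof -
  show "finite (todo st)" by (rule finite_subset[of _ "{..<n} \<times> {..<n}"]) (auto simp: todo_def)
  then show "finite (todo_through st x)" by (rule rev_finite_subset) (auto simp: todo_through_def)
qed

lemma card_todo_le: "card (todo st) \<le> n * n"
proof -
  have "card (todo st) \<le> card ({..<n} \<times> {..<n})" by (intro card_mono) (auto simp: todo_def)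
  then show ?thesis by simp
qed

lemma todo_cong: "rmem st' ''T'' = rmem st ''T'' \<Longrightarrow> todo st' = todo st"
  by (simp add: todo_def)

lemma on_path_diag: "u < n \<Longrightarrow> v < n \<Longrightarrow> on_path (P u v) x x \<longleftrightarrow> x \<in> set (P u v)"
  using path_edges_subset[of "{x}" "P u v"] by (auto simp: on_path_def)

definition indicators :: "state \<Rightarrow> bool" where
  "indicators st \<longleftrightarrow> (\<forall>u<n. \<forall>v<n. rmem st ''T'' [u, v] \<in> {0, 1})"

lemma todo_times_path:
  assumes "paths_known st" "indicators st" "u < n" "v < n" "x < n"
  shows "rmem st ''T'' [u, v] * rmem st ''P'' [u, v, x, x] = of_bool ((u, v) \<in> todo_through st x)"
proof -
  have "rmem st ''T'' [u, v] \<in> {0, 1}" using assms by (simp add: indicators_def)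
  then show ?thesis
    using assms by (auto simp: paths_known_def on_path_diag todo_def todo_through_def)
qed

lemma sem_count:
  assumes pk: "paths_known st" and ind: "indicators st" and x: "nmem st ''x'' [] = x" "x < n"
    and zero: "rmem st ''cnt'' [] = 0"
  shows "rmem (sem \<omega> count st) ''cnt'' [] = real (card (todo_through st x))"
  unfolding count_def
proof (rule sem_PFor2[where n = n and I = "\<lambda>Z t. rmem t ''cnt'' [] = real (card (Z \<inter> todo_through st x))"])
  fix Z u v and t :: state
  assume uv: "u < 1 * n" "v < 1 * n" and I: "rmem t ''cnt'' [] = real (card (Z \<inter> todo_through st x))"
    and new: "(u, v) \<notin> Z" "finite Z"
    and var: "nmem t ''u'' [] = u" "nmem t ''v'' [] = v"
    and fr: "\<And>a. a \<notin> nwrites count_body \<Longrightarrow> a \<noteq> ''u'' \<Longrightarrow> a \<noteq> ''v'' \<Longrightarrow> nmem t a = nmem st a"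
      "\<And>a. a \<notin> rwrites count_body \<Longrightarrow> rmem t a = rmem st a"
  have "nmem t ''x'' [] = x" "rmem t ''T'' = rmem st ''T''" "rmem t ''P'' = rmem st ''P''"
    using x by (simp_all add: fr count_body_def)
  then have "rmem (sem \<omega> count_body t) ''cnt'' [] = real (card (Z \<inter> todo_through st x)) + of_bool ((u, v) \<in> todo_through st x)"
    using todo_times_path[OF pk ind] uv x by (simp add: count_body_def var I)
  also have "\<dots> = real (card (insert (u, v) Z \<inter> todo_through st x))"
    using new by auto
  finally show "rmem (sem \<omega> count_body t) ''cnt'' [] = real (card (insert (u, v) Z \<inter> todo_through st x))" .
next
  fix t :: state assume "rmem t ''cnt'' [] = real (card ({..<1 * n} \<times> {..<1 * n} \<inter> todo_through st x))"
  moreover have "{..<1 * n} \<times> {..<1 * n} \<inter> todo_through st x = todo_through st x"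
    by (auto simp: todo_through_def todo_def)
  ultimately show "rmem t ''cnt'' [] = real (card (todo_through st x))" by simp
next
  show "nmem st ''n'' [] = n" using pk by (simp add: paths_known_def)
qed (use zero in \<open>simp_all add: count_body_def\<close>)

lemma sem_candidates:
  fixes st :: state and \<omega>
  assumes pk: "paths_known st" and ind: "indicators st" and zero: "rmem st ''best'' [] = 0"
  defines "c \<equiv> \<lambda>x. real (card (todo_through st x))"
  defines "st' \<equiv> sem \<omega> (PFor ''x'' 1 candidate) st"
  shows "(\<forall>x<n. c x \<le> rmem st' ''best'' []) \<and>
    (0 < rmem st' ''best'' [] \<longrightarrow> nmem st' ''bx'' [] < n \<and> c (nmem st' ''bx'' []) = rmem st' ''best'' [])"
  unfolding st'_def
proof (rule sem_PFor[where n = n and I = "\<lambda>k t. 0 \<le> rmem t ''best'' [] \<and> (\<forall>x<k. c x \<le> rmem t ''best'' []) \<and>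
    (0 < rmem t ''best'' [] \<longrightarrow> nmem t ''bx'' [] < n \<and> c (nmem t ''bx'' []) = rmem t ''best'' [])"])
  fix k and t :: state
  assume k: "k < 1 * n" and var: "nmem t ''x'' [] = k"
    and I: "0 \<le> rmem t ''best'' [] \<and> (\<forall>x<k. c x \<le> rmem t ''best'' []) \<and>
    (0 < rmem t ''best'' [] \<longrightarrow> nmem t ''bx'' [] < n \<and> c (nmem t ''bx'' []) = rmem t ''best'' [])"
    and fr: "\<And>a. a \<notin> nwrites candidate \<Longrightarrow> a \<noteq> ''x'' \<Longrightarrow> nmem t a = nmem st a"
      "\<And>a. a \<notin> rwrites candidate \<Longrightarrow> rmem t a = rmem st a"
  define t0 where "t0 = rset ''cnt'' [] 0 t"
  define t1 where "t1 = sem \<omega> count t0"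
  have T: "rmem t0 ''T'' = rmem st ''T''" "nmem t0 ''n'' = nmem st ''n''" "nmem t0 ''hop'' = nmem st ''hop''"
      "rmem t0 ''P'' = rmem st ''P''"
    by (simp_all add: t0_def fr greedy_defs fun_eq_iff)
  have pk0: "paths_known t0" using pk paths_known_cong T by blast
  have ind0: "indicators t0" using ind by (simp add: indicators_def T)
  have cnt: "rmem t1 ''cnt'' [] = c k"
    using sem_count[OF pk0 ind0, of k \<omega>] var k todo_cong[OF T(1)]
    by (simp add: t0_def t1_def c_def todo_through_def)
  have best: "rmem t1 ''best'' = rmem t ''best''"
    using sem_rmem_frame[of "''best''" count \<omega> t0] by (simp add: t1_def t0_def greedy_defs fun_eq_iff)
  have bx: "nmem t1 ''bx'' = nmem t ''bx''" "nmem t1 ''x'' [] = k"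
    using sem_nmem_frame[of "''bx''" count \<omega> t0] sem_nmem_frame[of "''x''" count \<omega> t0] var
    by (simp_all add: t1_def t0_def greedy_defs)
  have eq: "sem \<omega> candidate t = (if rmem t ''best'' [] < c k then nset ''bx'' [] k (rset ''best'' [] (c k) t1) else t1)"
    using cnt best bx by (simp add: candidate_def t0_def[symmetric] t1_def[symmetric])
  show "0 \<le> rmem (sem \<omega> candidate t) ''best'' [] \<and> (\<forall>x<Suc k. c x \<le> rmem (sem \<omega> candidate t) ''best'' []) \<and>
    (0 < rmem (sem \<omega> candidate t) ''best'' [] \<longrightarrow> nmem (sem \<omega> candidate t) ''bx'' [] < n \<and>
      c (nmem (sem \<omega> candidate t) ''bx'' []) = rmem (sem \<omega> candidate t) ''best'' [])"
  proof (cases "rmem t ''best'' [] < c k")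
    case True
    then show ?thesis unfolding eq using I k by (force simp: less_Suc_eq)
  next
    case False
    then show ?thesis unfolding eq using I best bx by (auto simp: less_Suc_eq)
  qed
next
  show "nmem st ''n'' [] = n" using pk by (simp add: paths_known_def)
qed (use zero in \<open>simp_all add: greedy_defs\<close>)

lemma sem_cover:
  assumes pk: "paths_known st" and ind: "indicators st" and x: "nmem st ''bx'' [] = x" "x < n"
  shows "\<forall>u v. rmem (sem \<omega> cover st) ''T'' [u, v] = (if (u, v) \<in> todo_through st x then 0 else rmem st ''T'' [u, v]) \<and>
    nmem (sem \<omega> cover st) ''hit'' [u, v] = (if (u, v) \<in> todo_through st x then Suc x else nmem st ''hit'' [u, v])"
proof -
  let ?I = "\<lambda>Z t. \<forall>u v.
    rmem t ''T'' [u, v] = (if (u, v) \<in> Z \<and> (u, v) \<in> todo_through st x then 0 else rmem st ''T'' [u, v]) \<and>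
    nmem t ''hit'' [u, v] = (if (u, v) \<in> Z \<and> (u, v) \<in> todo_through st x then Suc x else nmem st ''hit'' [u, v])"
  show ?thesis
    unfolding cover_def
  proof (rule sem_PFor2[where n = n and I = ?I])
    fix Z u v and t :: state
    assume uv: "u < 1 * n" "v < 1 * n" "(u, v) \<notin> Z" and var: "nmem t ''u'' [] = u" "nmem t ''v'' [] = v"
      and I: "?I Z t"
      and fr: "\<And>a. a \<notin> nwrites cover_body \<Longrightarrow> a \<noteq> ''u'' \<Longrightarrow> a \<noteq> ''v'' \<Longrightarrow> nmem t a = nmem st a"
        "\<And>a. a \<notin> rwrites cover_body \<Longrightarrow> rmem t a = rmem st a"
    have "nmem t ''bx'' [] = x" "rmem t ''P'' = rmem st ''P''" using x by (simp_all add: fr cover_body_def)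
    moreover have "rmem t ''T'' [u, v] = rmem st ''T'' [u, v]" using I uv by simp
    ultimately have "sem \<omega> cover_body t = (if (u, v) \<in> todo_through st x
        then nset ''hit'' [u, v] (Suc x) (rset ''T'' [u, v] 0 t) else t)"
      using todo_times_path[OF pk ind] uv x by (simp add: cover_body_def var)
    then show "\<forall>a b. rmem (sem \<omega> cover_body t) ''T'' [a, b] =
        (if (a, b) \<in> insert (u, v) Z \<and> (a, b) \<in> todo_through st x then 0 else rmem st ''T'' [a, b]) \<and>
      nmem (sem \<omega> cover_body t) ''hit'' [a, b] =
        (if (a, b) \<in> insert (u, v) Z \<and> (a, b) \<in> todo_through st x then Suc x else nmem st ''hit'' [a, b])"
      using I by auto
  next
    fix t :: state
    assume "\<forall>u v.
      rmem t ''T'' [u, v] = (if (u, v) \<in> {..<1 * n} \<times> {..<1 * n} \<and> (u, v) \<in> todo_through st x then 0 else rmem st ''T'' [u, v]) \<and>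
      nmem t ''hit'' [u, v] = (if (u, v) \<in> {..<1 * n} \<times> {..<1 * n} \<and> (u, v) \<in> todo_through st x then Suc x else nmem st ''hit'' [u, v])"
    moreover have "(u, v) \<in> todo_through st x \<Longrightarrow> (u, v) \<in> {..<1 * n} \<times> {..<1 * n}" for u v
      by (auto simp: todo_through_def todo_def)
    ultimately show "\<forall>u v. rmem t ''T'' [u, v] = (if (u, v) \<in> todo_through st x then 0 else rmem st ''T'' [u, v]) \<and>
      nmem t ''hit'' [u, v] = (if (u, v) \<in> todo_through st x then Suc x else nmem st ''hit'' [u, v])"
      by meson
  next
    show "nmem st ''n'' [] = n" using pk by (simp add: paths_known_def)
  qed (simp_all add: cover_body_def)
qed

end

section \<open>Size of the greedy hitting set\<close>

context usp_graph
begin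

definition threshold :: real where
  "threshold = sqrt (real n * ln (real n) ^ 3)"

text \<open>Bounds the fraction of uncovered pairs that survives one greedy choice. It is negative
  if the threshold exceeds \<open>n\<close>, but then no path is long.\<close>

definition ratio :: real where
  "ratio = 1 - threshold / real n"

lemma threshold_nonneg: "0 \<le> threshold"
  using ln_n_nonneg by (simp add: threshold_def)

lemma long_iff: "long u v \<longleftrightarrow> threshold \<le> real (length (P u v))"
  using ln_n_nonneg by (auto simp: long_def threshold_def real_sqrt_le_iff real_le_lsqrt sqrt_le_D)

text \<open>Double counting of incidences between uncovered pairs and vertices on their paths: each
  pair has at least \<open>threshold\<close> of them, each vertex at most \<open>B\<close>.\<close>

lemma card_todo_threshold:
  assumes long: "\<forall>(u, v)\<in>todo st. long u v" and max: "\<And>x. x < n \<Longrightarrow> real (card (todo_through st x)) \<le> B"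
  shows "threshold * real (card (todo st)) \<le> real n * B"
proof -
  have "threshold * real (card (todo st)) = (\<Sum>p\<in>todo st. threshold)" by simp
  also have "\<dots> \<le> (\<Sum>p\<in>todo st. real (card {x\<in>{..<n}. x \<in> set (P (fst p) (snd p))}))"
  proof (intro sum_mono)
    fix p assume p: "p \<in> todo st"
    then have uv: "fst p \<in> verts G" "snd p \<in> verts G" by (auto simp: todo_def verts_def)
    have "{x\<in>{..<n}. x \<in> set (P (fst p) (snd p))} = set (P (fst p) (snd p))"
      using P_facts(5)[OF uv] by (auto simp: verts_def)
    then show "threshold \<le> real (card {x\<in>{..<n}. x \<in> set (P (fst p) (snd p))})"
      using long p P_facts(4)[OF uv] by (auto simp: long_iff distinct_card)
  qed
  also have "\<dots> = real (\<Sum>p\<in>todo st. \<Sum>x\<in>{x\<in>{..<n}. x \<in> set (P (fst p) (snd p))}. 1)" by simp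
  also have "(\<Sum>p\<in>todo st. \<Sum>x\<in>{x\<in>{..<n}. x \<in> set (P (fst p) (snd p))}. 1)
      = (\<Sum>x\<in>{..<n}. \<Sum>p\<in>{p\<in>todo st. x \<in> set (P (fst p) (snd p))}. 1 :: nat)"
    by (rule sum.swap_restrict) auto
  also have "real \<dots> = (\<Sum>x<n. real (card (todo_through st x)))"
  proof -
    have "{p\<in>todo st. x \<in> set (P (fst p) (snd p))} = todo_through st x" for x
      by (auto simp: todo_through_def)
    then show ?thesis by simp
  qed
  also have "\<dots> \<le> (\<Sum>x<n. B)" by (intro sum_mono max) auto
  finally show ?thesis by simp
qed

definition hitters :: "state \<Rightarrow> nat set" where
  "hitters st = {h. \<exists>u<n. \<exists>v<n. nmem st ''hit'' [u, v] = Suc h}"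

definition greedy_inv :: "nat \<Rightarrow> state \<Rightarrow> bool" where
  "greedy_inv z st \<longleftrightarrow> indicators st \<and> (\<forall>(u, v)\<in>todo st. long u v) \<and>
     (\<forall>u<n. \<forall>v<n. \<forall>h. nmem st ''hit'' [u, v] = Suc h \<longrightarrow> h \<in> set (P u v)) \<and>
     (\<forall>u<n. \<forall>v<n. nmem st ''hit'' [u, v] = 0 \<and> long u v \<longrightarrow> (u, v) \<in> todo st) \<and>
     card (hitters st) \<le> nmem st ''m'' [] \<and>
     real (card (todo st)) \<le> (real n)\<^sup>2 * ratio ^ nmem st ''m'' [] \<and>
     (0 < nmem st ''m'' [] \<longrightarrow> 0 \<le> ratio \<and> 1 \<le> (real n)\<^sup>2 * ratio ^ (nmem st ''m'' [] - 1)) \<and>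
     (todo st = {} \<or> card (todo st) + z \<le> n * n)"

lemma greedy_inv_cong:
  assumes "rmem st' ''T'' = rmem st ''T''" "nmem st' ''hit'' = nmem st ''hit''" "nmem st' ''m'' = nmem st ''m''"
  shows "greedy_inv z st' \<longleftrightarrow> greedy_inv z st"
  using assms by (simp add: greedy_inv_def indicators_def todo_def hitters_def)

lemma hitters_subset:
  assumes "\<And>u v. nmem st' ''hit'' [u, v] = nmem st ''hit'' [u, v] \<or> nmem st' ''hit'' [u, v] = Suc x"
  shows "hitters st' \<subseteq> insert x (hitters st)"
proof
  fix h assume "h \<in> hitters st'"
  then obtain u v where "u < n" "v < n" "nmem st' ''hit'' [u, v] = Suc h" by (auto simp: hitters_def)
  then have "u < n \<and> v < n \<and> nmem st ''hit'' [u, v] = Suc h \<or> h = x" using assms[of u v] by auto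
  then show "h \<in> insert x (hitters st)" unfolding hitters_def by blast
qed

lemma finite_hitters: "greedy_inv z st \<Longrightarrow> finite (hitters st)"
proof (rule finite_subset)
  assume "greedy_inv z st"
  then show "hitters st \<subseteq> {..<n}"
    using P_facts(5) unfolding greedy_inv_def hitters_def verts_def by blast
qed simp

lemma sem_greedy_step:
  assumes pk: "paths_known st" and inv: "greedy_inv z st"
  shows "greedy_inv (Suc z) (sem \<omega> greedy_step st)"
proof -
  define t0 where "t0 = rset ''best'' [] 0 st"
  define t1 where "t1 = sem \<omega> (PFor ''x'' 1 candidate) t0"
  define B where "B = rmem t1 ''best'' []"
  define x where "x = nmem t1 ''bx'' []"
  define m where "m = nmem st ''m'' []"
  define t2 where "t2 = nset ''m'' [] (Suc m) t1"
  have fr: "nmem t1 a = nmem st a" if "a \<notin> {''bx'', ''x'', ''u'', ''v''}" for a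
    using sem_nmem_frame[of a "PFor ''x'' 1 candidate" \<omega> t0] that by (simp add: t1_def t0_def greedy_defs del: sem.simps(6))
  have fr': "rmem t1 a = rmem st a" if "a \<notin> {''best'', ''cnt''}" for a
    using sem_rmem_frame[of a "PFor ''x'' 1 candidate" \<omega> t0] that by (simp add: t1_def t0_def greedy_defs fun_eq_iff del: sem.simps(6))
  have same: "rmem t1 ''T'' = rmem st ''T''" "nmem t1 ''hit'' = nmem st ''hit''" "nmem t1 ''m'' = nmem st ''m''"
    "rmem t1 ''P'' = rmem st ''P''" "nmem t1 ''hop'' = nmem st ''hop''" "nmem t1 ''n'' = nmem st ''n''"
    by (simp_all add: fr fr')
  have ind: "indicators st" using inv by (simp add: greedy_inv_def)
  have "paths_known t0" "indicators t0" using pk ind by (simp_all add: t0_def paths_known_def indicators_def)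
  note cand = sem_candidates[OF this, of \<omega>]
  have tt0: "todo_through t0 y = todo_through st y" for y by (simp add: t0_def todo_through_def todo_def)
  have cand: "\<And>y. y < n \<Longrightarrow> real (card (todo_through st y)) \<le> B"
      "0 < B \<Longrightarrow> x < n \<and> real (card (todo_through st x)) = B"
    using cand unfolding t1_def[symmetric] B_def[symmetric] x_def[symmetric] tt0 by (auto simp: t0_def)
  have eq: "sem \<omega> greedy_step st = (if 0 < B then sem \<omega> cover t2 else t1)"
    using same(3) by (simp add: greedy_step_def t0_def[symmetric] t1_def[symmetric] t2_def B_def m_def Suc_eq_plus1 del: sem.simps(6) One_nat_def)
  show ?thesis
  proof (cases "0 < B")
    case False
    \<comment> \<open>An uncovered pair has its own endpoint on its path, so that endpoint would
      have been a candidate with positive count.\<close>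
    have "todo st = {}"
    proof (rule ccontr)
      assume "todo st \<noteq> {}"
      then obtain u v where uv: "(u, v) \<in> todo st" by auto
      then have "u < n" "v < n" by (auto simp: todo_def)
      then have "(u, v) \<in> todo_through st u" using uv P_facts(7)[of u v] by (simp add: todo_through_def verts_def)
      then have "0 < card (todo_through st u)" by (auto simp: card_gt_0_iff)
      then show False using cand(1)[OF \<open>u < n\<close>] False by simp
    qed
    then have "greedy_inv (Suc z) st" using inv by (simp add: greedy_inv_def)
    then show ?thesis using False eq greedy_inv_cong[OF same(1-3)] by simp
  next
    case True
    have xn: "x < n" and xB: "real (card (todo_through st x)) = B" using cand(2)[OF True] by auto
    define t3 where "t3 = sem \<omega> cover t2"
    have "paths_known t2" "indicators t2" "nmem t2 ''bx'' [] = x"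
      using pk ind by (simp_all add: t2_def paths_known_def indicators_def same x_def)
    note cov = sem_cover[OF this xn, of \<omega>]
    have tt2: "todo_through t2 x = todo_through st x" by (simp add: t2_def todo_through_def todo_def same)
    have T3: "rmem t3 ''T'' [u, v] = (if (u, v) \<in> todo_through st x then 0 else rmem st ''T'' [u, v])"
      and hit3: "nmem t3 ''hit'' [u, v] = (if (u, v) \<in> todo_through st x then Suc x else nmem st ''hit'' [u, v])" for u v
      using cov unfolding t3_def[symmetric] tt2 by (simp_all add: t2_def same)
    have m3: "nmem t3 ''m'' [] = Suc m"
      using sem_nmem_frame[of "''m''" cover \<omega> t2] by (simp add: t3_def t2_def greedy_defs)
    have sub: "todo_through st x \<subseteq> todo st" by (auto simp: todo_through_def)
    have todo3: "todo t3 = todo st - todo_through st x" by (auto simp: todo_def T3)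
    have card3: "card (todo t3) = card (todo st) - card (todo_through st x)"
      "card (todo_through st x) \<le> card (todo st)"
      using sub by (simp_all add: todo3 card_Diff_subset card_mono)
    have pos: "0 < card (todo_through st x)" using True xB by simp
    then have ne: "todo st \<noteq> {}" using sub by auto
    obtain a b where ab: "(a, b) \<in> todo st" using ne by auto
    then have "long a b" "a \<in> verts G" "b \<in> verts G"
      using inv unfolding greedy_inv_def by (blast, auto simp: todo_def verts_def)
    \<comment> \<open>A long path exists and no simple path has more than \<open>n\<close> vertices;
      hence \<open>ratio\<close> is nonnegative here.\<close>
    then have "threshold \<le> real n" using length_P_le[of a b] unfolding long_iff by linarith
    then have r: "0 \<le> ratio" using n_pos by (simp add: ratio_def)
    \<comment> \<open>By averaging, the best vertex covers at least the fraction
      \<open>threshold / n\<close> of the remaining pairs.\<close>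
    have "threshold * real (card (todo st)) \<le> real n * B"
      using inv cand(1) by (intro card_todo_threshold) (auto simp: greedy_inv_def)
    then have "real (card (todo t3)) \<le> real (card (todo st)) * ratio"
      using card3 xB n_pos by (simp add: of_nat_diff ratio_def field_simps)
    also have "\<dots> \<le> (real n)\<^sup>2 * ratio ^ m * ratio"
      using inv r by (intro mult_right_mono) (auto simp: greedy_inv_def m_def)
    finally have c1: "real (card (todo t3)) \<le> (real n)\<^sup>2 * ratio ^ Suc m" by (simp add: mult_ac)
    have "1 \<le> real (card (todo st))" using ne by (simp add: Suc_le_eq card_gt_0_iff)
    then have c2: "1 \<le> (real n)\<^sup>2 * ratio ^ m" using inv by (simp add: greedy_inv_def m_def)
    have c3: "card (todo t3) + Suc z \<le> n * n"
      using inv ne card3 pos by (auto simp: greedy_inv_def)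
    have "card (hitters t3) \<le> card (insert x (hitters st))"
      using finite_hitters[OF inv] hitters_subset[of t3 st x] hit3 by (intro card_mono) auto
    also have "\<dots> \<le> Suc (card (hitters st))" using finite_hitters[OF inv] by (simp add: card_insert_if)
    also have "\<dots> \<le> Suc m" using inv by (simp add: greedy_inv_def m_def)
    finally have c4: "card (hitters t3) \<le> Suc m" .
    have c5: "indicators t3" using ind by (simp add: indicators_def T3)
    have c6: "\<forall>(u, v)\<in>todo t3. long u v" using inv by (auto simp: greedy_inv_def todo3)
    have c7: "\<forall>u<n. \<forall>v<n. \<forall>h. nmem t3 ''hit'' [u, v] = Suc h \<longrightarrow> h \<in> set (P u v)"
      using inv by (auto simp: greedy_inv_def hit3 todo_through_def)
    have c8: "\<forall>u<n. \<forall>v<n. nmem t3 ''hit'' [u, v] = 0 \<and> long u v \<longrightarrow> (u, v) \<in> todo t3"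
      using inv by (auto simp: greedy_inv_def hit3 todo3)
    have "greedy_inv (Suc z) t3"
      unfolding greedy_inv_def m3 using c1 c2 c3 c4 c5 c6 c7 c8 r by simp
    then show ?thesis using True eq by (simp add: t3_def)
  qed
qed

lemma sem_greedy:
  assumes pk: "paths_known st" and T: "\<forall>u v. rmem st ''T'' [u, v] = of_bool (u < n \<and> v < n \<and> long u v)"
    and hit: "\<forall>u v. nmem st ''hit'' [u, v] = 0" and m: "nmem st ''m'' [] = 0"
  shows "greedy_inv (n * n) (sem \<omega> greedy st)"
  unfolding greedy_def
proof (rule sem_PFor2[where n = n and I = "\<lambda>Z t. greedy_inv (card Z) t"])
  have "todo st = {(u, v). u < n \<and> v < n \<and> long u v}" by (auto simp: todo_def T)
  then show "greedy_inv (card {}) st"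
    using card_todo_le[of st] T hit m
    by (auto simp: greedy_inv_def indicators_def hitters_def power2_eq_square simp flip: of_nat_mult)
next
  fix Z x y and t :: state
  assume Z: "(x, y) \<notin> Z" "finite Z" and I: "greedy_inv (card Z) t"
    and fr: "\<And>a. a \<notin> nwrites greedy_step \<Longrightarrow> a \<noteq> ''i'' \<Longrightarrow> a \<noteq> ''j'' \<Longrightarrow> nmem t a = nmem st a"
      "\<And>a. a \<notin> rwrites greedy_step \<Longrightarrow> rmem t a = rmem st a"
  have "nmem t ''n'' = nmem st ''n''" "nmem t ''hop'' = nmem st ''hop''" "rmem t ''P'' = rmem st ''P''"
    by (simp_all add: fr greedy_defs)
  then have "paths_known t" using pk paths_known_cong by blast
  from sem_greedy_step[OF this I, of \<omega>] show "greedy_inv (card (insert (x, y) Z)) (sem \<omega> greedy_step t)"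
    using Z by simp
next
  show "nmem st ''n'' [] = n" using pk by (simp add: paths_known_def)
qed (simp_all add: greedy_defs greedy_inv_def indicators_def todo_def hitters_def)

text \<open>Since \<open>1 - x \<le> exp (- x)\<close>, a pair surviving \<open>m - 1\<close>
  choices gives \<open>1 \<le> n^2 exp (- (m - 1) threshold / n)\<close>; taking logarithms bounds
  \<open>m\<close>.\<close>

lemma greedy_inv_final:
  assumes "greedy_inv (n * n) st"
  shows "\<And>u v. u < n \<Longrightarrow> v < n \<Longrightarrow> nmem st ''hit'' [u, v] = 0 \<Longrightarrow> \<not> long u v"
    "(real (nmem st ''m'' []) - 1) * threshold \<le> 2 * real n * ln (real n)"
proof -
  have "todo st = {}" using assms by (auto simp: greedy_inv_def)
  then show "\<And>u v. u < n \<Longrightarrow> v < n \<Longrightarrow> nmem st ''hit'' [u, v] = 0 \<Longrightarrow> \<not> long u v"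
    using assms unfolding greedy_inv_def by blast
  show "(real (nmem st ''m'' []) - 1) * threshold \<le> 2 * real n * ln (real n)"
  proof (cases "nmem st ''m'' []")
    case 0
    have "0 \<le> 2 * real n * ln (real n)" using ln_n_nonneg by simp
    then show ?thesis using 0 threshold_nonneg by simp
  next
    case (Suc k)
    then have r: "0 \<le> ratio" "1 \<le> (real n)\<^sup>2 * ratio ^ k" using assms by (auto simp: greedy_inv_def)
    have "ratio \<le> exp (- (threshold / real n))" using exp_ge_add_one_self[of "- (threshold / real n)"] by (simp add: ratio_def)
    then have "ratio ^ k \<le> exp (- (threshold / real n)) ^ k" using r by (intro power_mono)
    then have "1 \<le> (real n)\<^sup>2 * exp (- (real k * threshold / real n))"
      using r(2) mult_left_mono[of "ratio ^ k" "exp (- (threshold / real n)) ^ k" "(real n)\<^sup>2"]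
      by (simp add: exp_of_nat_mult[symmetric])
    then have "ln 1 \<le> ln ((real n)\<^sup>2 * exp (- (real k * threshold / real n)))"
      using n_pos by (subst ln_le_cancel_iff) auto
    then have "real k * threshold / real n \<le> 2 * ln (real n)"
      using n_pos by (simp add: ln_mult ln_realpow)
    then show ?thesis using Suc n_pos by (simp add: field_simps)
  qed
qed

end

definition phase1 :: prog where
  "phase1 = dijkstra ;; coef_table ;; mark_long ;; greedy ;; scales"

lemmas phase1_defs = dijkstra_defs greedy_defs coef_table_def coef_body_def mark_long_def mark_body_def scales_def log_term_def

lemma wellformed_phase1: "wellformed phase1"
  by (simp add: phase1_def phase1_defs)

lemma public_phase1: "public phase1"
  by (simp add: phase1_def phase1_defs)

context usp_graph
begin

lemma sem_phase1:
  fixes w :: "nat set \<Rightarrow> real" and \<omega>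
  assumes eps: "0 < \<epsilon>" and del: "0 < \<delta>" "\<delta> < 1"
  defines "st \<equiv> sem \<omega> phase1 (initial_state \<epsilon> \<delta> G w)"
  shows "paths_known st" "\<forall>k\<le>n. rmem st ''r'' [k] = sqrt_coef k"
    and "noise_structure G (\<lambda>s u. nmem st ''pos'' [s, u]) (\<lambda>u v. nmem st ''hit'' [u, v]) (nmem st ''m'' [])
      (rmem st ''sig'' []) (rmem st ''tau'' [])"
    and "\<And>u v. u < n \<Longrightarrow> v < n \<Longrightarrow> nmem st ''hit'' [u, v] = 0 \<Longrightarrow> real (length (P u v)) < threshold"
    and "(real (nmem st ''m'' []) - 1) * threshold \<le> 2 * real n * ln (real n)"
    and "(rmem st ''sig'' [])\<^sup>2 = 32 * real (nmem st ''m'' []) * (1 + ln (real n)) * (ln (1 / \<delta>) + 1) / \<epsilon>\<^sup>2"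
    and "(rmem st ''tau'' [])\<^sup>2 = 8 * (ln (1 / \<delta>) + 1) / \<epsilon>\<^sup>2"
proof -
  define s0 where "s0 = initial_state \<epsilon> \<delta> G w"
  define s1 where "s1 = sem \<omega> dijkstra s0"
  define s2 where "s2 = sem \<omega> coef_table s1"
  define s3 where "s3 = sem \<omega> mark_long s2"
  define s4 where "s4 = sem \<omega> greedy s3"
  have st: "st = sem \<omega> scales s4" by (simp add: st_def phase1_def s0_def s1_def s2_def s3_def s4_def)
  have inp: "input s0"
    by (auto simp: input_def s0_def initial_state_def)
  have row0: "\<forall>s y. row s0 s y = (0, 0, 0, 0, \<lambda>_ _. 0)" by (simp add: row_def s0_def initial_state_def)
  have f1: "nmem s1 a = nmem s0 a" if "a \<notin> nwrites dijkstra" for a using that by (simp add: s1_def sem_nmem_frame)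
  have f1': "rmem s1 a = rmem s0 a" if "a \<notin> rwrites dijkstra" for a using that by (simp add: s1_def sem_rmem_frame)
  have f2: "nmem s2 a = nmem s1 a" if "a \<notin> nwrites coef_table" for a using that by (simp add: s2_def sem_nmem_frame)
  have f2': "rmem s2 a = rmem s1 a" if "a \<notin> rwrites coef_table" for a using that by (simp add: s2_def sem_rmem_frame)
  have f3: "nmem s3 a = nmem s2 a" if "a \<notin> nwrites mark_long" for a using that by (simp add: s3_def sem_nmem_frame)
  have f3': "rmem s3 a = rmem s2 a" if "a \<notin> rwrites mark_long" for a using that by (simp add: s3_def sem_rmem_frame)
  have f4: "nmem s4 a = nmem s3 a" if "a \<notin> nwrites greedy" for a using that by (simp add: s4_def sem_nmem_frame)
  have f4': "rmem s4 a = rmem s3 a" if "a \<notin> rwrites greedy" for a using that by (simp add: s4_def sem_rmem_frame)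
  have f5: "nmem st a = nmem s4 a" for a unfolding st by (rule sem_nmem_frame) (simp add: scales_def)
  have f5': "rmem st a = rmem s4 a" if "a \<notin> {''sig'', ''tau''}" for a
    unfolding st by (rule sem_rmem_frame) (use that in \<open>simp add: scales_def\<close>)
  have n0: "nmem s0 ''n'' [] = n" using inp by (simp add: input_def)
  have N: "nmem s1 ''n'' [] = n" "nmem s2 ''n'' [] = n" "nmem s3 ''n'' [] = n" "nmem s4 ''n'' [] = n"
  proof -
    show 1: "nmem s1 ''n'' [] = n" by (subst f1) (simp_all add: n0 dijkstra_defs)
    show 2: "nmem s2 ''n'' [] = n" by (subst f2) (simp_all add: 1 coef_table_def coef_body_def)
    show 3: "nmem s3 ''n'' [] = n" by (subst f3) (simp_all add: 2 mark_long_def mark_body_def)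
    show "nmem s4 ''n'' [] = n" by (subst f4) (simp_all add: 3 greedy_defs)
  qed
  have dij: "\<forall>s<n. \<exists>xs. explored s1 s xs \<and> set xs = verts G"
    unfolding s1_def by (rule sem_dijkstra[OF inp row0])
  have pk1: "paths_known s1" using N(1) dij by (rule explored_paths_known)
  have pk2: "paths_known s2" using pk1 by (subst paths_known_cong[of _ s1]) (simp_all add: f2 f2' coef_table_def coef_body_def)
  have pk3: "paths_known s3" using pk2 by (subst paths_known_cong[of _ s2]) (simp_all add: f3 f3' mark_long_def mark_body_def)
  have pk4: "paths_known s4" using pk3 by (subst paths_known_cong[of _ s3]) (simp_all add: f4 f4' greedy_defs)
  show "paths_known st" using pk4 by (subst paths_known_cong[of _ s4]) (simp_all add: f5 f5')
  have r2: "\<forall>k\<le>n. rmem s2 ''r'' [k] = sqrt_coef k" unfolding s2_def by (rule sem_coef_table[OF N(1)])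
  have "rmem st ''r'' = rmem s2 ''r''" by (simp add: f5' f4' f3' greedy_defs mark_long_def mark_body_def)
  then show "\<forall>k\<le>n. rmem st ''r'' [k] = sqrt_coef k" using r2 by simp
  have T2: "rmem s2 ''T'' = rmem s0 ''T''" by (simp add: f2' f1' coef_table_def coef_body_def dijkstra_defs)
  have T3: "\<forall>u v. rmem s3 ''T'' [u, v] = of_bool (u < n \<and> v < n \<and> long u v)"
    unfolding s3_def by (rule sem_mark_long[OF pk2]) (simp add: T2 s0_def initial_state_def)
  have h3: "nmem s3 ''hit'' = nmem s0 ''hit''" "nmem s3 ''m'' = nmem s0 ''m''"
    by (simp_all add: f3 f2 f1 coef_table_def coef_body_def dijkstra_defs mark_long_def mark_body_def)
  have gi: "greedy_inv (n * n) s4"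
    unfolding s4_def by (rule sem_greedy[OF pk3 T3]) (simp_all add: h3 s0_def initial_state_def)
  note fin = greedy_inv_final[OF gi]
  show "real (length (P u v)) < threshold" if "u < n" "v < n" "nmem st ''hit'' [u, v] = 0" for u v
    using fin(1)[OF that(1,2)] that(3) by (simp add: f5 long_iff not_le)
  show "(real (nmem st ''m'' []) - 1) * threshold \<le> 2 * real n * ln (real n)" using fin(2) by (simp add: f5)
  have ed: "rmem s4 ''eps'' [] = \<epsilon>" "rmem s4 ''delta'' [] = \<delta>"
    by (simp_all add: f4' f3' f2' f1' phase1_defs) (simp_all add: s0_def initial_state_def)
  define D where "D = ln (1 / \<delta>) + 1"
  have D: "0 < D" unfolding D_def using del by (intro add_pos_pos ln_gt_zero) auto
  have C: "0 < 1 + ln (real n)" using ln_n_nonneg by simp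
  have sig: "rmem st ''sig'' [] = sqrt (32 * (real (nmem st ''m'' []) * ((1 + ln (real n)) * D))) / \<epsilon>"
    and tau: "rmem st ''tau'' [] = sqrt (8 * D) / \<epsilon>"
    unfolding f5 by (simp_all add: st scales_def log_term_def N ed D_def)
  show "(rmem st ''sig'' [])\<^sup>2 = 32 * real (nmem st ''m'' []) * (1 + ln (real n)) * (ln (1 / \<delta>) + 1) / \<epsilon>\<^sup>2"
    using C D by (simp add: sig power_divide D_def[symmetric] mult_ac)
  show "(rmem st ''tau'' [])\<^sup>2 = 8 * (ln (1 / \<delta>) + 1) / \<epsilon>\<^sup>2"
    using D by (simp add: tau power_divide D_def[symmetric])
  have pos: "nmem st ''pos'' = nmem s1 ''pos''"
    by (simp add: f5 f4 f3 f2 greedy_defs mark_long_def mark_body_def coef_table_def coef_body_def)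
  show "noise_structure G (\<lambda>s u. nmem st ''pos'' [s, u]) (\<lambda>u v. nmem st ''hit'' [u, v]) (nmem st ''m'' [])
      (rmem st ''sig'' []) (rmem st ''tau'' [])"
  proof
    fix s assume "s < n"
    then show "\<exists>xs. tree_order G s xs \<and> set xs = verts G \<and> (\<forall>i<length xs. nmem st ''pos'' [s, xs ! i] = i)"
      using dij unfolding pos explored_def by blast
  next
    fix u v h assume "u < n" "v < n" "nmem st ''hit'' [u, v] = Suc h"
    then show "h \<in> set (P u v)" using gi by (simp add: f5 greedy_inv_def)
  next
    show "card {h. \<exists>u<n. \<exists>v<n. nmem st ''hit'' [u, v] = Suc h} \<le> nmem st ''m'' []"
      using gi by (simp add: f5 greedy_inv_def hitters_def)
  next
    assume "0 < nmem st ''m'' []"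
    then show "0 < rmem st ''sig'' []" using C D eps by (simp add: sig)
  next
    show "0 < rmem st ''tau'' []" using D eps by (simp add: tau)
  qed
qed

end

section \<open>Sampling and output\<close>

definition sample_body :: prog where
  "sample_body = PSample ''g'' [Var ''x'', Var ''y'']"

definition sample_all :: prog where
  "sample_all = PFor ''x'' 2 (PFor ''y'' 1 sample_body)"

definition add_query :: prog where
  "add_query = PIf (NLess (Var ''x'') (Var ''y'')) (PRSet ''out'' [Var ''u'', Var ''v''] (RAdd (RGet ''out'' [Var ''u'', Var ''v''])
     (RMul (RGet ''P'' [Var ''u'', Var ''v'', Var ''x'', Var ''y'']) (RGet ''attr'' [Var ''x'', Var ''y'']))))"

definition add_edge_noise :: prog where
  "add_edge_noise = PIf (BAnd (BNot (NLess (NConst 0) (NGet ''hit'' [Var ''u'', Var ''v'']))) (NLess (Var ''x'') (Var ''y'')))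
     (PRSet ''out'' [Var ''u'', Var ''v''] (RAdd (RGet ''out'' [Var ''u'', Var ''v''])
       (RMul (RMul (RGet ''tau'' []) (RGet ''P'' [Var ''u'', Var ''v'', Var ''x'', Var ''y''])) (RGet ''g'' [Var ''x'', Var ''y'']))))"

text \<open>Adds an entry of \<open>toeplitz\<close>; the guard keeps the truncated subtraction
  exact.\<close>

definition add_coef :: "string \<Rightarrow> prog" where
  "add_coef a = PIf (BNot (NLess (NGet ''pos'' [Var ''x'', Var a]) (Var ''y'')))
     (PRSet ''t'' [] (RAdd (RGet ''t'' []) (RGet ''r'' [NSub (NGet ''pos'' [Var ''x'', Var a]) (Var ''y'')])))"

text \<open>Equality of \<open>hit\<close> with the successor of \<open>x\<close> is tested by two
  strict inequalities. Tree noise of the root \<open>x\<close> lies in row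
  \<open>n + x\<close>.\<close>

definition add_tree_noise :: prog where
  "add_tree_noise = PIf (BAnd (NLess (Var ''x'') (NGet ''hit'' [Var ''u'', Var ''v''])) (NLess (NGet ''hit'' [Var ''u'', Var ''v'']) (NAdd (Var ''x'') (NConst 2))))
     (PRSet ''t'' [] (OfNat (NConst 0)) ;; add_coef ''u'' ;; add_coef ''v'' ;;
      PRSet ''out'' [Var ''u'', Var ''v''] (RAdd (RGet ''out'' [Var ''u'', Var ''v''])
        (RMul (RMul (RGet ''sig'' []) (RGet ''t'' [])) (RGet ''g'' [NAdd (Var ''n'') (Var ''x''), Var ''y'']))))"

definition out_body :: prog where
  "out_body = add_query ;; add_edge_noise ;; add_tree_noise"

definition out_pair :: prog where
  "out_pair = PFor ''x'' 1 (PFor ''y'' 1 out_body)"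

definition out_all :: prog where
  "out_all = PFor ''u'' 1 (PFor ''v'' 1 out_pair)"

definition phase2 :: prog where
  "phase2 = sample_all ;; out_all"

lemmas phase2_defs = sample_body_def sample_all_def add_query_def add_edge_noise_def add_coef_def
  add_tree_noise_def out_body_def out_pair_def out_all_def

lemma wellformed_phase2: "wellformed phase2"
  by (simp add: phase2_def phase2_defs)

text \<open>The row-major numbering of the variates is the one that \<open>sum_div_mod\<close>
  inverts, which turns the array into a single Gaussian vector.\<close>

lemma sem_sample_all:
  assumes n: "nmem st ''n'' [] = n" and d: "drawn st = 0"
  shows "\<forall>x<2 * n. \<forall>y<n. rmem (sem \<omega> sample_all st) ''g'' [x, y] = \<omega> (x * n + y)"
  unfolding sample_all_def
proof (rule sem_PFor[where n = n and I = "\<lambda>k t. drawn t = k * n \<and> (\<forall>x<k. \<forall>y<n. rmem t ''g'' [x, y] = \<omega> (x * n + y))"])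
  fix k and t :: state
  assume I: "drawn t = k * n \<and> (\<forall>x<k. \<forall>y<n. rmem t ''g'' [x, y] = \<omega> (x * n + y))"
    and k: "nmem t ''x'' [] = k"
    and fr: "\<And>a. a \<notin> nwrites (PFor ''y'' 1 sample_body) \<Longrightarrow> a \<noteq> ''x'' \<Longrightarrow> nmem t a = nmem st a"
  show "drawn (sem \<omega> (PFor ''y'' 1 sample_body) t) = Suc k * n \<and>
    (\<forall>x<Suc k. \<forall>y<n. rmem (sem \<omega> (PFor ''y'' 1 sample_body) t) ''g'' [x, y] = \<omega> (x * n + y))"
  proof (rule sem_PFor[where n = n and I = "\<lambda>q t'. drawn t' = k * n + q \<and>
      (\<forall>x y. x < k \<and> y < n \<or> x = k \<and> y < q \<longrightarrow> rmem t' ''g'' [x, y] = \<omega> (x * n + y))"])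
    fix q and t' :: state
    assume I': "drawn t' = k * n + q \<and>
      (\<forall>x y. x < k \<and> y < n \<or> x = k \<and> y < q \<longrightarrow> rmem t' ''g'' [x, y] = \<omega> (x * n + y))"
      and q: "nmem t' ''y'' [] = q"
      and fr': "\<And>a. a \<notin> nwrites sample_body \<Longrightarrow> a \<noteq> ''y'' \<Longrightarrow> nmem t' a = nmem t a"
    have x: "nmem t' ''x'' [] = k" using k by (simp add: fr' sample_body_def)
    show "drawn (sem \<omega> sample_body t') = k * n + Suc q \<and>
      (\<forall>x y. x < k \<and> y < n \<or> x = k \<and> y < Suc q \<longrightarrow> rmem (sem \<omega> sample_body t') ''g'' [x, y] = \<omega> (x * n + y))"
    proof -
      have "sem \<omega> sample_body t' = rset ''g'' [k, q] (\<omega> (k * n + q)) (t'\<lparr>drawn := Suc (k * n + q)\<rparr>)"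
        using I' x q by (simp add: sample_body_def)
      then show ?thesis using I' by (auto simp: less_Suc_eq)
    qed
  next
    show "nmem t ''n'' [] = n" using n by (simp add: fr sample_body_def)
  qed (use I in \<open>auto simp: sample_body_def less_Suc_eq\<close>)
qed (use n d in \<open>simp_all add: sample_body_def\<close>)

lemma public_drawn: "public p \<Longrightarrow> drawn (sem \<omega> p s) = drawn s"
proof (induction p arbitrary: s)
  case (PFor i m p)
  have "drawn (fold (\<lambda>k s. sem \<omega> p (nset i [] k s)) ks s) = drawn s" for ks s
    using PFor by (induction ks arbitrary: s) auto
  then show ?case by simp
qed auto

lemma sum_div_mod:
  fixes f :: "nat \<Rightarrow> nat \<Rightarrow> real"
  assumes "0 < n"
  shows "(\<Sum>x<M. \<Sum>y<n. f x y) = (\<Sum>k<M * n. f (k div n) (k mod n))"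
proof -
  have "(\<Sum>k<M * n. f (k div n) (k mod n)) = (\<Sum>x<M. \<Sum>k\<in>{x * n..<x * n + n}. f (k div n) (k mod n))"
    by (rule sum.nat_group[symmetric])
  also have "\<dots> = (\<Sum>x<M. \<Sum>y<n. f x y)"
  proof (rule sum.cong[OF refl])
    fix x
    have "(\<Sum>y<n. f x y) = (\<Sum>y<n. f ((x * n + y) div n) ((x * n + y) mod n))" by (intro sum.cong refl) auto
    also have "\<dots> = (\<Sum>k\<in>{x * n..<x * n + n}. f (k div n) (k mod n))"
      by (rule sum.reindex_bij_witness[where i = "\<lambda>k. k - x * n" and j = "\<lambda>y. x * n + y"]) auto
    finally show "(\<Sum>k\<in>{x * n..<x * n + n}. f (k div n) (k mod n)) = (\<Sum>y<n. f x y)" by simp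
  qed
  finally show ?thesis by simp
qed

context noise_structure
begin

definition params :: "state \<Rightarrow> bool" where
  "params st \<longleftrightarrow> paths_known st \<and> (\<forall>k\<le>n. rmem st ''r'' [k] = sqrt_coef k) \<and>
     (\<forall>s u. nmem st ''pos'' [s, u] = pos s u) \<and> (\<forall>u v. nmem st ''hit'' [u, v] = hit u v) \<and>
     rmem st ''sig'' [] = \<sigma> \<and> rmem st ''tau'' [] = \<tau>"

definition summand :: "state \<Rightarrow> nat \<Rightarrow> nat \<Rightarrow> nat \<Rightarrow> nat \<Rightarrow> real" where
  "summand st u v x y = (if x < y \<and> {x, y} \<in> pedges u v then rmem st ''attr'' [x, y] else 0) +
     noise_coef u v x y * rmem st ''g'' [x, y] + noise_coef u v (n + x) y * rmem st ''g'' [n + x, y]"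

lemma sem_out_body:
  assumes par: "params t" and var: "nmem t ''u'' [] = u" "nmem t ''v'' [] = v" "nmem t ''x'' [] = x" "nmem t ''y'' [] = y"
    and less: "u < n" "v < n" "x < n" "y < n"
  shows "rmem (sem \<omega> out_body t) ''out'' = (rmem t ''out'')([u, v] := rmem t ''out'' [u, v] + summand t u v x y)"
proof -
  have nn: "nmem t ''n'' [] = n" using par by (simp add: params_def paths_known_def)
  have Pxy: "rmem t ''P'' [u, v, x, y] = of_bool ({x, y} \<in> pedges u v)" if "x < y"
    using par less that by (simp add: params_def paths_known_def on_path_def)
  define t1 where "t1 = sem \<omega> add_query t"
  define t2 where "t2 = sem \<omega> add_edge_noise t1"
  have t1: "t1 = (if x < y then rset ''out'' [u, v] (rmem t ''out'' [u, v] + of_bool ({x, y} \<in> pedges u v) * rmem t ''attr'' [x, y]) t else t)"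
    by (simp add: t1_def add_query_def var Pxy)
  have v1: "nmem t1 = nmem t" and f1: "\<And>a. a \<noteq> ''out'' \<Longrightarrow> rmem t1 a = rmem t a"
    by (auto simp: t1 fun_eq_iff)
  have o1: "rmem t1 ''out'' = (rmem t ''out'')([u, v] := rmem t ''out'' [u, v] +
      (if x < y \<and> {x, y} \<in> pedges u v then rmem t ''attr'' [x, y] else 0))"
    by (auto simp: t1 fun_eq_iff)
  have t2: "t2 = (if hit u v = 0 \<and> x < y then rset ''out'' [u, v] (rmem t1 ''out'' [u, v] +
      \<tau> * of_bool ({x, y} \<in> pedges u v) * rmem t ''g'' [x, y]) t1 else t1)"
    using par by (simp add: t2_def add_edge_noise_def v1 f1 var Pxy params_def)
  have v2: "nmem t2 = nmem t" and f2: "\<And>a. a \<noteq> ''out'' \<Longrightarrow> rmem t2 a = rmem t a"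
    by (auto simp: t2 v1 f1 fun_eq_iff)
  have o2: "rmem t2 ''out'' = (rmem t1 ''out'')([u, v] := rmem t1 ''out'' [u, v] + noise_coef u v x y * rmem t ''g'' [x, y])"
    using less by (auto simp: t2 fun_eq_iff noise_coef_def)
  have coef: "rmem t' ''t'' [] = rmem t0 ''t'' [] + toeplitz (pos x z) y \<and> nmem t' = nmem t0 \<and> (\<forall>a. a \<noteq> ''t'' \<longrightarrow> rmem t' a = rmem t0 a)"
    if "t' = sem \<omega> (add_coef a) t0" "nmem t0 = nmem t" "\<And>a. a \<noteq> ''t'' \<Longrightarrow> a \<noteq> ''out'' \<Longrightarrow> rmem t0 a = rmem t a"
      "nmem t a [] = z" "z < n" for t' t0 :: state and a z
  proof -
    have "rmem t ''r'' [pos x z - y] = sqrt_coef (pos x z - y)"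
      using par pos_less[OF less(3) that(5)] by (simp add: params_def)
    moreover have "nmem t ''pos'' [x, z] = pos x z" using par by (simp add: params_def)
    ultimately have "t' = (if y \<le> pos x z then rset ''t'' [] (rmem t0 ''t'' [] + sqrt_coef (pos x z - y)) t0 else t0)"
      using that by (simp add: add_coef_def var not_less)
    then show ?thesis by (auto simp: toeplitz_def fun_eq_iff)
  qed
  define t3 where "t3 = rset ''t'' [] 0 t2"
  define t4 where "t4 = sem \<omega> (add_coef ''u'') t3"
  define t5 where "t5 = sem \<omega> (add_coef ''v'') t4"
  have c4: "rmem t4 ''t'' [] = toeplitz (pos x u) y \<and> nmem t4 = nmem t \<and> (\<forall>a. a \<noteq> ''t'' \<longrightarrow> rmem t4 a = rmem t2 a)"
    using coef[OF t4_def, of u] var less v2 f2 by (simp add: t3_def fun_eq_iff)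
  have c5: "rmem t5 ''t'' [] = toeplitz (pos x u) y + toeplitz (pos x v) y \<and> nmem t5 = nmem t \<and> (\<forall>a. a \<noteq> ''t'' \<longrightarrow> rmem t5 a = rmem t2 a)"
    using coef[OF t5_def, of v] var less c4 f2 by simp
  have cond: "x < hit u v \<and> hit u v < x + 2 \<longleftrightarrow> hit u v = Suc x" by auto
  have "sem \<omega> out_body t = sem \<omega> add_tree_noise t2" by (simp add: out_body_def t1_def t2_def)
  also have "\<dots> = (if hit u v = Suc x then rset ''out'' [u, v] (rmem t2 ''out'' [u, v] +
      \<sigma> * (toeplitz (pos x u) y + toeplitz (pos x v) y) * rmem t ''g'' [n + x, y]) t5 else t2)"
    using par c5 cond
    by (simp add: add_tree_noise_def t3_def[symmetric] t4_def[symmetric] t5_def[symmetric] v2 f2 var nn params_def)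
  finally have "rmem (sem \<omega> out_body t) ''out'' = (rmem t2 ''out'')([u, v] := rmem t2 ''out'' [u, v] +
      noise_coef u v (n + x) y * rmem t ''g'' [n + x, y])"
    using c5 by (auto simp: fun_eq_iff noise_coef_def)
  then show ?thesis by (simp add: o1 o2 summand_def add.assoc)
qed

lemma params_cong:
  assumes "nmem t ''n'' = nmem st ''n''" "nmem t ''hop'' = nmem st ''hop''" "nmem t ''pos'' = nmem st ''pos''"
    "nmem t ''hit'' = nmem st ''hit''" "rmem t ''P'' = rmem st ''P''" "rmem t ''r'' = rmem st ''r''"
    "rmem t ''sig'' = rmem st ''sig''" "rmem t ''tau'' = rmem st ''tau''"
  shows "params t \<longleftrightarrow> params st"
  using assms paths_known_cong[of t st] by (simp add: params_def)

lemma sem_out_pair: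
  assumes par: "params st" and var: "nmem st ''u'' [] = u" "nmem st ''v'' [] = v" and less: "u < n" "v < n"
  shows "rmem (sem \<omega> out_pair st) ''out'' = (rmem st ''out'')([u, v] := rmem st ''out'' [u, v] +
    (\<Sum>(x, y)\<in>{..<n} \<times> {..<n}. summand st u v x y))"
  unfolding out_pair_def
proof (rule sem_PFor2[where n = n and I = "\<lambda>Z t. rmem t ''out'' = (rmem st ''out'')([u, v] := rmem st ''out'' [u, v] +
    (\<Sum>(x, y)\<in>Z. summand st u v x y))"])
  fix Z x y and t :: state
  assume xy: "x < 1 * n" "y < 1 * n" "(x, y) \<notin> Z" "finite Z"
    and I: "rmem t ''out'' = (rmem st ''out'')([u, v] := rmem st ''out'' [u, v] + (\<Sum>(x, y)\<in>Z. summand st u v x y))"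
    and vxy: "nmem t ''x'' [] = x" "nmem t ''y'' [] = y"
    and fr: "\<And>a. a \<notin> nwrites out_body \<Longrightarrow> a \<noteq> ''x'' \<Longrightarrow> a \<noteq> ''y'' \<Longrightarrow> nmem t a = nmem st a"
      "\<And>a. a \<notin> rwrites out_body \<Longrightarrow> rmem t a = rmem st a"
  have "params t" using par by (subst params_cong[of t st]) (simp_all add: fr phase2_defs)
  moreover have "nmem t ''u'' [] = u" "nmem t ''v'' [] = v" using var by (simp_all add: fr phase2_defs)
  moreover have "summand t u v x y = summand st u v x y"
    by (simp add: summand_def fr phase2_defs)
  ultimately show "rmem (sem \<omega> out_body t) ''out'' = (rmem st ''out'')([u, v] := rmem st ''out'' [u, v] +
      (\<Sum>(x, y)\<in>insert (x, y) Z. summand st u v x y))"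
    using sem_out_body[of t u v x y \<omega>] vxy less xy by (simp add: I add_ac)
next
  show "nmem st ''n'' [] = n" using par by (simp add: params_def paths_known_def)
qed (simp_all add: phase2_defs)

lemma sem_out_all:
  assumes par: "params st" and zero: "\<And>u v. rmem st ''out'' [u, v] = 0"
  shows "\<forall>u<n. \<forall>v<n. rmem (sem \<omega> out_all st) ''out'' [u, v] = (\<Sum>(x, y)\<in>{..<n} \<times> {..<n}. summand st u v x y)"
proof -
  let ?I = "\<lambda>Z t. \<forall>u v. rmem t ''out'' [u, v] =
    (if (u, v) \<in> Z then \<Sum>(x, y)\<in>{..<n} \<times> {..<n}. summand st u v x y else 0)"
  show ?thesis
    unfolding out_all_def
  proof (rule sem_PFor2[where n = n and I = ?I])
    fix Z u v and t :: state
    assume uv: "u < 1 * n" "v < 1 * n" "(u, v) \<notin> Z"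
      and I: "?I Z t"
      and var: "nmem t ''u'' [] = u" "nmem t ''v'' [] = v"
      and fr: "\<And>a. a \<notin> nwrites out_pair \<Longrightarrow> a \<noteq> ''u'' \<Longrightarrow> a \<noteq> ''v'' \<Longrightarrow> nmem t a = nmem st a"
        "\<And>a. a \<notin> rwrites out_pair \<Longrightarrow> rmem t a = rmem st a"
    have "params t" using par by (subst params_cong[of t st]) (simp_all add: fr phase2_defs)
    moreover have "summand t u v x y = summand st u v x y" for x y
      by (simp add: summand_def fr phase2_defs)
    ultimately have "rmem (sem \<omega> out_pair t) ''out'' = (rmem t ''out'')([u, v] := (\<Sum>(x, y)\<in>{..<n} \<times> {..<n}. summand st u v x y))"
      using sem_out_pair[of t u v \<omega>] var uv I by simp
    then show "\<forall>a b. rmem (sem \<omega> out_pair t) ''out'' [a, b] =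
      (if (a, b) \<in> insert (u, v) Z then \<Sum>(x, y)\<in>{..<n} \<times> {..<n}. summand st a b x y else 0)"
      using I by auto
  next
    show "nmem st ''n'' [] = n" using par by (simp add: params_def paths_known_def)
  qed (simp_all add: phase2_defs zero)
qed

definition noise_vec :: "nat \<Rightarrow> nat \<Rightarrow> nat \<Rightarrow> real" where
  "noise_vec u v k = noise_coef u v (k div n) (k mod n)"

text \<open>Every output is the true answer plus a linear form in the Gaussian vector;
  \<open>attr\<close> enters only through the true answer.\<close>

lemma sem_phase2:
  assumes par: "params st" and zero: "\<And>u v. rmem st ''out'' [u, v] = 0" and d: "drawn st = 0"
    and attr: "\<And>x y. {x, y} \<in> edges G \<Longrightarrow> rmem st ''attr'' [x, y] = w {x, y}"
    and uv: "u < n" "v < n"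
  shows "rmem (sem \<omega> phase2 st) ''out'' [u, v] = counting_query G w u v + lin_form ((n + n) * n) (noise_vec u v) \<omega>"
proof -
  define s1 where "s1 = sem \<omega> sample_all st"
  have fr: "nmem s1 a = nmem st a" if "a \<notin> {''x'', ''y''}" for a
    unfolding s1_def using that by (intro sem_nmem_frame) (simp add: phase2_defs)
  have fr': "rmem s1 a = rmem st a" if "a \<noteq> ''g''" for a
    unfolding s1_def using that by (intro sem_rmem_frame) (simp add: phase2_defs)
  have nn: "nmem st ''n'' [] = n" using par by (simp add: params_def paths_known_def)
  have par1: "params s1" using par by (subst params_cong[of s1 st]) (simp_all add: fr fr')
  have g: "rmem s1 ''g'' [x, y] = \<omega> (x * n + y)" if "x < n + n" "y < n" for x y
    using sem_sample_all[OF nn d, of \<omega>] that by (simp add: s1_def)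
  have pe: "pedges u v \<subseteq> edges G" using P_facts(6)[of u v] uv by (simp add: verts_def)
  have "rmem (sem \<omega> phase2 st) ''out'' [u, v] = (\<Sum>(x, y)\<in>{..<n} \<times> {..<n}. summand s1 u v x y)"
    using sem_out_all[OF par1, of \<omega>] uv zero by (simp add: phase2_def s1_def[symmetric] fr')
  also have "\<dots> = (\<Sum>x<n. \<Sum>y<n. summand s1 u v x y)" by (simp add: sum.cartesian_product)
  also have "\<dots> = (\<Sum>x<n. \<Sum>y<n. if x < y \<and> {x, y} \<in> pedges u v then w {x, y} else 0) +
      ((\<Sum>x<n. \<Sum>y<n. noise_coef u v x y * \<omega> (x * n + y)) +
       (\<Sum>x<n. \<Sum>y<n. noise_coef u v (n + x) y * \<omega> ((n + x) * n + y)))"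
    unfolding sum.distrib[symmetric]
  proof (intro sum.cong refl)
    fix x y assume "x \<in> {..<n}" "y \<in> {..<n}"
    then show "summand s1 u v x y = (if x < y \<and> {x, y} \<in> pedges u v then w {x, y} else 0) +
      (noise_coef u v x y * \<omega> (x * n + y) + noise_coef u v (n + x) y * \<omega> ((n + x) * n + y))"
      using attr[of x y] pe g[of x y] g[of "n + x" y] by (auto simp: summand_def fr')
  qed
  also have "(\<Sum>x<n. \<Sum>y<n. if x < y \<and> {x, y} \<in> pedges u v then w {x, y} else 0) = counting_query G w u v"
    unfolding counting_query_def by (rule sum_pedges_ordered[OF uv])
  also have "(\<Sum>x<n. \<Sum>y<n. noise_coef u v x y * \<omega> (x * n + y)) + (\<Sum>x<n. \<Sum>y<n. noise_coef u v (n + x) y * \<omega> ((n + x) * n + y))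
      = (\<Sum>x<n + n. \<Sum>y<n. noise_coef u v x y * \<omega> (x * n + y))"
    by (rule sum_lessThan_add[symmetric])
  also have "\<dots> = lin_form ((n + n) * n) (noise_vec u v) \<omega>"
    unfolding sum_div_mod[OF n_pos] lin_form_def noise_vec_def by simp
  finally show ?thesis .
qed

end

section \<open>Privacy and accuracy\<close>

lemma measurable_output:
  "(\<And>u v. X u v \<in> borel_measurable randomness) \<Longrightarrow>
    (\<lambda>\<omega>. \<lambda>(u, v)\<in>verts G \<times> verts G. X u v \<omega>) \<in> measurable randomness (output_space G)"
  unfolding output_space_def by (intro measurable_restrict) (auto simp: case_prod_beta)

locale calibrated_noise = noise_structure +
  fixes \<epsilon> \<delta> :: real
  assumes eps: "0 < \<epsilon>" "\<epsilon> < 1" and del: "0 < \<delta>" "\<delta> < 1"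
    and sigma: "\<sigma>\<^sup>2 = 32 * real m * (1 + ln (real n)) * (ln (1 / \<delta>) + 1) / \<epsilon>\<^sup>2"
    and tau: "\<tau>\<^sup>2 = 8 * (ln (1 / \<delta>) + 1) / \<epsilon>\<^sup>2"
    and unhit: "\<And>u v. u < n \<Longrightarrow> v < n \<Longrightarrow> hit u v = 0 \<Longrightarrow> real (length (P u v)) < threshold"
    and m_bound: "(real m - 1) * threshold \<le> 2 * real n * ln (real n)"
begin

definition noisy :: "(nat set \<Rightarrow> real) \<Rightarrow> (nat \<Rightarrow> real) \<Rightarrow> nat \<times> nat \<Rightarrow> real" where
  "noisy w \<omega> = (\<lambda>(u, v)\<in>verts G \<times> verts G. counting_query G w u v + lin_form ((n + n) * n) (noise_vec u v) \<omega>)"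

abbreviation "D \<equiv> ln (1 / \<delta>) + 1"

lemma D_pos: "0 < D"
  using del by (intro add_pos_pos ln_gt_zero) auto

lemma noisy_measurable [measurable]: "noisy w \<in> measurable randomness (output_space G)"
  unfolding noisy_def by (rule measurable_output) simp

lemma noisy_shift:
  assumes "neighboring G w w'"
  obtains b where "\<And>k. (n + n) * n \<le> k \<Longrightarrow> b k = 0" "sq_norm ((n + n) * n) b \<le> \<epsilon>\<^sup>2 / (4 * D)"
    "\<And>\<omega>. noisy w \<omega> = noisy w' (\<lambda>k. \<omega> k + b k)"
proof -
  have "(\<Sum>e\<in>edges G. \<bar>w e - w' e\<bar>) \<le> 1" using assms by (simp add: neighboring_def)
  from noise_shift[OF this] obtain c where
    c: "(\<Sum>x<n + n. \<Sum>y<n. (c x y)\<^sup>2) \<le> 1 / \<tau>\<^sup>2 + real m * (4 * (1 + ln (real n)) / \<sigma>\<^sup>2)"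
    "\<And>u v. u < n \<Longrightarrow> v < n \<Longrightarrow> (\<Sum>x<n + n. \<Sum>y<n. noise_coef u v x y * c x y) = (\<Sum>e\<in>pedges u v. w e - w' e)"
    by blast
  define b where "b k = (if k < (n + n) * n then c (k div n) (k mod n) else 0)" for k
  show thesis
  proof (rule that[of b])
    show "b k = 0" if "(n + n) * n \<le> k" for k using that by (simp add: b_def)
    have C: "0 < 1 + ln (real n)" using ln_n_nonneg by simp
    have "sq_norm ((n + n) * n) b = (\<Sum>x<n + n. \<Sum>y<n. (c x y)\<^sup>2)"
      unfolding sum_div_mod[OF n_pos] sq_norm_def b_def by (intro sum.cong) auto
    also have "\<dots> \<le> 1 / \<tau>\<^sup>2 + real m * (4 * (1 + ln (real n)) / \<sigma>\<^sup>2)" by (rule c(1))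
    \<comment> \<open>One half of the budget pays for the edges, the other for the trees; without
      hitting vertices the second term is zero.\<close>
    also have "\<dots> \<le> \<epsilon>\<^sup>2 / (8 * D) + \<epsilon>\<^sup>2 / (8 * D)"
    proof (rule add_mono)
      show "1 / \<tau>\<^sup>2 \<le> \<epsilon>\<^sup>2 / (8 * D)" by (simp add: tau)
      show "real m * (4 * (1 + ln (real n)) / \<sigma>\<^sup>2) \<le> \<epsilon>\<^sup>2 / (8 * D)"
      proof (cases "m = 0")
        case False
        define C E where "C = 1 + ln (real n)" and "E = D"
        have "0 < C" "0 < E" using ln_n_nonneg D_pos by (simp_all add: C_def E_def)
        then have "real m * (4 * C / \<sigma>\<^sup>2) = \<epsilon>\<^sup>2 / (8 * E)"
          unfolding sigma C_def[symmetric] E_def[symmetric] using False eps by (simp add: field_simps)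
        then show ?thesis by (simp add: C_def E_def)
      qed (use D_pos in simp)
    qed
    also have "\<dots> = \<epsilon>\<^sup>2 / (4 * D)"
    proof -
      have "x / (8 * E) + x / (8 * E) = x / (4 * E)" for x E :: real by simp
      then show ?thesis .
    qed
    finally show "sq_norm ((n + n) * n) b \<le> \<epsilon>\<^sup>2 / (4 * D)" .
    fix \<omega>
    have "counting_query G w u v + lin_form ((n + n) * n) (noise_vec u v) \<omega>
        = counting_query G w' u v + lin_form ((n + n) * n) (noise_vec u v) (\<lambda>k. \<omega> k + b k)" if "u < n" "v < n" for u v
    proof -
      have "lin_form ((n + n) * n) (noise_vec u v) b = (\<Sum>x<n + n. \<Sum>y<n. noise_coef u v x y * c x y)"
        unfolding sum_div_mod[OF n_pos] lin_form_def noise_vec_def b_def by (intro sum.cong) auto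
      also have "\<dots> = counting_query G w u v - counting_query G w' u v"
        using c(2)[OF that] by (simp add: counting_query_def sum_subtractf)
      finally show ?thesis by (simp add: lin_form_def distrib_left sum.distrib)
    qed
    then show "noisy w \<omega> = noisy w' (\<lambda>k. \<omega> k + b k)"
      by (auto simp: noisy_def verts_def fun_eq_iff restrict_def)
  qed
qed

text \<open>Running on \<open>w\<close> amounts to running on \<open>w'\<close> with translated
  noise, so an output event pulls back to one noise event \<open>A\<close> and the Gaussian
  mechanism applies to it.\<close>

lemma noisy_private:
  "differentially_private \<epsilon> \<delta> G (\<lambda>w. distr randomness (output_space G) (noisy w))"
  unfolding differentially_private_def
proof (intro allI impI ballI)
  fix w w' C
  assume nb: "neighboring G w w'" and "C \<in> sets (distr randomness (output_space G) (noisy w))"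
  then have C [measurable]: "C \<in> sets (output_space G)" by simp
  obtain b where b: "\<And>k. (n + n) * n \<le> k \<Longrightarrow> b k = 0" "sq_norm ((n + n) * n) b \<le> \<epsilon>\<^sup>2 / (4 * D)"
    "\<And>\<omega>. noisy w \<omega> = noisy w' (\<lambda>k. \<omega> k + b k)"
    using noisy_shift[OF nb] by blast
  define A where "A = noisy w' -` C"
  have A: "A \<in> sets randomness"
    using measurable_sets[OF noisy_measurable[of w'] C] by (simp add: A_def)
  have "measure (distr randomness (output_space G) (noisy w)) C = measure randomness {\<omega>. (\<lambda>k. \<omega> k + b k) \<in> A}"
    by (subst measure_distr) (simp_all add: b(3) A_def vimage_def)
  also have "\<dots> \<le> exp \<epsilon> * measure randomness A + \<delta>"
    using b(1,2) eps del A by (intro gaussian_mechanism) auto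
  also have "measure randomness A = measure (distr randomness (output_space G) (noisy w')) C"
    by (subst measure_distr) (simp_all add: A_def)
  finally show "measure (distr randomness (output_space G) (noisy w)) C \<le>
    exp \<epsilon> * measure (distr randomness (output_space G) (noisy w')) C + \<delta>" .
qed

text \<open>Both kinds of noise have variance of order
  \<open>threshold * D / \<epsilon>\<^sup>2\<close>. The constant comes from the trees: 128 is 4
  times the 32 of \<open>\<sigma>\<close>, 9 comes from \<open>1 + l \<le> 3 * l\<close>, and 3 from
  the bound on \<open>m * l^2\<close>.\<close>

lemma sq_norm_noise_vec_le:
  assumes n2: "2 \<le> n" and uv: "u < n" "v < n"
  shows "sq_norm ((n + n) * n) (noise_vec u v) \<le> 3456 * threshold * D / \<epsilon>\<^sup>2"
proof -
  define l where "l = ln (real n)"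
  \<comment> \<open>The lower bound, which needs \<open>n\<close> at least 2, gives
    \<open>1 + l \<le> 3 * l\<close>.\<close>
  have l: "1 / 2 \<le> l" "l \<le> real n"
  proof -
    have "1 / 2 \<le> ln (2 :: real)" using ln2_ge_two_thirds by simp
    also have "\<dots> \<le> l" using n2 by (simp add: l_def)
    finally show "1 / 2 \<le> l" .
    show "l \<le> real n" using n2 ln_le_minus_one[of "real n"] by (simp add: l_def)
  qed
  have th2: "threshold\<^sup>2 = real n * l ^ 3" using l by (simp add: threshold_def l_def)
  have th: "0 < threshold" using l n2 by (simp add: threshold_def l_def[symmetric])
  have "sq_norm ((n + n) * n) (noise_vec u v) = (\<Sum>x<n + n. \<Sum>y<n. (noise_coef u v x y)\<^sup>2)"
    unfolding sum_div_mod[OF n_pos] sq_norm_def noise_vec_def ..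
  also have "\<dots> \<le> (if hit u v = 0 then \<tau>\<^sup>2 * real (length (P u v)) else 4 * \<sigma>\<^sup>2 * (1 + ln (real n)))"
    by (rule sq_norm_noise_coef_le[OF uv])
  also have "\<dots> \<le> 3456 * threshold * D / \<epsilon>\<^sup>2"
  proof (cases "hit u v = 0")
    case True
    have "\<tau>\<^sup>2 * real (length (P u v)) \<le> \<tau>\<^sup>2 * threshold"
      using unhit[OF uv True] by (intro mult_left_mono) auto
    also have "\<dots> = 8 * (threshold * D / \<epsilon>\<^sup>2)" by (simp add: tau)
    also have "\<dots> \<le> 3456 * (threshold * D / \<epsilon>\<^sup>2)" using D_pos th by (intro mult_right_mono) auto
    finally show ?thesis using True by (simp add: mult_ac)
  next
    case False
    \<comment> \<open>Pays for the 1 subtracted from \<open>m\<close> in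
      \<open>m_bound\<close>.\<close>
    have "l ^ 2 \<le> threshold"
    proof (rule power2_le_imp_le)
      have "l * l ^ 3 \<le> real n * l ^ 3" using l by (intro mult_right_mono) auto
      then show "(l ^ 2)\<^sup>2 \<le> threshold\<^sup>2" by (simp add: th2 power_mult[symmetric] power_Suc[symmetric] del: power_Suc)
    qed (use th in simp)
    \<comment> \<open>Since \<open>n * l^3\<close> is the square of \<open>threshold\<close>,
      multiplying \<open>m_bound\<close> by \<open>l^2\<close> and cancelling one
      \<open>threshold\<close> gives the claim.\<close>
    moreover have "(real m - 1) * l ^ 2 \<le> 2 * threshold"
    proof -
      have "((real m - 1) * threshold) * l ^ 2 \<le> (2 * real n * l) * l ^ 2"
        using m_bound by (intro mult_right_mono) (auto simp: l_def)
      also have "\<dots> = 2 * threshold * threshold" using th2 by (simp add: power2_eq_square power3_eq_cube)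
      finally have "threshold * ((real m - 1) * l ^ 2) \<le> threshold * (2 * threshold)" by (simp add: mult_ac)
      then show ?thesis using th by simp
    qed
    ultimately have ml: "real m * l ^ 2 \<le> 3 * threshold" by (simp add: algebra_simps)
    have "4 * \<sigma>\<^sup>2 * (1 + l) = 128 * (real m * (1 + l)\<^sup>2) * (D / \<epsilon>\<^sup>2)"
      unfolding sigma l_def[symmetric] by (simp add: power2_eq_square)
    also have "\<dots> \<le> 128 * (real m * (3 * l)\<^sup>2) * (D / \<epsilon>\<^sup>2)"
      using l D_pos by (intro mult_left_mono mult_right_mono power_mono) auto
    also have "\<dots> = 1152 * (real m * l ^ 2) * (D / \<epsilon>\<^sup>2)" by (simp add: power_mult_distrib)
    also have "\<dots> \<le> 1152 * (3 * threshold) * (D / \<epsilon>\<^sup>2)"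
      using ml D_pos by (intro mult_left_mono mult_right_mono) auto
    finally show ?thesis using False by (simp add: l_def)
  qed
  finally show ?thesis .
qed

text \<open>Union bound. As 27648 is 8 times 3456, the radius satisfies
  \<open>t^2 \<ge> 8 * V * l\<close>, so each pair fails with probability at most
  \<open>2 / n^4\<close>, and all \<open>n^2\<close> pairs together with at most
  \<open>2 / n^2 \<le> 1 / n\<close>.\<close>

lemma noisy_accurate:
  assumes d0: "\<delta> \<le> \<delta>\<^sub>0" "\<delta>\<^sub>0 < 1"
  defines "K \<equiv> sqrt (27648 * (1 + 1 / ln (1 / \<delta>\<^sub>0)))"
  shows "1 - 1 / real n \<le> \<P>(f_hat in distr randomness (output_space G) (noisy w).
    (MAX (u, v)\<in>verts G \<times> verts G. \<bar>f_hat (u, v) - counting_query G w u v\<bar>)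
      \<le> K * (real n powr (1/4) * ln (real n) powr (5/4) * ln (1 / \<delta>) powr (1/2) / \<epsilon>))"
proof (cases "2 \<le> n")
  case False
  \<comment> \<open>For one vertex the required probability is 0.\<close>
  then have "n = 1" using n_pos by simp
  then show ?thesis by simp
next
  case n2: True
  interpret prob_space randomness by (rule prob_space_randomness)
  define l where "l = ln (real n)"
  define t where "t = K * (real n powr (1/4) * l powr (5/4) * ln (1 / \<delta>) powr (1/2) / \<epsilon>)"
  define V where "V = 3456 * threshold * D / \<epsilon>\<^sup>2"
  let ?A = "verts G \<times> verts G" and ?M = "(n + n) * n"
  have l: "0 < l" using n2 by (simp add: l_def)
  have fin: "finite ?A" "?A \<noteq> {}" using n_pos by (auto simp: verts_def)
  have L0: "0 < ln (1 / \<delta>\<^sub>0)" "ln (1 / \<delta>\<^sub>0) \<le> ln (1 / \<delta>)"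
    using d0 del by (auto simp: ln_div)
  have th: "0 < threshold" using l n2 by (simp add: threshold_def l_def[symmetric])
  have V: "0 < V" using th D_pos eps by (simp add: V_def)
  have K: "0 \<le> K" "K\<^sup>2 = 27648 * (1 + 1 / ln (1 / \<delta>\<^sub>0))" using L0 by (simp_all add: K_def)
  have t: "0 \<le> t" using K eps by (simp add: t_def)
  have "8 * V * l \<le> t\<^sup>2"
  proof -
    have a: "(real n powr (1/4) * l powr (5/4))\<^sup>2 = threshold * l"
    proof -
      have "(real n powr (1/4) * l powr (5/4))\<^sup>2 = real n powr (1/2) * l powr (5/2)"
        using n_pos l by (simp add: power_mult_distrib powr_power)
      also have "l powr (5/2) = l powr (3/2) * l powr 1" by (subst powr_add[symmetric]) simp
      also have "real n powr (1/2) * (l powr (3/2) * l powr 1) = (real n * l ^ 3) powr (1/2) * l"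
      proof -
        have "(l ^ 3) powr (1/2) = l powr (3/2)" using l powr_powr[of l 3 "1/2"] by simp
        then show ?thesis using l by (simp add: powr_mult)
      qed
      also have "(real n * l ^ 3) powr (1/2) = threshold"
        using l by (simp add: threshold_def l_def[symmetric] powr_half_sqrt)
      finally show ?thesis .
    qed
    have b: "(ln (1 / \<delta>) powr (1/2))\<^sup>2 = ln (1 / \<delta>)" using L0 by (simp add: powr_power)
    \<comment> \<open>Here the bound on \<open>\<delta>\<close> enters: the summand 1 of
      \<open>D\<close> is absorbed into a multiple of \<open>ln (1 / \<delta>)\<close>.\<close>
    have "D \<le> (1 + 1 / ln (1 / \<delta>\<^sub>0)) * ln (1 / \<delta>)"
    proof -
      have "1 \<le> 1 / ln (1 / \<delta>\<^sub>0) * ln (1 / \<delta>)" using L0 by (simp add: field_simps)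
      then show ?thesis by (simp only: distrib_right mult_1)
    qed
    then have "27648 * (threshold * l / \<epsilon>\<^sup>2) * D \<le> 27648 * (threshold * l / \<epsilon>\<^sup>2) * ((1 + 1 / ln (1 / \<delta>\<^sub>0)) * ln (1 / \<delta>))"
      using th l by (intro mult_left_mono) auto
    also have "\<dots> = K\<^sup>2 * ((real n powr (1/4) * l powr (5/4))\<^sup>2 * (ln (1 / \<delta>) powr (1/2))\<^sup>2 / \<epsilon>\<^sup>2)"
      unfolding K(2) a b by (simp add: mult_ac)
    also have "\<dots> = t\<^sup>2" by (simp add: t_def power_mult_distrib power_divide)
    finally show ?thesis by (simp add: V_def mult_ac)
  qed
  then have e: "exp (- t\<^sup>2 / (2 * V)) \<le> 1 / real n ^ 4"
  proof -
    have "4 * l \<le> t\<^sup>2 / (2 * V)" using \<open>8 * V * l \<le> t\<^sup>2\<close> V by (simp add: field_simps)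
    then have "exp (- t\<^sup>2 / (2 * V)) \<le> exp (- (4 * l))" by simp
    also have "\<dots> = 1 / exp l ^ 4" by (simp add: exp_minus exp_of_nat_mult[symmetric] inverse_eq_divide)
    finally show ?thesis using n_pos by (simp add: l_def)
  qed
  let ?X = "\<lambda>uv. lin_form ?M (noise_vec (fst uv) (snd uv))"
  let ?bad = "\<lambda>uv. {\<omega>. t < \<bar>?X uv \<omega>\<bar>}"
  have bad: "?bad uv \<in> events" for uv
  proof -
    have "{\<omega>\<in>space randomness. t < \<bar>?X uv \<omega>\<bar>} \<in> events" by measurable
    then show ?thesis by simp
  qed
  let ?N = "distr randomness (output_space G) (noisy w)"
  have good: "{f \<in> space ?N. (MAX (u, v)\<in>?A. \<bar>f (u, v) - counting_query G w u v\<bar>) \<le> t}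
      = {f \<in> space (output_space G). \<forall>uv\<in>?A. \<bar>f uv - counting_query G w (fst uv) (snd uv)\<bar> \<le> t}"
    using fin by (auto simp: Max_le_iff)
  have "{f \<in> space (output_space G). \<forall>uv\<in>?A. \<bar>f uv - counting_query G w (fst uv) (snd uv)\<bar> \<le> t} \<in> sets (output_space G)"
  proof (intro sets.sets_Collect_finite_All fin)
    fix uv assume "uv \<in> ?A"
    then have [measurable]: "(\<lambda>f. f uv) \<in> borel_measurable (output_space G)"
      unfolding output_space_def by (rule measurable_component_singleton)
    show "{f \<in> space (output_space G). \<bar>f uv - counting_query G w (fst uv) (snd uv)\<bar> \<le> t} \<in> sets (output_space G)"
      by measurable
  qed
  then have "measure ?N {f \<in> space ?N. (MAX (u, v)\<in>?A. \<bar>f (u, v) - counting_query G w u v\<bar>) \<le> t}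
      = prob (noisy w -` {f \<in> space (output_space G). \<forall>uv\<in>?A. \<bar>f uv - counting_query G w (fst uv) (snd uv)\<bar> \<le> t} \<inter> space randomness)"
    unfolding good by (subst measure_distr) simp_all
  also have "noisy w -` {f \<in> space (output_space G). \<forall>uv\<in>?A. \<bar>f uv - counting_query G w (fst uv) (snd uv)\<bar> \<le> t} \<inter> space randomness
      = space randomness - (\<Union>uv\<in>?A. ?bad uv)"
  proof -
    have "noisy w \<omega> \<in> space (output_space G)" for \<omega>
      using measurable_space[OF noisy_measurable[of w]] by simp
    moreover have "(\<forall>uv\<in>?A. \<bar>noisy w \<omega> uv - counting_query G w (fst uv) (snd uv)\<bar> \<le> t) \<longleftrightarrow> (\<forall>uv\<in>?A. \<omega> \<notin> ?bad uv)" for \<omega>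
      by (intro ball_cong refl) (auto simp: noisy_def)
    ultimately show ?thesis by auto
  qed
  also have "prob \<dots> = 1 - prob (\<Union>uv\<in>?A. ?bad uv)"
    using bad fin by (intro prob_compl sets.finite_UN) auto
  finally have eq: "measure ?N {f \<in> space ?N. (MAX (u, v)\<in>?A. \<bar>f (u, v) - counting_query G w u v\<bar>) \<le> t}
      = 1 - prob (\<Union>uv\<in>?A. ?bad uv)" .
  have "prob (\<Union>uv\<in>?A. ?bad uv) \<le> (\<Sum>uv\<in>?A. prob (?bad uv))"
    using bad fin by (intro finite_measure_subadditive_finite) auto
  also have "(\<Sum>uv\<in>?A. prob (?bad uv)) \<le> (\<Sum>uv\<in>?A. 2 * (1 / real n ^ 4))"
  proof (intro sum_mono)
    fix uv assume uv: "uv \<in> ?A"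
    have "prob (?bad uv) \<le> 2 * exp (- t\<^sup>2 / (2 * V))"
      using sq_norm_noise_vec_le[OF n2, of "fst uv" "snd uv"] uv V t
      by (intro gaussian_tail) (auto simp: V_def verts_def)
    then show "prob (?bad uv) \<le> 2 * (1 / real n ^ 4)" using e by linarith
  qed
  also have "\<dots> = 2 / real n * (1 / real n)"
    using n_pos by (simp add: verts_def card_cartesian_product power4_eq_xxxx field_simps)
  also have "\<dots> \<le> 1 * (1 / real n)" using n2 by (intro mult_right_mono) auto
  finally show ?thesis using eq by (simp add: t_def l_def)
qed

end

section \<open>The complete program\<close>

definition algorithm :: prog where
  "algorithm = phase1 ;; phase2"

lemma wellformed_algorithm: "wellformed algorithm"
  by (simp add: algorithm_def wellformed_phase1 wellformed_phase2)

text \<open>The noise parameters are chosen before \<open>w\<close>: one structure describes the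
  outputs for all attribute functions, which is what allows neighbors to be compared.\<close>

lemma estimates_algorithm:
  assumes G: "wf_graph G" "unique_shortest_paths G" and eps: "0 < \<epsilon>" "\<epsilon> < 1" and del: "0 < \<delta>" "\<delta> < 1"
  obtains pos hit m \<sigma> \<tau> where "calibrated_noise G pos hit m \<sigma> \<tau> \<epsilon> \<delta>"
    "\<And>w. estimates (compile algorithm) \<epsilon> \<delta> G w = calibrated_noise.noisy G pos hit \<sigma> \<tau> w"
proof -
  interpret usp_graph G using G by unfold_locales
  \<comment> \<open>A reference run with zero attributes and zero randomness. By noninterference
    every actual first phase ends in the same state except for \<open>attr\<close>.\<close>
  define s0 where "s0 = initial_state \<epsilon> \<delta> G (\<lambda>_. 0)"
  define s1 where "s1 = sem (\<lambda>_. 0) phase1 s0"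
  note ph1 = sem_phase1[OF eps(1) del, where w = "\<lambda>_. 0" and \<omega> = "\<lambda>_. 0", folded s0_def, folded s1_def]
  let ?pos = "\<lambda>s u. nmem s1 ''pos'' [s, u]" and ?hit = "\<lambda>u v. nmem s1 ''hit'' [u, v]"
  let ?m = "nmem s1 ''m'' []" and ?\<sigma> = "rmem s1 ''sig'' []" and ?\<tau> = "rmem s1 ''tau'' []"
  interpret ns: noise_structure G ?pos ?hit ?m ?\<sigma> ?\<tau> by (rule ph1(3))
  have cal: "calibrated_noise G ?pos ?hit ?m ?\<sigma> ?\<tau> \<epsilon> \<delta>"
    using ph1(4-7) eps del by unfold_locales auto
  interpret cn: calibrated_noise G ?pos ?hit ?m ?\<sigma> ?\<tau> \<epsilon> \<delta> by (rule cal)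
  have est: "estimates (compile algorithm) \<epsilon> \<delta> G w \<omega> = cn.noisy w \<omega>" for w \<omega>
  proof -
    define W where "W i = (if \<exists>u v. i = [u, v] \<and> {u, v} \<in> edges G then w (set i) else 0)" for i
    have init: "initial_state \<epsilon> \<delta> G w = set_attr W s0"
      by (auto simp: initial_state_def set_attr_def s0_def W_def fun_eq_iff)
    define t1 where "t1 = set_attr W s1"
    have "sem \<omega> phase1 (initial_state \<epsilon> \<delta> G w) = t1"
      unfolding init t1_def s1_def by (rule sem_set_attr[OF public_phase1])
    then have fin: "final_state \<omega> (compile algorithm) (initial_state \<epsilon> \<delta> G w) = sem \<omega> phase2 t1"
      by (simp add: final_state_compile[OF wellformed_algorithm]) (simp add: algorithm_def)
    have par: "ns.params t1"
      using ph1(1,2) by (auto simp: ns.params_def t1_def rmem_set_attr paths_known_def)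
    have zero: "rmem t1 ''out'' [u, v] = 0" for u v
    proof -
      have "rmem s1 ''out'' = rmem s0 ''out''"
        unfolding s1_def by (rule sem_rmem_frame) (simp add: phase1_def phase1_defs)
      then show ?thesis by (simp add: t1_def rmem_set_attr s0_def initial_state_def)
    qed
    have dr: "drawn t1 = 0"
      by (simp add: t1_def s1_def public_drawn[OF public_phase1]) (simp add: s0_def initial_state_def)
    have attr: "rmem t1 ''attr'' [x, y] = w {x, y}" if "{x, y} \<in> edges G" for x y
      using that by (auto simp: t1_def rmem_set_attr W_def)
    show ?thesis
      unfolding estimates_def cn.noisy_def fin
      using ns.sem_phase2[OF par zero dr attr] by (auto simp: fun_eq_iff restrict_def verts_def)
  qed
  show thesis by (rule that[OF cal]) (simp add: est fun_eq_iff)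
qed

text \<open>The noise is calibrated to \<open>ln (1 / \<delta>) + 1\<close>, whereas the bound
  contains only \<open>ln (1 / \<delta>)\<close>, which tends to 0 as \<open>\<delta>\<close> tends
  to 1. A fixed \<open>\<delta>\<^sub>0\<close> below 1 lets the constant absorb the difference
  uniformly. The same program is the witness for all parameters, which it reads from memory.\<close>

theorem theorem4p1:
  fixes \<delta>\<^sub>0 :: real
  assumes "0 < \<delta>\<^sub>0" and "\<delta>\<^sub>0 < 1"
  shows "\<exists>K::real. \<forall>\<epsilon> \<delta> :: real. 0 < \<epsilon> \<and> \<epsilon> < 1 \<and> 0 < \<delta> \<and> \<delta> \<le> \<delta>\<^sub>0 \<longrightarrow>
    (\<exists>\<A> :: com. polynomial_time \<A> \<epsilon> \<delta> \<and>
      (\<forall>G. wf_graph G \<and> unique_shortest_paths G \<longrightarrow>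
        differentially_private \<epsilon> \<delta> G (mechanism \<A> \<epsilon> \<delta> G) \<and>
        (\<forall>w. is_attribute G w \<longrightarrow>
          \<P>(f_hat in mechanism \<A> \<epsilon> \<delta> G w.
             (MAX (u, v)\<in>verts G \<times> verts G. \<bar>f_hat (u, v) - counting_query G w u v\<bar>)
               \<le> K * (real (nverts G) powr (1/4) * ln (real (nverts G)) powr (5/4)
                       * ln (1 / \<delta>) powr (1/2) / \<epsilon>))
            \<ge> 1 - 1 / real (nverts G))))"
proof (intro exI[of _ "sqrt (27648 * (1 + 1 / ln (1 / \<delta>\<^sub>0)))"] allI impI)
  fix \<epsilon> \<delta> :: real
  assume "0 < \<epsilon> \<and> \<epsilon> < 1 \<and> 0 < \<delta> \<and> \<delta> \<le> \<delta>\<^sub>0"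
  then have eps: "0 < \<epsilon>" "\<epsilon> < 1" and del: "0 < \<delta>" "\<delta> < 1" and d0: "\<delta> \<le> \<delta>\<^sub>0" using assms by auto
  let ?A = "compile algorithm"
  have poly: "polynomial_time ?A \<epsilon> \<delta>"
    unfolding polynomial_time_def
  proof (intro exI[of _ "steps algorithm"] allI impI conjI)
    fix G w assume "wf_graph G \<and> unique_shortest_paths G \<and> is_attribute G w"
    then obtain pos hit m \<sigma> \<tau> where cal: "calibrated_noise G pos hit m \<sigma> \<tau> \<epsilon> \<delta>"
      "\<And>w. estimates ?A \<epsilon> \<delta> G w = calibrated_noise.noisy G pos hit \<sigma> \<tau> w"
      using estimates_algorithm[of G, OF _ _ eps del] by blast
    show "estimates ?A \<epsilon> \<delta> G w \<in> measurable randomness (output_space G)"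
      unfolding cal(2) by (rule calibrated_noise.noisy_measurable[OF cal(1)])
    fix \<omega>
    have "nmem (initial_state \<epsilon> \<delta> G w) ''n'' [] = nverts G" by (simp add: initial_state_def)
    then show "\<exists>t s'. exec \<omega> ?A (initial_state \<epsilon> \<delta> G w) t s' \<and> t \<le> poly (steps algorithm) (nverts G)"
      using exec_compile[OF wellformed_algorithm, of "initial_state \<epsilon> \<delta> G w" \<omega>] by auto
  qed
  show "\<exists>\<A> :: com. polynomial_time \<A> \<epsilon> \<delta> \<and>
      (\<forall>G. wf_graph G \<and> unique_shortest_paths G \<longrightarrow>
        differentially_private \<epsilon> \<delta> G (mechanism \<A> \<epsilon> \<delta> G) \<and>
        (\<forall>w. is_attribute G w \<longrightarrow>
          \<P>(f_hat in mechanism \<A> \<epsilon> \<delta> G w.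
             (MAX (u, v)\<in>verts G \<times> verts G. \<bar>f_hat (u, v) - counting_query G w u v\<bar>)
               \<le> sqrt (27648 * (1 + 1 / ln (1 / \<delta>\<^sub>0))) * (real (nverts G) powr (1/4) * ln (real (nverts G)) powr (5/4)
                       * ln (1 / \<delta>) powr (1/2) / \<epsilon>))
            \<ge> 1 - 1 / real (nverts G)))"
  proof (intro exI[of _ ?A] conjI allI impI poly)
    fix G assume "wf_graph G \<and> unique_shortest_paths G"
    then obtain pos hit m \<sigma> \<tau> where cal: "calibrated_noise G pos hit m \<sigma> \<tau> \<epsilon> \<delta>"
      "\<And>w. estimates ?A \<epsilon> \<delta> G w = calibrated_noise.noisy G pos hit \<sigma> \<tau> w"
      using estimates_algorithm[of G, OF _ _ eps del] by blast
    have mech: "mechanism ?A \<epsilon> \<delta> G = (\<lambda>w. distr randomness (output_space G) (calibrated_noise.noisy G pos hit \<sigma> \<tau> w))"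
      by (simp add: mechanism_def cal(2) fun_eq_iff)
    show "differentially_private \<epsilon> \<delta> G (mechanism ?A \<epsilon> \<delta> G)"
      unfolding mech by (rule calibrated_noise.noisy_private[OF cal(1)])
    fix w assume "is_attribute G w"
    show "\<P>(f_hat in mechanism ?A \<epsilon> \<delta> G w.
             (MAX (u, v)\<in>verts G \<times> verts G. \<bar>f_hat (u, v) - counting_query G w u v\<bar>)
               \<le> sqrt (27648 * (1 + 1 / ln (1 / \<delta>\<^sub>0))) * (real (nverts G) powr (1/4) * ln (real (nverts G)) powr (5/4)
                       * ln (1 / \<delta>) powr (1/2) / \<epsilon>))
            \<ge> 1 - 1 / real (nverts G)"
      unfolding mech by (rule calibrated_noise.noisy_accurate[OF cal(1) d0 assms(2)])
  qed
qed

end
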